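(* Let $L$ be a graded vector space over a field of characteristic $0$. There is a one-to-one correspondence between compatible $L_\infty$-algebra structures on $L$ and Maurer-Cartan elements in the graded Lie algebra $(\mathrm{Coder}^\bullet_c(SV),\llbracket~,~\rrbracket)$, where $V=s^{-1}L$.
   Context: Signs and shuffles: for $\sigma\in S_n$ and homogeneous elements $x_1,\dots,x_n$, $\epsilon(\sigma)$ is the Koszul sign, defined by $x_{\sigma(1)}\odot\cdots\odot x_{\sigma(n)}=\epsilon(\sigma)\,x_1\odot\cdots\odot x_n$ in the graded symmetric algebra, and $\chi(\sigma)=(-1)^\sigma\epsilon(\sigma)$. $Sh(i,n-i)$ is the set of $\sigma\in S_n$ with $\sigma(1)<\cdots<\sigma(i)$ and $\sigma(i+1)<\cdots<\sigma(n)$. A graded multilinear map $f$ is skew-symmetric if permuting its arguments by $\sigma$ multiplies the value by $\chi(\sigma)$. $L_\infty$-algebra: a graded vector space $L=\oplus_{i\in\mathbb{Z}}L_i$ with graded skew-symmetric multilinear maps $l_k:L^{\otimes k}\to L$ of degree $2-k$, $k\ge1$, such that for all $n\ge1$ and homogeneous $x_1,\dots,x_n\in L$, $$\sum_{i+j=n+1}\ \sum_{\sigma\in Sh(i,n-i)}\chi(\sigma)(-1)^{i(j-1)}\,l_j\big(l_i(x_{\sigma(1)},\dots,x_{\sigma(i)}),x_{\sigma(i+1)},\dots,x_{\sigma(n)}\big)=0.$$ Compatible $L_\infty$-algebra: a triple $(L,\{l_k\}_{k\ge1},\{l'_k\}_{k\ge1})$ where $(L,\{l_k\}_{k\ge1})$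 and $(L,\{l'_k\}_{k\ge1})$ are $L_\infty$-algebras and for all $n\ge1$ and homogeneous $x_1,\dots,x_n\in L$, $$\sum_{i+j=n+1}\ \sum_{\sigma\in Sh(i,n-i)}\chi(\sigma)(-1)^{i(j-1)}\Big\{l_j\big(l'_i(x_{\sigma(1)},\dots,x_{\sigma(i)}),x_{\sigma(i+1)},\dots,x_{\sigma(n)}\big)+l'_j\big(l_i(x_{\sigma(1)},\dots,x_{\sigma(i)}),x_{\sigma(i+1)},\dots,x_{\sigma(n)}\big)\Big\}=0.$$ The pair $(\{l_k\}_{k\ge1},\{l'_k\}_{k\ge1})$ is then called a compatible $L_\infty$-algebra structure on $L$. Coderivations: $V=s^{-1}L$ is the desuspension of $L$, $V_i=L_{i+1}$. $SV$ is the symmetric coalgebra on $V$; $\mathrm{Coder}^n(SV)$ is the space of degree $n$ coderivations on $SV$, and $\mathrm{Coder}^\bullet(SV)$ is a graded Lie algebra with the (graded) commutator bracket $[~,~]_C$. The graded Lie algebra $\mathrm{Coder}^\bullet_c(SV)=\oplus_{n\ge0}\mathrm{Coder}^n_c(SV)$: $\mathrm{Coder}^n_c(SV)$ is the direct sum of $n+1$ copies of $\mathrm{Coder}^n(SV)$, and for $(D_1,\dots,D_{m+1})\in\mathrm{Coder}^m_c(SV)$, $(D'_1,\dots,D'_{n+1})\in\mathrm{Coder}^n_c(SV)$, the $i$-th component ($1\le i\le m+n+1$) of $\llbracket(D_1,\dots,D_{m+1}),(D'_1,\dots,D'_{n+1})\rrbracket$ is $\sum_{p+q=i+1,\,1\le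 p\le m+1,\,1\le q\le n+1}[D_p,D'_q]_C$. A Maurer-Cartan element of a graded Lie algebra $(\mathfrak{g},[~,~])$ is a degree $1$ element $\theta$ with $[\theta,\theta]=0$. *)

theory Defs
  imports
    Complex_Main
    "HOL-Library.FuncSet"
    "HOL-Library.Set_Algebras"
    "HOL-Library.Poly_Mapping"
    "HOL-Combinatorics.Permutations"
begin

section \<open>Graded vector spaces, shuffles and signs\<close>

definition graded_vector_space ::
  "('k::field \<Rightarrow> 'v::ab_group_add \<Rightarrow> 'v) \<Rightarrow> (int \<Rightarrow> 'v set) \<Rightarrow> bool" where
  "graded_vector_space s L \<longleftrightarrow>
     vector_space s \<and> (\<forall>i. module.subspace s (L i)) \<and>
     (\<forall>x. \<exists>!c. (\<forall>i. c i \<in> L i) \<and> finite {i. c i \<noteq> 0} \<and> x = (\<Sum>i | c i \<noteq> 0. c i))"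

text \<open>Desuspension: \<open>(s\<^sup>-\<^sup>1 L)\<^sub>i = L\<^sub>i\<^sub>+\<^sub>1\<close>, on the same underlying vector space, so that the
  degree \<open>-1\<close> map \<open>s\<^sup>-\<^sup>1 : L \<rightarrow> s\<^sup>-\<^sup>1 L\<close> is the identity on elements.\<close>

definition desusp :: "(int \<Rightarrow> 'v set) \<Rightarrow> int \<Rightarrow> 'v set" where
  "desusp L i = L (i + 1)"

text \<open>\<open>xs\<close> is a list of homogeneous elements of degrees \<open>ds\<close>.  Degrees are carried along
  explicitly since \<open>0\<close> lies in every component.\<close>

definition homog :: "(int \<Rightarrow> 'v set) \<Rightarrow> int list \<Rightarrow> 'v list \<Rightarrow> bool" where
  "homog L ds xs \<longleftrightarrow> list_all2 (\<lambda>d x. x \<in> L d) ds xs"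

text \<open>Argument positions are \<open>0, \<dots>, n - 1\<close>, and
  \<open>permute_list \<sigma> [x\<^sub>0, \<dots>] = [x\<^bsub>\<sigma> 0\<^esub>, \<dots>]\<close>.\<close>

definition shuffle_perms :: "nat \<Rightarrow> nat \<Rightarrow> (nat \<Rightarrow> nat) set" where
  "shuffle_perms i m =
     {\<sigma>. \<sigma> permutes {..<i + m} \<and> strict_mono_on {..<i} \<sigma> \<and> strict_mono_on {i..<i + m} \<sigma>}"

text \<open>The Koszul sign of \<open>\<sigma>\<close> on elements of degrees \<open>ds\<close>: each pair that has to be
  interchanged to sort \<open>x\<^bsub>\<sigma> 0\<^esub> \<odot> \<dots> \<odot> x\<^bsub>\<sigma> (n-1)\<^esub>\<close> contributes \<open>(-1)\<close> to the product of its
  degrees.  The identity that characterises it in the symmetric algebra is lemma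
  \<open>sym_mon_permute\<close> below.\<close>

definition koszul_sign :: "int list \<Rightarrow> (nat \<Rightarrow> nat) \<Rightarrow> 'k::field" where
  "koszul_sign ds \<sigma> =
     (\<Prod>(a, b)\<in>{(a, b). a < b \<and> b < length ds \<and> \<sigma> b < \<sigma> a}. (-1) powi (ds ! \<sigma> a * ds ! \<sigma> b))"

definition skew_koszul_sign :: "int list \<Rightarrow> (nat \<Rightarrow> nat) \<Rightarrow> 'k::field" where
  "skew_koszul_sign ds \<sigma> = of_int (sign \<sigma>) * koszul_sign ds \<sigma>"


section \<open>Compatible L-infinity algebras\<close>

text \<open>A family \<open>{l\<^sub>k}\<close>, \<open>k \<ge> 1\<close>, is a function \<open>l\<close> with \<open>l k [x\<^sub>1, \<dots>, x\<^sub>k] = l\<^sub>k(x\<^sub>1, \<dots>, x\<^sub>k)\<close>.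
  The first conjunct of \<open>skew_maps\<close> normalises the meaningless values, so that equal families
  are equal functions.\<close>

definition multilinear_on_lists ::
  "('k::field \<Rightarrow> 'v::ab_group_add \<Rightarrow> 'v) \<Rightarrow> nat \<Rightarrow> ('v list \<Rightarrow> 'v) \<Rightarrow> bool" where
  "multilinear_on_lists s k f \<longleftrightarrow>
     (\<forall>us ws x y c. length us + 1 + length ws = k \<longrightarrow>
        f (us @ (x + y) # ws) = f (us @ x # ws) + f (us @ y # ws) \<and>
        f (us @ s c x # ws) = s c (f (us @ x # ws)))"

definition skew_maps ::
  "('k::field \<Rightarrow> 'v::ab_group_add \<Rightarrow> 'v) \<Rightarrow> (int \<Rightarrow> 'v set) \<Rightarrow> (nat \<Rightarrow> 'v list \<Rightarrow> 'v) \<Rightarrow> bool" where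
  "skew_maps s L l \<longleftrightarrow>
     (\<forall>k xs. \<not> (1 \<le> k \<and> length xs = k) \<longrightarrow> l k xs = 0) \<and>
     (\<forall>k\<ge>1. multilinear_on_lists s k (l k) \<and>
        (\<forall>ds xs. length xs = k \<and> homog L ds xs \<longrightarrow>
           l k xs \<in> L (sum_list ds + 2 - int k) \<and>
           (\<forall>\<sigma>. \<sigma> permutes {..<k} \<longrightarrow>
              l k (permute_list \<sigma> xs) = s (skew_koszul_sign ds \<sigma>) (l k xs))))"

definition L_infinity_algebra ::
  "('k::field \<Rightarrow> 'v::ab_group_add \<Rightarrow> 'v) \<Rightarrow> (int \<Rightarrow> 'v set) \<Rightarrow> (nat \<Rightarrow> 'v list \<Rightarrow> 'v) \<Rightarrow> bool" where
  "L_infinity_algebra s L l \<longleftrightarrow>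
     skew_maps s L l \<and>
     (\<forall>n\<ge>1. \<forall>ds xs. length xs = n \<and> homog L ds xs \<longrightarrow>
        (\<Sum>(i, j)\<in>{(i, j). 1 \<le> i \<and> 1 \<le> j \<and> i + j = n + 1}.
          \<Sum>\<sigma>\<in>shuffle_perms i (n - i).
            let ys = permute_list \<sigma> xs
            in s (skew_koszul_sign ds \<sigma> * (-1) ^ (i * (j - 1)))
                 (l j (l i (take i ys) # drop i ys))) = 0)"

definition compatible_L_infinity_algebra ::
  "('k::field \<Rightarrow> 'v::ab_group_add \<Rightarrow> 'v) \<Rightarrow> (int \<Rightarrow> 'v set) \<Rightarrow>
   (nat \<Rightarrow> 'v list \<Rightarrow> 'v) \<Rightarrow> (nat \<Rightarrow> 'v list \<Rightarrow> 'v) \<Rightarrow> bool" where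
  "compatible_L_infinity_algebra s L l l' \<longleftrightarrow>
     L_infinity_algebra s L l \<and> L_infinity_algebra s L l' \<and>
     (\<forall>n\<ge>1. \<forall>ds xs. length xs = n \<and> homog L ds xs \<longrightarrow>
        (\<Sum>(i, j)\<in>{(i, j). 1 \<le> i \<and> 1 \<le> j \<and> i + j = n + 1}.
          \<Sum>\<sigma>\<in>shuffle_perms i (n - i).
            let ys = permute_list \<sigma> xs
            in s (skew_koszul_sign ds \<sigma> * (-1) ^ (i * (j - 1)))
                 (l j (l' i (take i ys) # drop i ys) + l' j (l i (take i ys) # drop i ys))) = 0)"


section \<open>Quotients of free vector spaces and tensor products\<close>

text \<open>The free vector space on \<open>'x\<close> is \<open>'x \<Rightarrow>\<^sub>0 'k\<close>.  A quotient of (a subspace of) it by a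
  subspace \<open>K\<close> is a set \<open>Q\<close> of cosets \<open>f +o K\<close>; cosets are added as sets, and \<open>K\<close> is the zero.\<close>

definition pscale :: "'k::field \<Rightarrow> ('x \<Rightarrow>\<^sub>0 'k) \<Rightarrow> ('x \<Rightarrow>\<^sub>0 'k)" where
  "pscale c = Poly_Mapping.map ((*) c)"

definition coset_scale :: "('x \<Rightarrow>\<^sub>0 'k::field) set \<Rightarrow> 'k \<Rightarrow> ('x \<Rightarrow>\<^sub>0 'k) set \<Rightarrow> ('x \<Rightarrow>\<^sub>0 'k) set" where
  "coset_scale K c A = pscale c ` A + K"

definition coset_hom ::
  "('x \<Rightarrow>\<^sub>0 'k::field) set set \<Rightarrow> ('x \<Rightarrow>\<^sub>0 'k) set \<Rightarrow> ('y \<Rightarrow>\<^sub>0 'k) set set \<Rightarrow> ('y \<Rightarrow>\<^sub>0 'k) set \<Rightarrow>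
   (('x \<Rightarrow>\<^sub>0 'k) set \<Rightarrow> ('y \<Rightarrow>\<^sub>0 'k) set) set" where
  "coset_hom Q K Q' K' =
     {\<phi> \<in> Q \<rightarrow>\<^sub>E Q'. (\<forall>A\<in>Q. \<forall>B\<in>Q. \<phi> (A + B) = \<phi> A + \<phi> B) \<and>
                   (\<forall>c. \<forall>A\<in>Q. \<phi> (coset_scale K c A) = coset_scale K' c (\<phi> A))}"

definition tensor_rels ::
  "('x \<Rightarrow>\<^sub>0 'k::field) set set \<Rightarrow> ('x \<Rightarrow>\<^sub>0 'k) set \<Rightarrow>
   ((('x \<Rightarrow>\<^sub>0 'k) set \<times> ('x \<Rightarrow>\<^sub>0 'k) set) \<Rightarrow>\<^sub>0 'k) set" where
  "tensor_rels Q K =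
     {Poly_Mapping.single (A + B, C) 1 - Poly_Mapping.single (A, C) 1 - Poly_Mapping.single (B, C) 1
       | A B C. A \<in> Q \<and> B \<in> Q \<and> C \<in> Q} \<union>
     {Poly_Mapping.single (A, B + C) 1 - Poly_Mapping.single (A, B) 1 - Poly_Mapping.single (A, C) 1
       | A B C. A \<in> Q \<and> B \<in> Q \<and> C \<in> Q} \<union>
     {Poly_Mapping.single (coset_scale K c A, B) 1 - Poly_Mapping.single (A, B) c
       | A B c. A \<in> Q \<and> B \<in> Q} \<union>
     {Poly_Mapping.single (A, coset_scale K c B) 1 - Poly_Mapping.single (A, B) c
       | A B c. A \<in> Q \<and> B \<in> Q}"

definition tensor_ker ::
  "('x \<Rightarrow>\<^sub>0 'k::field) set set \<Rightarrow> ('x \<Rightarrow>\<^sub>0 'k) set \<Rightarrow>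
   ((('x \<Rightarrow>\<^sub>0 'k) set \<times> ('x \<Rightarrow>\<^sub>0 'k) set) \<Rightarrow>\<^sub>0 'k) set" where
  "tensor_ker Q K = module.span pscale (tensor_rels Q K)"

definition tensor_space ::
  "('x \<Rightarrow>\<^sub>0 'k::field) set set \<Rightarrow> ('x \<Rightarrow>\<^sub>0 'k) set \<Rightarrow>
   ((('x \<Rightarrow>\<^sub>0 'k) set \<times> ('x \<Rightarrow>\<^sub>0 'k) set) \<Rightarrow>\<^sub>0 'k) set set" where
  "tensor_space Q K = {h +o tensor_ker Q K | h. Poly_Mapping.keys h \<subseteq> Q \<times> Q}"


section \<open>The symmetric coalgebra\<close>

text \<open>The symmetric coalgebra of the graded vector space \<open>V\<close> is the reduced one,
  \<open>SV = \<Oplus>\<^bsub>n \<ge> 1\<^esub> S\<^sup>n V\<close>: the non-unital tensor algebra (words of length at least one modulo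
  multilinearity) modulo \<open>x \<otimes> y = (-1)\<^bsup>|x||y|\<^esup> y \<otimes> x\<close>.\<close>

definition sym_rels ::
  "('k::field \<Rightarrow> 'v::ab_group_add \<Rightarrow> 'v) \<Rightarrow> (int \<Rightarrow> 'v set) \<Rightarrow> ('v list \<Rightarrow>\<^sub>0 'k) set" where
  "sym_rels s V =
     {Poly_Mapping.single (us @ (x + y) # ws) 1
        - Poly_Mapping.single (us @ x # ws) 1 - Poly_Mapping.single (us @ y # ws) 1
       | us ws x y. True} \<union>
     {Poly_Mapping.single (us @ s c x # ws) 1 - Poly_Mapping.single (us @ x # ws) c
       | us ws x c. True} \<union>
     {Poly_Mapping.single (us @ x # y # ws) 1
        - Poly_Mapping.single (us @ y # x # ws) ((-1) powi (p * q))
       | us ws x y p q. x \<in> V p \<and> y \<in> V q}"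

definition sym_ker ::
  "('k::field \<Rightarrow> 'v::ab_group_add \<Rightarrow> 'v) \<Rightarrow> (int \<Rightarrow> 'v set) \<Rightarrow> ('v list \<Rightarrow>\<^sub>0 'k) set" where
  "sym_ker s V = module.span pscale (sym_rels s V)"

definition sym_space ::
  "('k::field \<Rightarrow> 'v::ab_group_add \<Rightarrow> 'v) \<Rightarrow> (int \<Rightarrow> 'v set) \<Rightarrow> ('v list \<Rightarrow>\<^sub>0 'k) set set" where
  "sym_space s V = {f +o sym_ker s V | f. [] \<notin> Poly_Mapping.keys f}"

definition sym_mon ::
  "('k::field \<Rightarrow> 'v::ab_group_add \<Rightarrow> 'v) \<Rightarrow> (int \<Rightarrow> 'v set) \<Rightarrow> 'v list \<Rightarrow> ('v list \<Rightarrow>\<^sub>0 'k) set" where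
  "sym_mon s V xs = Poly_Mapping.single xs 1 +o sym_ker s V"

definition sym_degree ::
  "('k::field \<Rightarrow> 'v::ab_group_add \<Rightarrow> 'v) \<Rightarrow> (int \<Rightarrow> 'v set) \<Rightarrow> int \<Rightarrow> ('v list \<Rightarrow>\<^sub>0 'k) set set" where
  "sym_degree s V d =
     {f +o sym_ker s V | f. f \<in> module.span pscale
        {Poly_Mapping.single xs 1 | xs. xs \<noteq> [] \<and> (\<exists>ds. homog V ds xs \<and> sum_list ds = d)}}"

abbreviation sym_tensor_ker ::
  "('k::field \<Rightarrow> 'v::ab_group_add \<Rightarrow> 'v) \<Rightarrow> (int \<Rightarrow> 'v set) \<Rightarrow>
   ((('v list \<Rightarrow>\<^sub>0 'k) set \<times> ('v list \<Rightarrow>\<^sub>0 'k) set) \<Rightarrow>\<^sub>0 'k) set" where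
  "sym_tensor_ker s V \<equiv> tensor_ker (sym_space s V) (sym_ker s V)"

abbreviation sym_tensor_space ::
  "('k::field \<Rightarrow> 'v::ab_group_add \<Rightarrow> 'v) \<Rightarrow> (int \<Rightarrow> 'v set) \<Rightarrow>
   ((('v list \<Rightarrow>\<^sub>0 'k) set \<times> ('v list \<Rightarrow>\<^sub>0 'k) set) \<Rightarrow>\<^sub>0 'k) set set" where
  "sym_tensor_space s V \<equiv> tensor_space (sym_space s V) (sym_ker s V)"

text \<open>The linear map with
  \<open>\<Delta>(x\<^sub>1 \<odot> \<dots> \<odot> x\<^sub>n) = \<Sum>\<^bsub>0 < i < n\<^esub> \<Sum>\<^bsub>\<sigma> \<in> Sh(i, n-i)\<^esub>
     \<epsilon>(\<sigma>) (x\<^bsub>\<sigma> 1\<^esub> \<odot> \<dots> \<odot> x\<^bsub>\<sigma> i\<^esub>) \<otimes> (x\<^bsub>\<sigma> (i+1)\<^esub> \<odot> \<dots> \<odot> x\<^bsub>\<sigma> n\<^esub>)\<close>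
  on homogeneous elements of \<open>V\<close>.\<close>

definition sym_coproduct ::
  "('k::field \<Rightarrow> 'v::ab_group_add \<Rightarrow> 'v) \<Rightarrow> (int \<Rightarrow> 'v set) \<Rightarrow>
   ('v list \<Rightarrow>\<^sub>0 'k) set \<Rightarrow> ((('v list \<Rightarrow>\<^sub>0 'k) set \<times> ('v list \<Rightarrow>\<^sub>0 'k) set) \<Rightarrow>\<^sub>0 'k) set" where
  "sym_coproduct s V = (THE \<Delta>.
     \<Delta> \<in> coset_hom (sym_space s V) (sym_ker s V) (sym_tensor_space s V) (sym_tensor_ker s V) \<and>
     (\<forall>ds xs. xs \<noteq> [] \<and> homog V ds xs \<longrightarrow>
        \<Delta> (sym_mon s V xs) =
          (\<Sum>i\<in>{1..<length xs}. \<Sum>\<sigma>\<in>shuffle_perms i (length xs - i).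
             let ys = permute_list \<sigma> xs
             in Poly_Mapping.single (sym_mon s V (take i ys), sym_mon s V (drop i ys))
                  (koszul_sign ds \<sigma>)) +o sym_tensor_ker s V))"


section \<open>Coderivations\<close>

text \<open>\<open>D \<otimes> 1 + 1 \<otimes> D\<close> for \<open>D\<close> of degree \<open>n\<close>, where
  \<open>(1 \<otimes> D)(a \<otimes> b) = (-1)\<^bsup>n|a|\<^esup> a \<otimes> D b\<close>.\<close>

definition tensor_coder ::
  "('k::field \<Rightarrow> 'v::ab_group_add \<Rightarrow> 'v) \<Rightarrow> (int \<Rightarrow> 'v set) \<Rightarrow> int \<Rightarrow>
   (('v list \<Rightarrow>\<^sub>0 'k) set \<Rightarrow> ('v list \<Rightarrow>\<^sub>0 'k) set) \<Rightarrow>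
   ((('v list \<Rightarrow>\<^sub>0 'k) set \<times> ('v list \<Rightarrow>\<^sub>0 'k) set) \<Rightarrow>\<^sub>0 'k) set \<Rightarrow>
   ((('v list \<Rightarrow>\<^sub>0 'k) set \<times> ('v list \<Rightarrow>\<^sub>0 'k) set) \<Rightarrow>\<^sub>0 'k) set" where
  "tensor_coder s V n D = (THE T.
     T \<in> coset_hom (sym_tensor_space s V) (sym_tensor_ker s V)
                    (sym_tensor_space s V) (sym_tensor_ker s V) \<and>
     (\<forall>a. \<forall>A\<in>sym_degree s V a. \<forall>B\<in>sym_space s V.
        T (Poly_Mapping.single (A, B) 1 +o sym_tensor_ker s V) =
          (Poly_Mapping.single (D A, B) 1 + Poly_Mapping.single (A, D B) ((-1) powi (n * a)))
            +o sym_tensor_ker s V))"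

definition Coder ::
  "('k::field \<Rightarrow> 'v::ab_group_add \<Rightarrow> 'v) \<Rightarrow> (int \<Rightarrow> 'v set) \<Rightarrow> int \<Rightarrow>
   (('v list \<Rightarrow>\<^sub>0 'k) set \<Rightarrow> ('v list \<Rightarrow>\<^sub>0 'k) set) set" where
  "Coder s V n =
     {D \<in> coset_hom (sym_space s V) (sym_ker s V) (sym_space s V) (sym_ker s V).
        (\<forall>d. \<forall>A\<in>sym_degree s V d. D A \<in> sym_degree s V (d + n)) \<and>
        (\<forall>A\<in>sym_space s V.
           sym_coproduct s V (D A) = tensor_coder s V n D (sym_coproduct s V A))}"

definition coder_bracket ::
  "('k::field \<Rightarrow> 'v::ab_group_add \<Rightarrow> 'v) \<Rightarrow> (int \<Rightarrow> 'v set) \<Rightarrow> int \<Rightarrow> int \<Rightarrow>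
   (('v list \<Rightarrow>\<^sub>0 'k) set \<Rightarrow> ('v list \<Rightarrow>\<^sub>0 'k) set) \<Rightarrow>
   (('v list \<Rightarrow>\<^sub>0 'k) set \<Rightarrow> ('v list \<Rightarrow>\<^sub>0 'k) set) \<Rightarrow>
   ('v list \<Rightarrow>\<^sub>0 'k) set \<Rightarrow> ('v list \<Rightarrow>\<^sub>0 'k) set" where
  "coder_bracket s V m n D D' =
     (\<lambda>A\<in>sym_space s V. D (D' A) + coset_scale (sym_ker s V) (- ((-1) powi (m * n))) (D' (D A)))"

text \<open>An element of \<open>Coder\<^sup>n\<^sub>c(SV)\<close> is the list of its \<open>n + 1\<close> components.\<close>

definition Coder_c ::
  "('k::field \<Rightarrow> 'v::ab_group_add \<Rightarrow> 'v) \<Rightarrow> (int \<Rightarrow> 'v set) \<Rightarrow> nat \<Rightarrow>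
   (('v list \<Rightarrow>\<^sub>0 'k) set \<Rightarrow> ('v list \<Rightarrow>\<^sub>0 'k) set) list set" where
  "Coder_c s V n = {Ds. length Ds = n + 1 \<and> set Ds \<subseteq> Coder s V (int n)}"

definition Coder_c_zero ::
  "('k::field \<Rightarrow> 'v::ab_group_add \<Rightarrow> 'v) \<Rightarrow> (int \<Rightarrow> 'v set) \<Rightarrow> nat \<Rightarrow>
   (('v list \<Rightarrow>\<^sub>0 'k) set \<Rightarrow> ('v list \<Rightarrow>\<^sub>0 'k) set) list" where
  "Coder_c_zero s V n = replicate (n + 1) (\<lambda>A\<in>sym_space s V. sym_ker s V)"

text \<open>The degrees \<open>m\<close> and \<open>n\<close> of the arguments are read off from their lengths.\<close>

definition Coder_c_bracket ::
  "('k::field \<Rightarrow> 'v::ab_group_add \<Rightarrow> 'v) \<Rightarrow> (int \<Rightarrow> 'v set) \<Rightarrow>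
   (('v list \<Rightarrow>\<^sub>0 'k) set \<Rightarrow> ('v list \<Rightarrow>\<^sub>0 'k) set) list \<Rightarrow>
   (('v list \<Rightarrow>\<^sub>0 'k) set \<Rightarrow> ('v list \<Rightarrow>\<^sub>0 'k) set) list \<Rightarrow>
   (('v list \<Rightarrow>\<^sub>0 'k) set \<Rightarrow> ('v list \<Rightarrow>\<^sub>0 'k) set) list" where
  "Coder_c_bracket s V Ds Ds' =
     (let m = length Ds - 1; n = length Ds' - 1 in
      map (\<lambda>i. \<lambda>A\<in>sym_space s V.
             (\<Sum>(p, q)\<in>{(p, q). p + q = i + 1 \<and> 1 \<le> p \<and> p \<le> m + 1 \<and> 1 \<le> q \<and> q \<le> n + 1}.
                coder_bracket s V (int m) (int n) (Ds ! (p - 1)) (Ds' ! (q - 1)) A) + sym_ker s V)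
        [1..<m + n + 2])"

definition maurer_cartan ::
  "(nat \<Rightarrow> 'g set) \<Rightarrow> (nat \<Rightarrow> 'g) \<Rightarrow> ('g \<Rightarrow> 'g \<Rightarrow> 'g) \<Rightarrow> 'g set" where
  "maurer_cartan g zero bracket = {\<theta> \<in> g 1. bracket \<theta> \<theta> = zero 2}"


section \<open>The coderivation of a family of brackets\<close>

text \<open>The maps \<open>d\<^sub>k(s\<^sup>-\<^sup>1x\<^sub>1, \<dots>, s\<^sup>-\<^sup>1x\<^sub>k) = (-1)\<^bsup>\<Sum>(k-a)|x\<^sub>a|\<^esup> s\<^sup>-\<^sup>1 l\<^sub>k(x\<^sub>1, \<dots>, x\<^sub>k)\<close> of degree \<open>1\<close>,
  where \<open>ds\<close> lists the degrees \<open>|x\<^sub>a|\<close> in \<open>L\<close>.  The sign is the one that arises from moving the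
  \<open>s\<^sup>-\<^sup>1\<close>'s past the \<open>x\<^sub>a\<close>'s.\<close>

definition decalage ::
  "('k::field \<Rightarrow> 'v::ab_group_add \<Rightarrow> 'v) \<Rightarrow> (nat \<Rightarrow> 'v list \<Rightarrow> 'v) \<Rightarrow> int list \<Rightarrow> 'v list \<Rightarrow> 'v" where
  "decalage s l ds xs =
     s ((-1) powi (\<Sum>a<length xs. int (length xs - 1 - a) * ds ! a)) (l (length xs) xs)"

text \<open>\<open>D\<close> is the coderivation cogenerated by the \<open>d\<^sub>k\<close>:
  \<open>D(v\<^sub>1 \<odot> \<dots> \<odot> v\<^sub>n) = \<Sum>\<^bsub>1 \<le> i \<le> n\<^esub> \<Sum>\<^bsub>\<sigma> \<in> Sh(i, n-i)\<^esub>
     \<epsilon>(\<sigma>) d\<^sub>i(v\<^bsub>\<sigma> 1\<^esub>, \<dots>, v\<^bsub>\<sigma> i\<^esub>) \<odot> v\<^bsub>\<sigma> (i+1)\<^esub> \<odot> \<dots> \<odot> v\<^bsub>\<sigma> n\<^esub>\<close>,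
  with \<open>\<epsilon>\<close> taken in \<open>V = s\<^sup>-\<^sup>1 L\<close>.\<close>

definition induced_coder ::
  "('k::field \<Rightarrow> 'v::ab_group_add \<Rightarrow> 'v) \<Rightarrow> (int \<Rightarrow> 'v set) \<Rightarrow> (nat \<Rightarrow> 'v list \<Rightarrow> 'v) \<Rightarrow>
   (('v list \<Rightarrow>\<^sub>0 'k) set \<Rightarrow> ('v list \<Rightarrow>\<^sub>0 'k) set) \<Rightarrow> bool" where
  "induced_coder s L l D \<longleftrightarrow>
     (\<forall>ds xs. xs \<noteq> [] \<and> homog L ds xs \<longrightarrow>
        D (sym_mon s (desusp L) xs) =
          (\<Sum>i\<in>{1..length xs}. \<Sum>\<sigma>\<in>shuffle_perms i (length xs - i).
             let ys = permute_list \<sigma> xs; es = permute_list \<sigma> ds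
             in Poly_Mapping.single (decalage s l (take i es) (take i ys) # drop i ys)
                  (koszul_sign (map (\<lambda>d. d - 1) ds) \<sigma>)) +o sym_ker s (desusp L))"


section \<open>The defining identity of the Koszul sign\<close>

lemma vector_space_pscale: "vector_space (pscale :: 'k::field \<Rightarrow> ('x \<Rightarrow>\<^sub>0 'k) \<Rightarrow> _)"
proof -
  have l: "Poly_Mapping.lookup (pscale c f) x = c * Poly_Mapping.lookup f x"
    for c :: 'k and f :: "'x \<Rightarrow>\<^sub>0 'k" and x
    by (simp add: pscale_def Poly_Mapping.map.rep_eq when_def)
  show ?thesis
    by (unfold_locales; intro poly_mapping_eqI; simp add: l lookup_add algebra_simps)
qed

lemma koszul_sign_transpose:
  assumes \<sigma>: "\<sigma> permutes {..<length ds}" and a: "Suc a < length ds" "\<sigma> (Suc a) < \<sigma> a"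
  defines "\<tau> \<equiv> Transposition.transpose a (Suc a)"
  defines "Inv \<equiv> \<lambda>\<sigma>. {(i, j). i < j \<and> j < length ds \<and> \<sigma> j < (\<sigma> i :: nat)}"
  shows "(koszul_sign ds \<sigma> :: 'k::field) = (-1) powi (ds ! \<sigma> a * ds ! \<sigma> (Suc a)) * koszul_sign ds (\<sigma> \<circ> \<tau>)"
    and "card (Inv (\<sigma> \<circ> \<tau>)) < card (Inv \<sigma>)"
proof -
  let ?g = "\<lambda>(i, j). (\<tau> i, \<tau> j)"
  have t: "\<tau> a = Suc a" "\<tau> (Suc a) = a" "\<And>i. i \<noteq> a \<Longrightarrow> i \<noteq> Suc a \<Longrightarrow> \<tau> i = i" "\<And>i. \<tau> (\<tau> i) = i"
    by (auto simp: \<tau>_def)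
  have fin: "finite (Inv \<rho>)" for \<rho>
    by (rule finite_subset[of _ "{..<length ds} \<times> {..<length ds}"]) (auto simp: Inv_def)
  have tlt: "\<tau> j < length ds" if "j < length ds" for j
    using that a t by (cases "j = a"; cases "j = Suc a") auto
  have mono: "\<tau> i < \<tau> j" if "i < j" "(i, j) \<noteq> (a, Suc a)" for i j
    using that t by (cases "i = a"; cases "i = Suc a"; cases "j = a"; cases "j = Suc a") auto
  have bij: "bij_betw ?g (Inv (\<sigma> \<circ> \<tau>)) (Inv \<sigma> - {(a, Suc a)})"
  proof (rule bij_betw_byWitness[where f' = ?g])
    show "?g ` Inv (\<sigma> \<circ> \<tau>) \<subseteq> Inv \<sigma> - {(a, Suc a)}"
    proof clarify
      fix i j assume ij: "(i, j) \<in> Inv (\<sigma> \<circ> \<tau>)"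
      then have ne: "(i, j) \<noteq> (a, Suc a)" using a t by (auto simp: Inv_def)
      have "(\<tau> i, \<tau> j) \<noteq> (a, Suc a)"
      proof
        assume "(\<tau> i, \<tau> j) = (a, Suc a)"
        then have "i = Suc a" "j = a" using t(1,2) t(4)[of i] t(4)[of j] by auto
        then show False using ij by (simp add: Inv_def)
      qed
      then show "(\<tau> i, \<tau> j) \<in> Inv \<sigma> - {(a, Suc a)}"
        using ij mono[OF _ ne] tlt by (auto simp: Inv_def)
    qed
    show "?g ` (Inv \<sigma> - {(a, Suc a)}) \<subseteq> Inv (\<sigma> \<circ> \<tau>)"
      using mono tlt t(4) by (auto simp: Inv_def)
  qed (auto simp: t)
  have mem: "(a, Suc a) \<in> Inv \<sigma>" using a by (auto simp: Inv_def)
  have "card (Inv (\<sigma> \<circ> \<tau>)) = card (Inv \<sigma> - {(a, Suc a)})"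
    using bij by (rule bij_betw_same_card)
  then show "card (Inv (\<sigma> \<circ> \<tau>)) < card (Inv \<sigma>)"
    using card_Diff1_less[OF fin mem] by presburger
  let ?h = "\<lambda>(i, j). ((-1) powi (ds ! \<sigma> i * ds ! \<sigma> j) :: 'k)"
  have "koszul_sign ds \<sigma> = (\<Prod>p\<in>Inv \<sigma>. ?h p)"
    by (simp add: koszul_sign_def Inv_def)
  also have "\<dots> = ?h (a, Suc a) * (\<Prod>p\<in>Inv \<sigma> - {(a, Suc a)}. ?h p)"
    using mem fin by (subst prod.remove[of _ "(a, Suc a)"]) auto
  also have "(\<Prod>p\<in>Inv \<sigma> - {(a, Suc a)}. ?h p) = (\<Prod>p\<in>Inv (\<sigma> \<circ> \<tau>). ?h (?g p))"
    by (rule prod.reindex_bij_betw[OF bij, symmetric])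
  also have "\<dots> = koszul_sign ds (\<sigma> \<circ> \<tau>)"
    by (simp add: koszul_sign_def Inv_def case_prod_unfold)
  finally show "koszul_sign ds \<sigma> = (-1) powi (ds ! \<sigma> a * ds ! \<sigma> (Suc a)) * (koszul_sign ds (\<sigma> \<circ> \<tau>) :: 'k)"
    by simp
qed

lemma single_permute_mem_sym_ker:
  fixes s :: "'k::field \<Rightarrow> 'v::ab_group_add \<Rightarrow> 'v"
  assumes xs: "homog V ds xs" and "\<sigma> permutes {..<length xs}"
  shows "Poly_Mapping.single (permute_list \<sigma> xs) 1 - Poly_Mapping.single xs (koszul_sign ds \<sigma>)
           \<in> sym_ker s V"
  using assms(2)
proof (induction "card {(i, j). i < j \<and> j < length ds \<and> \<sigma> j < \<sigma> i}" arbitrary: \<sigma> rule: less_induct)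
  case less
  interpret vector_space "pscale :: 'k \<Rightarrow> ('v list \<Rightarrow>\<^sub>0 'k) \<Rightarrow> _"
    by (rule vector_space_pscale)
  have len: "length ds = length xs"
    using xs by (auto simp: homog_def list_all2_lengthD)
  have mem: "xs ! i \<in> V (ds ! i)" if "i < length xs" for i
    using xs that len by (auto simp: homog_def list_all2_conv_all_nth)
  note \<sigma> = less.prems
  have \<sigma>lt: "\<sigma> i < length xs" if "i < length xs" for i
    using permutes_in_image[OF \<sigma>, of i] that by simp
  show ?case
  proof (cases "\<exists>a. Suc a < length xs \<and> \<sigma> (Suc a) < \<sigma> a")
    case False
    have "\<sigma> i \<ge> i" if "i < length xs" for i
      using that
    proof (induction i)
      case (Suc i)
      have "\<sigma> i \<noteq> \<sigma> (Suc i)" using \<sigma> by (metis n_not_Suc_n permutes_inv_eq)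
      moreover have "i \<le> \<sigma> i" "\<not> \<sigma> (Suc i) < \<sigma> i" using Suc False by auto
      ultimately show ?case by linarith
    qed simp
    then have "\<sigma> = id" using permutes_natset_ge[OF \<sigma>] by auto
    moreover have "koszul_sign ds id = (1::'k)"
      unfolding koszul_sign_def by (rule prod.neutral) auto
    ultimately show ?thesis by (simp add: sym_ker_def span_zero)
  next
    case True
    then obtain a where a: "Suc a < length xs" "\<sigma> (Suc a) < \<sigma> a" by blast
    define \<tau> where "\<tau> = Transposition.transpose a (Suc a)"
    note step = koszul_sign_transpose[of \<sigma> ds a, folded \<tau>_def, unfolded len, OF \<sigma> a]
    have \<tau>: "\<tau> permutes {..<length xs}" unfolding \<tau>_def using a by (intro permutes_swap_id) auto
    have \<sigma>\<tau>: "(\<sigma> \<circ> \<tau>) permutes {..<length xs}" using permutes_compose[OF \<tau> \<sigma>] .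
    let ?ys = "permute_list \<sigma> xs" and ?zs = "permute_list (\<sigma> \<circ> \<tau>) xs"
    let ?us = "take a ?ys" and ?ws = "drop (Suc (Suc a)) ?ys"
    let ?e = "(-1) powi (ds ! \<sigma> a * ds ! \<sigma> (Suc a)) :: 'k"
    have ys: "?ys = ?us @ xs ! \<sigma> a # xs ! \<sigma> (Suc a) # ?ws"
      using a \<sigma> id_take_nth_drop[of a ?ys] Cons_nth_drop_Suc[of "Suc a" ?ys]
      by (simp add: permute_list_nth)
    have zs: "?zs = ?us @ xs ! \<sigma> (Suc a) # xs ! \<sigma> a # ?ws"
    proof (rule nth_equalityI)
      fix i assume "i < length ?zs"
      then have i: "i < length xs" by simp
      have "?zs ! i = xs ! \<sigma> (\<tau> i)"
        using i \<sigma>\<tau> by (simp add: permute_list_nth)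
      moreover have "Suc (Suc (i - 2)) = i" if "\<not> i \<le> Suc a"
        using that by simp
      ultimately show "?zs ! i = (?us @ xs ! \<sigma> (Suc a) # xs ! \<sigma> a # ?ws) ! i"
        using a i \<sigma> by (auto simp: permute_list_nth nth_append nth_Cons' \<tau>_def
            Transposition.transpose_def)
    qed (use a in simp)
    have "Poly_Mapping.single (us @ x # y # ws) 1 - Poly_Mapping.single (us @ y # x # ws) ((-1) powi (p * q))
        \<in> sym_rels s V" if "x \<in> V p" "y \<in> V q" for us ws x y p q
      unfolding sym_rels_def using that by blast
    moreover obtain us ws where "?ys = us @ xs ! \<sigma> a # xs ! \<sigma> (Suc a) # ws"
      and "?zs = us @ xs ! \<sigma> (Suc a) # xs ! \<sigma> a # ws"
      using ys zs by blast
    ultimately have "Poly_Mapping.single ?ys 1 - Poly_Mapping.single ?zs ?e \<in> sym_rels s V"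
      using mem \<sigma>lt a by simp
    then have 1: "Poly_Mapping.single ?ys 1 - Poly_Mapping.single ?zs ?e \<in> span (sym_rels s V)"
      by (rule span_base)
    have "Poly_Mapping.single ?zs 1 - Poly_Mapping.single xs (koszul_sign ds (\<sigma> \<circ> \<tau>)) \<in> span (sym_rels s V)"
      using less.hyps[of "\<sigma> \<circ> \<tau>"] step(2) \<sigma>\<tau> by (simp add: sym_ker_def len)
    then have 2: "pscale ?e (Poly_Mapping.single ?zs 1 - Poly_Mapping.single xs (koszul_sign ds (\<sigma> \<circ> \<tau>)))
        \<in> span (sym_rels s V)"
      by (rule span_scale)
    have ps: "pscale c (Poly_Mapping.single x b) = Poly_Mapping.single x (c * b)" for c b :: 'k and x :: "'v list"
      by (simp add: pscale_def)
    show ?thesis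
      using span_add[OF 1 2] by (simp add: sym_ker_def scale_right_diff_distrib ps step(1))
  qed
qed

lemma sym_mon_permute:
  fixes s :: "'k::field \<Rightarrow> 'v::ab_group_add \<Rightarrow> 'v"
  assumes "homog V ds xs" and "\<sigma> permutes {..<length xs}"
  shows "sym_mon s V (permute_list \<sigma> xs) =
           coset_scale (sym_ker s V) (koszul_sign ds \<sigma>) (sym_mon s V xs)"
proof -
  interpret vector_space "pscale :: 'k \<Rightarrow> ('v list \<Rightarrow>\<^sub>0 'k) \<Rightarrow> _"
    by (rule vector_space_pscale)
  let ?K = "sym_ker s V" and ?c = "koszul_sign ds \<sigma> :: 'k"
  have K: "subspace ?K" by (simp add: sym_ker_def)
  have ps: "pscale ?c (Poly_Mapping.single xs 1) = Poly_Mapping.single xs ?c"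
    by (simp add: pscale_def)
  define d where "d = Poly_Mapping.single (permute_list \<sigma> xs) 1 - Poly_Mapping.single xs ?c"
  have d: "d \<in> ?K" unfolding d_def by (rule single_permute_mem_sym_ker[OF assms])
  have eq: "Poly_Mapping.single (permute_list \<sigma> xs) 1 = Poly_Mapping.single xs ?c + d"
    by (simp add: d_def)
  show ?thesis
  proof (intro set_eqI iffI)
    fix f assume "f \<in> sym_mon s V (permute_list \<sigma> xs)"
    then obtain r where r: "r \<in> ?K" "f = Poly_Mapping.single xs ?c + (d + r)"
      by (auto simp: sym_mon_def elt_set_plus_def eq add.assoc)
    have "Poly_Mapping.single xs 1 \<in> sym_mon s V xs"
      using subspace_0[OF K] by (force simp: sym_mon_def elt_set_plus_def)
    then show "f \<in> coset_scale ?K ?c (sym_mon s V xs)"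
      using r subspace_add[OF K d r(1)] unfolding coset_scale_def set_plus_def
      by (auto simp flip: ps)
  next
    fix f assume "f \<in> coset_scale ?K ?c (sym_mon s V xs)"
    then obtain r q where rq: "r \<in> ?K" "q \<in> ?K" "f = pscale ?c (Poly_Mapping.single xs 1 + r) + q"
      by (auto simp: coset_scale_def sym_mon_def elt_set_plus_def set_plus_def)
    then have "f = Poly_Mapping.single (permute_list \<sigma> xs) 1 + (pscale ?c r + q - d)"
      by (simp add: eq scale_right_distrib ps)
    moreover have "pscale ?c r + q - d \<in> ?K"
      using rq d K by (intro subspace_diff subspace_add subspace_scale)
    ultimately show "f \<in> sym_mon s V (permute_list \<sigma> xs)"
      by (auto simp: sym_mon_def elt_set_plus_def)
  qed
qed

end

(* Everything is done on the dual side.  A linear map out of SV is the same as a multilinear,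
   graded symmetric function of words, and two elements of a quotient of a free vector space are
   equal as soon as all such functions agree on them.  Transposing a coderivation turns its
   defining identity into an identity between sums over unshuffles of a word, where
   coassociativity and cocommutativity can be used without passing to quotients.

   Composing the reduced coproduct with the multiplication of SV gives 2^n - 2 on S^n V, so in
   characteristic 0 every functional that vanishes on V factors through the coproduct.  Hence a
   coderivation is determined by its corestriction SV -> V, and conversely every graded symmetric
   map of degree 1 extends to a coderivation.  By decalage these maps are the families l_k of
   degree 2 - k.

   The anticommutator of two coderivations of degree 1 is again a coderivation, so it vanishes iff
   its corestriction does, and on homogeneous words that corestriction is, up to a sign, the
   Jacobi sum of the two families.  A pair (D, D') is a Maurer-Cartan element iff the
   anticommutators of (D, D), (D, D') and (D', D') vanish. *)
theory Submission
  imports Defs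
begin

section \<open>Quotients of free vector spaces\<close>

text \<open>Two obstacles shape the proof. Elements of SV and of its tensor square are cosets, the
  latter of formal sums of pairs of cosets, and the coproduct and D \<otimes> 1 + 1 \<otimes> D are
  given by definite descriptions, so direct computation would need representatives at every step;
  functionals hide them. And letters are arbitrary vectors, whereas Koszul signs are defined for
  homogeneous ones. Since signs depend on parities only, each letter is split into an even and an
  odd part, and signs are produced by the involution x \<mapsto> (-1)^|x| x of V. The unshuffle sum
  becomes a recursion on words that never mentions degrees, and coassociativity, cocommutativity and
  the count 2^n become inductions on lists. Degrees return when multilinear functions are compared
  on homogeneous words. Of the 2^n terms the two with an empty factor are missing in the reduced
  coproduct, hence 2^n - 2, which is nonzero for n \<ge> 2. Characteristic 0 also serves to divide
  by 2: the Jacobi sum for l = l' and the middle component of the bracket both appear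
  doubled.\<close>

abbreviation "single \<equiv> Poly_Mapping.single"
abbreviation "keys \<equiv> Poly_Mapping.keys"
abbreviation "lookup \<equiv> Poly_Mapping.lookup"

definition lext :: "('k::field \<Rightarrow> 'w::ab_group_add \<Rightarrow> 'w) \<Rightarrow> ('x \<Rightarrow> 'w) \<Rightarrow> ('x \<Rightarrow>\<^sub>0 'k) \<Rightarrow> 'w" where
  "lext sc t f = (\<Sum>x\<in>keys f. sc (lookup f x) (t x))"

definition annihilates ::
  "('k::field \<Rightarrow> 'w::ab_group_add \<Rightarrow> 'w) \<Rightarrow> ('x \<Rightarrow>\<^sub>0 'k) set \<Rightarrow> ('x \<Rightarrow> 'w) \<Rightarrow> bool" where
  "annihilates sc R t \<longleftrightarrow> (\<forall>r\<in>R. lext sc t r = 0)"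

text \<open>The representative chosen by \<open>SOME\<close> depends on \<open>A\<close> alone, so
  the value is additive in \<open>t\<close> for arbitrary \<open>t\<close>. Independence of the
  choice holds when \<open>t\<close> annihilates the relations, see
  \<open>coset_eval_coset\<close>.\<close>

definition coset_eval ::
  "('k::field \<Rightarrow> 'w::ab_group_add \<Rightarrow> 'w) \<Rightarrow> ('x \<Rightarrow> 'w) \<Rightarrow> ('x \<Rightarrow>\<^sub>0 'k) set \<Rightarrow> 'w" where
  "coset_eval sc t A = lext sc t (SOME f. f \<in> A)"

interpretation free: vector_space "pscale :: 'k::field \<Rightarrow> ('x \<Rightarrow>\<^sub>0 'k) \<Rightarrow> _"
  by (rule vector_space_pscale)

interpretation scalar: vector_space "(*) :: 'k::field \<Rightarrow> 'k \<Rightarrow> 'k"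
  by unfold_locales (auto simp: algebra_simps)

lemmas scalar_vs = scalar.vector_space_axioms

lemma lookup_pscale [simp]: "lookup (pscale c f) x = c * lookup f x"
  by (simp add: pscale_def Poly_Mapping.map.rep_eq when_def)

lemma pscale_single [simp]: "pscale c (single x b) = single x (c * b)"
  by (simp add: pscale_def)

lemma keys_pscale_subset: "keys (pscale c f) \<subseteq> keys f"
  by (auto simp: in_keys_iff)

lemma keys_pscale_subsetI: "keys f \<subseteq> S \<Longrightarrow> keys (pscale c f) \<subseteq> S"
  using keys_pscale_subset[of c f] by (rule order_trans)

lemma keys_add_subsetI:
  "keys f \<subseteq> S \<Longrightarrow> keys g \<subseteq> S \<Longrightarrow> keys (f + g) \<subseteq> S"
  by (rule order_trans[OF keys_add]) simp

lemma keys_lext_subset: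
  assumes "\<And>x. x \<in> keys f \<Longrightarrow> keys (M x) \<subseteq> S"
  shows "keys (lext pscale M f) \<subseteq> S"
proof -
  have "keys (\<Sum>x\<in>X. pscale (lookup f x) (M x)) \<subseteq> S"
    if "finite X" "X \<subseteq> keys f" for X
    using that
  proof (induction X)
    case (insert x X)
    then show ?case
      using assms[of x] by (simp add: keys_add_subsetI keys_pscale_subsetI)
  qed simp
  then show ?thesis by (simp add: lext_def)
qed

lemma lext_cong:
  "(\<And>x. x \<in> keys f \<Longrightarrow> t x = t' x) \<Longrightarrow> lext sc t f = lext sc t' f"
  by (simp add: lext_def)

context vector_space
begin

lemma lext_superset:
  assumes "finite X" "keys f \<subseteq> X"
  shows "lext scale t f = (\<Sum>x\<in>X. scale (lookup f x) (t x))"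
  unfolding lext_def using assms by (intro sum.mono_neutral_left) (auto simp: in_keys_iff)

lemma lext_zero [simp]: "lext scale t 0 = 0"
  by (simp add: lext_def)

lemma lext_single [simp]: "lext scale t (single x c) = scale c (t x)"
  by (simp add: lext_def)

lemma lext_add: "lext scale t (f + g) = lext scale t f + lext scale t g"
proof -
  let ?X = "keys f \<union> keys g"
  have "keys (f + g) \<subseteq> ?X" by (rule keys_add)
  then show ?thesis
    by (simp add: lext_superset[of ?X] lookup_add scale_left_distrib sum.distrib)
qed

lemma lext_pscale: "lext scale t (pscale c f) = scale c (lext scale t f)"
  by (simp add: lext_superset[of "keys f" "pscale c f"] keys_pscale_subset
      lext_superset[of "keys f" f] scale_sum_right)

lemma linear_lext: "Vector_Spaces.linear pscale scale (lext scale t)"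
  by unfold_locales (simp_all add: lext_add lext_pscale free.scale_right_distrib
      free.scale_left_distrib scale_right_distrib scale_left_distrib)

lemma lext_diff: "lext scale t (f - g) = lext scale t f - lext scale t g"
  using lext_add[of t "f - g" g] by simp

lemma lext_sum: "lext scale t (\<Sum>i\<in>I. f i) = (\<Sum>i\<in>I. lext scale t (f i))"
  by (induction I rule: infinite_finite_induct) (simp_all add: lext_add)

lemma lext_fun_add: "lext scale (\<lambda>x. t x + t' x) f = lext scale t f + lext scale t' f"
  by (simp add: lext_def scale_right_distrib sum.distrib)

lemma lext_fun_scale: "lext scale (\<lambda>x. scale c (t x)) f = scale c (lext scale t f)"
  by (simp add: lext_def scale_sum_right mult.commute)

lemma lext_fun_zero [simp]: "lext scale (\<lambda>x. 0) f = 0"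
  by (simp add: lext_def)

lemma lext_annihilates_span:
  assumes "annihilates scale R t" "f \<in> free.span R"
  shows "lext scale t f = 0"
  using assms(2)
proof (rule free.span_induct)
  show "free.subspace {f. lext scale t f = 0}"
    by (auto simp: free.subspace_def lext_add lext_pscale)
qed (use assms(1) in \<open>simp add: annihilates_def\<close>)

end

lemma linear_comp_lext:
  assumes "Vector_Spaces.linear s1 s2 g"
  shows "g (lext s1 t f) = lext s2 (\<lambda>x. g (t x)) f"
proof -
  interpret Vector_Spaces.linear s1 s2 g by fact
  show ?thesis by (simp add: lext_def sum scale)
qed

lemma lext_commute:
  fixes t :: "'x \<Rightarrow> 'y \<Rightarrow> 'k::field"
  shows "lext (*) (\<lambda>x. lext (*) (t x) g) f = lext (*) (\<lambda>y. lext (*) (\<lambda>x. t x y) f) g"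
  by (simp add: lext_def sum_distrib_left mult.left_commute) (simp only: mult_ac, rule sum.swap)

lemma lext_single_one [simp]: "lext pscale (\<lambda>x. single x 1) f = f"
proof (rule poly_mapping_eqI)
  fix x
  show "lookup (lext pscale (\<lambda>x. single x 1) f) x = lookup f x"
    by (cases "x \<in> keys f")
      (auto simp: lext_def lookup_sum lookup_single when_def in_keys_iff)
qed

text \<open>A vector outside the span can be added to a basis of the span without losing
  independence; the linear functional that is 1 on it and 0 on the basis then kills
  \<open>R\<close>. This separation property lets equalities in quotients be tested on
  functionals.\<close>

lemma mem_span_functionals:
  fixes f :: "'x \<Rightarrow>\<^sub>0 'k::field"
  assumes "\<And>t. annihilates (*) R t \<Longrightarrow> lext (*) t f = 0"
  shows "f \<in> free.span R"
proof (rule ccontr)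
  assume f: "f \<notin> free.span R"
  interpret vector_space_pair "pscale :: 'k \<Rightarrow> ('x \<Rightarrow>\<^sub>0 'k) \<Rightarrow> _" "(*) :: 'k \<Rightarrow> 'k \<Rightarrow> 'k"
    by unfold_locales
  obtain B where B: "B \<subseteq> R" "free.independent B" "R \<subseteq> free.span B"
    using free.maximal_independent_subset by blast
  have RB: "free.span R = free.span B"
    using B free.span_mono free.span_span by (metis free.span_subspace free.subspace_span subset_antisym)
  have "free.independent (insert f B)"
    using f B RB by (intro free.independent_insertI) auto
  then obtain g where g: "Vector_Spaces.linear pscale (*) g"
    "\<forall>x\<in>insert f B. g x = (if x = f then 1 else 0)"
    using linear_independent_extend[of "insert f B" "\<lambda>x. if x = f then 1 else 0"] by blast
  interpret g: Vector_Spaces.linear pscale "(*)" g by (rule g(1))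
  have fB: "f \<notin> B" using f RB free.span_base by blast
  have gl: "g h = lext (*) (\<lambda>x. g (single x 1)) h" for h
    using linear_comp_lext[OF g(1), of "\<lambda>x. single x 1" h] by simp
  have "g h = 0" if "h \<in> free.span B" for h
    using that
  proof (rule free.span_induct)
    show "free.subspace {h. g h = 0}"
      by (auto simp: free.subspace_def g.add g.scale)
  qed (use g(2) fB in auto)
  then have "annihilates (*) R (\<lambda>x. g (single x 1))"
    using B(3) by (auto simp: annihilates_def gl[symmetric])
  from assms[OF this] have "g f = 0" by (simp add: gl[symmetric])
  then show False using g(2) by simp
qed

lemma free_induct [consumes 1, case_names zero add]:
  fixes f :: "'x \<Rightarrow>\<^sub>0 'k::field"
  assumes "keys f \<subseteq> S" "P 0"
    and "\<And>f x c. keys f \<subseteq> S \<Longrightarrow> P f \<Longrightarrow> x \<in> S \<Longrightarrow> P (single x c + f)"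
  shows "P f"
proof -
  let ?s = "\<lambda>X. \<Sum>x\<in>X. single x (lookup f x)"
  have "keys (?s X) \<subseteq> S \<and> P (?s X)" if "finite X" "X \<subseteq> S" for X
    using that
  proof (induction X)
    case (insert x X)
    then show ?case using assms(3)[of "?s X" x] by (simp add: keys_add_subsetI)
  qed (use assms(2) in simp)
  from this[of "keys f"] assms(1) lext_single_one[of f]
  show ?thesis by (simp add: lext_def)
qed

section \<open>Quotients of the free vector space on a set of generators\<close>

lemma coset_eq_iff:
  assumes "free.subspace K"
  shows "f +o K = g +o K \<longleftrightarrow> f - g \<in> K"
proof
  assume "f +o K = g +o K"
  moreover have "f \<in> f +o K"
    using free.subspace_0[OF assms] by (force simp: elt_set_plus_def)
  ultimately have "f \<in> g +o K" by simp
  then show "f - g \<in> K" by (simp add: set_minus_plus)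
next
  assume fg: "f - g \<in> K"
  show "f +o K = g +o K"
  proof (intro set_eqI)
    fix h
    have "h - g = (h - f) + (f - g)" "h - f = (h - g) - (f - g)" by simp_all
    then show "h \<in> f +o K \<longleftrightarrow> h \<in> g +o K"
      unfolding set_minus_plus[symmetric]
      using free.subspace_add[OF assms] free.subspace_diff[OF assms] fg by metis
  qed
qed

text \<open>Used twice: for SV, with \<open>S\<close> the nonempty words, and for SV \<otimes> SV,
  with \<open>S\<close> the pairs of classes in SV. The type \<open>'x\<close> is larger than
  \<open>S\<close> in both cases; \<open>keys_rel\<close> ensures that every representative of a
  class in \<open>Q\<close> is supported in \<open>S\<close>.\<close>

locale free_quotient =
  fixes S :: "'x set" and R :: "('x \<Rightarrow>\<^sub>0 'k::field) set"
  assumes keys_rel: "\<And>r. r \<in> R \<Longrightarrow> keys r \<subseteq> S"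
begin

abbreviation K where "K \<equiv> free.span R"

definition Q where "Q = {f +o K | f. keys f \<subseteq> S}"

lemma keys_span: "f \<in> K \<Longrightarrow> keys f \<subseteq> S"
proof (induction rule: free.span_induct)
  case base
  have "free.subspace {f. keys f \<subseteq> S}"
    by (simp add: free.subspace_def keys_add_subsetI keys_pscale_subsetI)
  then show ?case .
qed (rule keys_rel)

lemma coset_self: "f \<in> f +o K"
  using free.span_zero by (force simp: elt_set_plus_def)

lemma coset_eq: "f +o K = g +o K \<longleftrightarrow> f - g \<in> K"
  by (rule coset_eq_iff) simp

lemma coset_add: "(f +o K) + (g +o K) = (f + g) +o K"
proof -
  have "K + K = K"
  proof
    show "K + K \<subseteq> K" by (auto simp: set_plus_def free.span_add)
    show "K \<subseteq> K + K" using free.span_zero by (rule set_zero_plus2)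
  qed
  then show ?thesis by (simp add: set_plus_rearrange)
qed

lemma coset_scale_coset: "coset_scale K c (f +o K) = pscale c f +o K"
proof (intro set_eqI iffI)
  fix h assume "h \<in> coset_scale K c (f +o K)"
  then obtain a b where "a \<in> K" "b \<in> K" "h = pscale c (f + a) + b"
    by (auto simp: coset_scale_def elt_set_plus_def set_plus_def)
  then have "h - pscale c f \<in> K"
    by (simp add: free.scale_right_distrib free.span_add free.span_scale)
  then show "h \<in> pscale c f +o K" by (simp add: set_minus_plus)
next
  fix h assume "h \<in> pscale c f +o K"
  then obtain b where "b \<in> K" "h = pscale c f + b" by (auto simp: elt_set_plus_def)
  then show "h \<in> coset_scale K c (f +o K)"
    using coset_self unfolding coset_scale_def by blast
qed

lemma Q_cases [elim?]:
  assumes "A \<in> Q"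
  obtains f where "A = f +o K" "keys f \<subseteq> S"
  using assms by (auto simp: Q_def)

lemma coset_in_Q [intro]: "keys f \<subseteq> S \<Longrightarrow> f +o K \<in> Q"
  by (auto simp: Q_def)

lemma single_in_Q [intro, simp]: "x \<in> S \<Longrightarrow> single x c +o K \<in> Q"
  by (rule coset_in_Q) simp

lemma K_in_Q [intro, simp]: "K \<in> Q"
  using coset_in_Q[of 0] by simp

lemma add_in_Q [intro, simp]: "A \<in> Q \<Longrightarrow> B \<in> Q \<Longrightarrow> A + B \<in> Q"
  by (elim Q_cases) (simp add: coset_add coset_in_Q keys_add_subsetI)

lemma scale_in_Q [intro, simp]: "A \<in> Q \<Longrightarrow> coset_scale K c A \<in> Q"
  by (elim Q_cases) (simp add: coset_scale_coset coset_in_Q keys_pscale_subsetI)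

lemma Q_add_K [simp]: "A \<in> Q \<Longrightarrow> A + K = A" "A \<in> Q \<Longrightarrow> K + A = A"
  using coset_add[of _ 0] coset_add[of 0] by (auto elim!: Q_cases)

lemma Q_scale_one [simp]: "A \<in> Q \<Longrightarrow> coset_scale K 1 A = A"
  by (auto elim!: Q_cases simp: coset_scale_coset)

lemma some_rep:
  assumes "A \<in> Q"
  obtains f where "(SOME f. f \<in> A) = f" "A = f +o K" "keys f \<subseteq> S"
proof -
  obtain g where g: "A = g +o K" "keys g \<subseteq> S" using Q_cases[OF assms] .
  define f where "f = (SOME f. f \<in> A)"
  have fA: "f \<in> A" unfolding f_def using coset_self g(1) by (metis someI)
  then have fg: "f - g \<in> K" using g by (simp add: set_minus_plus)
  then have "A = f +o K" using g coset_eq by blast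
  moreover have "keys f \<subseteq> S"
    using keys_span[OF fg] keys_add[of "f - g" g] g by auto
  ultimately show ?thesis by (rule that[OF f_def[symmetric]])
qed

lemma coset_eq_functionals:
  assumes "\<And>t. annihilates (*) R t \<Longrightarrow> lext (*) t f = lext (*) t g"
  shows "f +o K = g +o K"
  unfolding coset_eq by (rule mem_span_functionals) (simp add: assms scalar.lext_diff)

context
  fixes sc :: "'k \<Rightarrow> 'w::ab_group_add \<Rightarrow> 'w" and t :: "'x \<Rightarrow> 'w"
  assumes vs: "vector_space sc" and ann: "annihilates sc R t"
begin

interpretation vector_space sc by (rule vs)

lemma coset_eval_coset: "coset_eval sc t (f +o K) = lext sc t f"
proof -
  have "(SOME g. g \<in> f +o K) \<in> f +o K" using coset_self by (rule someI)
  then have "(SOME g. g \<in> f +o K) - f \<in> K" by (simp add: set_minus_plus)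
  from lext_annihilates_span[OF ann this] show ?thesis
    by (simp add: coset_eval_def lext_diff)
qed

lemma coset_eval_single: "coset_eval sc t (single x c +o K) = sc c (t x)"
  by (simp add: coset_eval_coset)

lemma coset_eval_K: "coset_eval sc t K = 0"
  using coset_eval_coset[of 0] by simp

lemma coset_eval_add:
  "A \<in> Q \<Longrightarrow> B \<in> Q \<Longrightarrow> coset_eval sc t (A + B) = coset_eval sc t A + coset_eval sc t B"
  by (auto elim!: Q_cases simp: coset_add coset_eval_coset lext_add)

lemma coset_eval_scale:
  "A \<in> Q \<Longrightarrow> coset_eval sc t (coset_scale K c A) = sc c (coset_eval sc t A)"
  by (auto elim!: Q_cases simp: coset_scale_coset coset_eval_coset lext_pscale)

end

lemma Q_eqI:
  assumes "A \<in> Q" "B \<in> Q"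
    and "\<And>t. annihilates (*) R t \<Longrightarrow> coset_eval (*) t A = coset_eval (*) t B"
  shows "A = B"
proof -
  obtain f g where fg: "A = f +o K" "B = g +o K" using assms(1,2) by (metis Q_cases)
  show ?thesis unfolding fg
    using assms(3) fg by (intro coset_eq_functionals)
      (simp add: coset_eval_coset[OF scalar_vs])
qed

lemma coset_eval_fun_add:
  "vector_space sc \<Longrightarrow> coset_eval sc (\<lambda>x. t x + t' x) A = coset_eval sc t A + coset_eval sc t' A"
  by (simp add: coset_eval_def vector_space.lext_fun_add)

lemma coset_eval_fun_scale:
  "vector_space sc \<Longrightarrow> coset_eval sc (\<lambda>x. sc c (t x)) A = sc c (coset_eval sc t A)"
  by (simp add: coset_eval_def vector_space.lext_fun_scale)

lemma coset_eval_fun_zero: "vector_space sc \<Longrightarrow> coset_eval sc (\<lambda>x. 0) A = 0"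
  by (simp add: coset_eval_def vector_space.lext_fun_zero)

lemma coset_eval_cong:
  assumes "A \<in> Q" "\<And>x. x \<in> S \<Longrightarrow> t x = t' x"
  shows "coset_eval sc t A = coset_eval sc t' A"
proof -
  obtain f where f: "(SOME f. f \<in> A) = f" "A = f +o K" "keys f \<subseteq> S"
    using some_rep[OF assms(1)] .
  then show ?thesis using assms(2) by (auto simp: coset_eval_def intro!: lext_cong)
qed

definition linear_on where
  "linear_on sc g \<longleftrightarrow> (\<forall>A\<in>Q. \<forall>B\<in>Q. g (A + B) = g A + g B) \<and>
     (\<forall>A\<in>Q. \<forall>c. g (coset_scale K c A) = sc c (g A))"

context
  fixes sc :: "'k \<Rightarrow> 'w::ab_group_add \<Rightarrow> 'w" and g
  assumes vs: "vector_space sc" and lin: "linear_on sc g"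
begin

interpretation vector_space sc by (rule vs)

lemma linear_on_K: "g K = 0"
  using lin coset_scale_coset[of 0 0] by (auto simp: linear_on_def dest!: bspec[of _ _ K] spec[of _ 0])

lemma linear_on_coset:
  "keys f \<subseteq> S \<Longrightarrow>
     g (f +o K) = lext sc (\<lambda>x. if x \<in> S then g (single x 1 +o K) else 0) f"
proof (induction rule: free_induct)
  case (add f x c)
  have "(single x c + f) +o K = coset_scale K c (single x 1 +o K) + (f +o K)"
    by (simp add: coset_scale_coset coset_add)
  then show ?case using add lin by (simp add: linear_on_def lext_add coset_in_Q)
qed (simp add: linear_on_K)

text \<open>Each relation represents the zero class, on which \<open>g\<close> vanishes. So every
  linear function on the quotient arises by evaluation from its values on generators; 0 is a default
  that makes these values a total function.\<close>

lemma linear_on_annihilates: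
  "annihilates sc R (\<lambda>x. if x \<in> S then g (single x 1 +o K) else 0)"
  unfolding annihilates_def
proof
  fix r assume r: "r \<in> R"
  have "r +o K = 0 +o K" using free.span_base[OF r] by (simp only: coset_eq diff_zero)
  then show "lext sc (\<lambda>x. if x \<in> S then g (single x 1 +o K) else 0) r = 0"
    using linear_on_coset[OF keys_rel[OF r]] linear_on_K by simp
qed

lemma linear_on_eval:
  assumes "A \<in> Q"
  shows "g A = coset_eval sc (\<lambda>x. if x \<in> S then g (single x 1 +o K) else 0) A"
proof -
  obtain f where f: "A = f +o K" "keys f \<subseteq> S" using Q_cases[OF assms] .
  show ?thesis
    unfolding f(1) coset_eval_coset[OF vs linear_on_annihilates] by (rule linear_on_coset[OF f(2)])
qed

end

lemma linear_on_coset_eval: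
  "vector_space sc \<Longrightarrow> annihilates sc R t \<Longrightarrow> linear_on sc (coset_eval sc t)"
  by (simp add: linear_on_def coset_eval_add coset_eval_scale)

end

section \<open>Linear maps between quotients and their transposes\<close>

locale free_quotient_pair = dom: free_quotient S R + cod: free_quotient S' R'
  for S :: "'x set" and R :: "('x \<Rightarrow>\<^sub>0 'k::field) set"
    and S' :: "'y set" and R' :: "('y \<Rightarrow>\<^sub>0 'k) set"
begin

abbreviation "homs \<equiv> coset_hom dom.Q dom.K cod.Q cod.K"

definition lift :: "('x \<Rightarrow> ('y \<Rightarrow>\<^sub>0 'k)) \<Rightarrow> ('x \<Rightarrow>\<^sub>0 'k) set \<Rightarrow> ('y \<Rightarrow>\<^sub>0 'k) set" where
  "lift M = (\<lambda>A\<in>dom.Q. coset_eval pscale M A +o cod.K)"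

text \<open>The transpose of a map of quotients; functionals are functions on generators.\<close>

definition dual ::
  "('k \<Rightarrow> 'w::ab_group_add \<Rightarrow> 'w) \<Rightarrow> (('x \<Rightarrow>\<^sub>0 'k) set \<Rightarrow> ('y \<Rightarrow>\<^sub>0 'k) set) \<Rightarrow> ('y \<Rightarrow> 'w) \<Rightarrow> 'x \<Rightarrow> 'w"
  where "dual sc \<phi> t x =
    (if x \<in> S then coset_eval sc t (\<phi> (single x 1 +o dom.K)) else 0)"

text \<open>Well-definedness is required dually: \<open>M\<close> pulls functionals annihilating
  \<open>R'\<close> back to functionals annihilating \<open>R\<close>. Since functionals separate
  cosets, the image is independent of the representative; for SV the condition is checked by showing
  that a function of words is graded symmetric.\<close>

lemma lift_coset:
  assumes ann: "\<And>t. annihilates (*) R' t \<Longrightarrow> annihilates (*) R (\<lambda>x. lext (*) t (M x))"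
    and f: "keys f \<subseteq> S"
  shows "lift M (f +o dom.K) = lext pscale M f +o cod.K"
proof -
  obtain g where g: "(SOME h. h \<in> f +o dom.K) = g" "f +o dom.K = g +o dom.K"
    using dom.some_rep[OF dom.coset_in_Q[OF f]] by metis
  have "lext pscale M g +o cod.K = lext pscale M f +o cod.K"
  proof (rule cod.coset_eq_functionals)
    fix t :: "'y \<Rightarrow> 'k" assume t: "annihilates (*) R' t"
    have "lext (*) (\<lambda>x. lext (*) t (M x)) g = lext (*) (\<lambda>x. lext (*) t (M x)) f"
      using g(2) dom.coset_eval_coset[OF scalar_vs ann[OF t]] by metis
    then show "lext (*) t (lext pscale M g) = lext (*) t (lext pscale M f)"
      by (simp add: linear_comp_lext[OF scalar.linear_lext])
  qed
  then show ?thesis using f by (simp add: lift_def coset_eval_def g(1) dom.coset_in_Q)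
qed

lemma lift_coset_hom:
  assumes ann: "\<And>t. annihilates (*) R' t \<Longrightarrow> annihilates (*) R (\<lambda>x. lext (*) t (M x))"
    and keys: "\<And>x. x \<in> S \<Longrightarrow> keys (M x) \<subseteq> S'"
  shows "lift M \<in> homs"
proof -
  note [simp] = lift_coset[OF ann]
  have 1: "lift M A \<in> cod.Q" if A: "A \<in> dom.Q" for A
  proof -
    obtain f where f: "A = f +o dom.K" "keys f \<subseteq> S" using dom.Q_cases[OF A] .
    then show ?thesis using keys by (auto intro!: cod.coset_in_Q keys_lext_subset)
  qed
  have 2: "lift M (A + B) = lift M A + lift M B" if AB: "A \<in> dom.Q" "B \<in> dom.Q" for A B
  proof -
    obtain f g where fg: "A = f +o dom.K" "keys f \<subseteq> S" "B = g +o dom.K" "keys g \<subseteq> S"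
      using AB by (metis dom.Q_cases)
    then have "keys (f + g) \<subseteq> S" using keys_add[of f g] by blast
    then show ?thesis using fg by (simp add: dom.coset_add cod.coset_add free.lext_add)
  qed
  have 3: "lift M (coset_scale dom.K c A) = coset_scale cod.K c (lift M A)" if A: "A \<in> dom.Q" for A c
  proof -
    obtain f where f: "A = f +o dom.K" "keys f \<subseteq> S" using dom.Q_cases[OF A] .
    then have "keys (pscale c f) \<subseteq> S" using keys_pscale_subset[of c f] by blast
    then show ?thesis using f
      by (simp add: dom.coset_scale_coset cod.coset_scale_coset free.lext_pscale)
  qed
  show ?thesis using 1 2 3 by (auto simp: coset_hom_def lift_def)
qed

lemma coset_hom_in_Q: "\<phi> \<in> homs \<Longrightarrow> A \<in> dom.Q \<Longrightarrow> \<phi> A \<in> cod.Q"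
  by (auto simp: coset_hom_def)

lemma linear_on_coset_hom:
  assumes "\<phi> \<in> homs" "cod.linear_on sc g"
  shows "dom.linear_on sc (\<lambda>A. g (\<phi> A))"
  using assms coset_hom_in_Q[OF assms(1)]
  unfolding dom.linear_on_def cod.linear_on_def by (auto simp: coset_hom_def)

context
  fixes sc :: "'k \<Rightarrow> 'w::ab_group_add \<Rightarrow> 'w" and \<phi> t
  assumes vs: "vector_space sc" and \<phi>: "\<phi> \<in> homs"
    and ann: "annihilates sc R' t"
begin

lemma dual_annihilates: "annihilates sc R (dual sc \<phi> t)"
  using dom.linear_on_annihilates[OF vs linear_on_coset_hom[OF \<phi> cod.linear_on_coset_eval[OF vs ann]]]
  by (simp add: dual_def[abs_def])

lemma coset_eval_dual:
  assumes "A \<in> dom.Q"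
  shows "coset_eval sc t (\<phi> A) = coset_eval sc (dual sc \<phi> t) A"
  using dom.linear_on_eval[OF vs linear_on_coset_hom[OF \<phi> cod.linear_on_coset_eval[OF vs ann]] assms]
  by (simp add: dual_def[abs_def])

end

lemma dual_lift:
  assumes vs: "vector_space sc"
    and ann: "\<And>t. annihilates (*) R' t \<Longrightarrow> annihilates (*) R (\<lambda>x. lext (*) t (M x))"
    and t: "annihilates sc R' t" and x: "x \<in> S"
  shows "dual sc (lift M) t x = lext sc t (M x)"
  using x by (simp add: dual_def lift_coset[OF ann] cod.coset_eval_coset[OF vs t])

lemma coset_hom_eqI:
  assumes \<phi>: "\<phi> \<in> homs" and \<psi>: "\<psi> \<in> homs"
    and eq: "\<And>t x. annihilates (*) R' t \<Longrightarrow> x \<in> S \<Longrightarrow> dual (*) \<phi> t x = dual (*) \<psi> t x"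
  shows "\<phi> = \<psi>"
proof (rule ext)
  fix A
  show "\<phi> A = \<psi> A"
  proof (cases "A \<in> dom.Q")
    case True
    show ?thesis
    proof (rule cod.Q_eqI)
      fix t :: "'y \<Rightarrow> 'k" assume t: "annihilates (*) R' t"
      show "coset_eval (*) t (\<phi> A) = coset_eval (*) t (\<psi> A)"
        using dom.coset_eval_cong[OF True eq[OF t]]
        by (simp add: coset_eval_dual[OF scalar_vs \<phi> t True]
            coset_eval_dual[OF scalar_vs \<psi> t True])
    qed (use True \<phi> \<psi> in \<open>auto simp: coset_hom_def\<close>)
  next
    case False
    then show ?thesis using \<phi> \<psi> by (auto simp: coset_hom_def PiE_def extensional_def)
  qed
qed

lemma dual_fun_zero: "vector_space sc \<Longrightarrow> dual sc \<phi> (\<lambda>x. 0) = (\<lambda>x. 0)"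
  by (simp add: fun_eq_iff dual_def cod.coset_eval_fun_zero)

lemma dual_fun_add:
  "vector_space sc \<Longrightarrow> dual sc \<phi> (\<lambda>x. t x + t' x) = (\<lambda>x. dual sc \<phi> t x + dual sc \<phi> t' x)"
  by (simp add: fun_eq_iff dual_def cod.coset_eval_fun_add)

end

section \<open>Gradings and parity\<close>

lemma powi_minus_one: "(-1 :: 'k::field) powi n = (if even n then 1 else -1)"
  by (auto simp: power_int_def even_nat_iff)

lemma subspace_graded: "graded_vector_space s L \<Longrightarrow> module.subspace s (L i)"
  by (simp add: graded_vector_space_def)

lemma graded_desusp:
  fixes s :: "'k::field \<Rightarrow> 'v::ab_group_add \<Rightarrow> 'v"
  assumes "graded_vector_space s L"
  shows "graded_vector_space s (desusp L)"
  unfolding graded_vector_space_def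
proof (intro conjI allI)
  show "vector_space s" and "module.subspace s (desusp L i)" for i
    using assms by (simp_all add: graded_vector_space_def desusp_def)
next
  fix x :: 'v
  let ?P = "\<lambda>(L :: int \<Rightarrow> 'v set) c. (\<forall>i. c i \<in> L i) \<and> finite {i. c i \<noteq> 0} \<and> x = (\<Sum>i | c i \<noteq> 0. c i)"
  have shift: "?P L c \<longleftrightarrow> ?P (desusp L) (\<lambda>i. c (i + 1))" for c
  proof -
    have 1: "(\<lambda>i. i + 1) ` {i. c (i + 1) \<noteq> 0} = {i :: int. c i \<noteq> 0}"
      by (auto simp: image_iff intro!: exI[of _ "_ - 1"])
    have inj: "inj_on (\<lambda>i :: int. i + 1) {i. c (i + 1) \<noteq> 0}" by simp
    have "(\<forall>i. c i \<in> L i) \<longleftrightarrow> (\<forall>i. c (i + 1) \<in> L (i + 1))"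
      by (metis diff_add_cancel)
    moreover have "finite {i. c i \<noteq> 0} \<longleftrightarrow> finite {i. c (i + 1) \<noteq> 0}"
      using finite_image_iff[OF inj] by (simp only: 1)
    moreover have "(\<Sum>i | c i \<noteq> 0. c i) = (\<Sum>i | c (i + 1) \<noteq> 0. c (i + 1))"
      using sum.reindex[OF inj, of c] by (simp only: 1 o_def)
    ultimately show ?thesis by (simp add: desusp_def)
  qed
  have "\<exists>!c. ?P L c" using assms by (simp add: graded_vector_space_def)
  then obtain c where c: "?P L c" and uniq: "\<And>c'. ?P L c' \<Longrightarrow> c' = c" by blast
  show "\<exists>!c. ?P (desusp L) c"
  proof (rule ex1I)
    show "?P (desusp L) (\<lambda>i. c (i + 1))" using c shift by blast
  next
    fix b assume b: "?P (desusp L) b"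
    then have "?P L (\<lambda>i. b (i - 1))" using shift[of "\<lambda>i. b (i - 1)"] by simp
    then have "(\<lambda>i. b (i - 1)) = c" by (rule uniq)
    then have "c (i + 1) = b (i + 1 - 1)" for i by (rule fun_cong[OF sym])
    then show "b = (\<lambda>i. c (i + 1))" by simp
  qed
qed

locale graded_space =
  fixes s :: "'k::field_char_0 \<Rightarrow> 'v::ab_group_add \<Rightarrow> 'v" and V :: "int \<Rightarrow> 'v set"
  assumes graded: "graded_vector_space s V"
begin

sublocale vector_space s
  using graded by (simp add: graded_vector_space_def)

lemma subspace_V: "subspace (V i)"
  using graded by (simp add: graded_vector_space_def)

lemmas V_zero [simp] = subspace_0[OF subspace_V]
  and V_add = subspace_add[OF subspace_V]
  and V_scale = subspace_scale[OF subspace_V]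
  and V_neg = subspace_neg[OF subspace_V]

section \<open>Homogeneous components and the parity involution\<close>

definition decomposition where
  "decomposition x c \<longleftrightarrow>
     (\<forall>i. c i \<in> V i) \<and> finite {i. c i \<noteq> 0} \<and> x = (\<Sum>i | c i \<noteq> 0. c i)"

definition component where
  "component x = (THE c. decomposition x c)"

lemma decomposition_ex1: "\<exists>!c. decomposition x c"
  using graded by (simp add: graded_vector_space_def decomposition_def)

lemma decomposition_component: "decomposition x (component x)"
  unfolding component_def by (rule theI'[OF decomposition_ex1])

lemma component_in: "component x i \<in> V i"
  and finite_component: "finite {i. component x i \<noteq> 0}"
  and sum_component: "x = (\<Sum>i | component x i \<noteq> 0. component x i)"
  using decomposition_component[of x] by (auto simp: decomposition_def)

lemma component_eqI:
  assumes "finite I" "\<And>i. c i \<in> V i" "\<And>i. i \<notin> I \<Longrightarrow> c i = 0" "x = (\<Sum>i\<in>I. c i)"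
  shows "component x = c"
proof -
  have "{i. c i \<noteq> 0} \<subseteq> I" using assms(3) by blast
  then have "decomposition x c"
    using assms by (auto simp: decomposition_def finite_subset intro!: sum.mono_neutral_right)
  then show ?thesis using decomposition_ex1 decomposition_component by blast
qed

lemma sum_component_superset:
  assumes "finite I" "{i. component x i \<noteq> 0} \<subseteq> I"
  shows "x = (\<Sum>i\<in>I. component x i)"
proof -
  have "x = (\<Sum>i | component x i \<noteq> 0. component x i)" by (rule sum_component)
  also have "\<dots> = (\<Sum>i\<in>I. component x i)"
    using assms by (intro sum.mono_neutral_left) auto
  finally show ?thesis .
qed

lemma component_add: "component (x + y) = (\<lambda>i. component x i + component y i)"
proof -
  define I where "I = {i. component x i \<noteq> 0} \<union> {i. component y i \<noteq> 0}"
  have I: "finite I" by (simp add: I_def finite_component)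
  have "x = (\<Sum>i\<in>I. component x i)" "y = (\<Sum>i\<in>I. component y i)"
    using I by (auto intro!: sum_component_superset simp: I_def)
  then have "x + y = (\<Sum>i\<in>I. component x i + component y i)"
    by (simp add: sum.distrib)
  then show ?thesis
    using I by (intro component_eqI[of I]) (auto simp: V_add component_in I_def)
qed

lemma component_scale: "component (s c x) = (\<lambda>i. s c (component x i))"
proof -
  have "s c x = s c (\<Sum>i | component x i \<noteq> 0. component x i)" using sum_component by metis
  then show ?thesis
    by (intro component_eqI[OF finite_component[of x]])
      (auto simp: V_scale component_in scale_sum_right)
qed

lemma component_homogeneous: "x \<in> V p \<Longrightarrow> component x = (\<lambda>i. if i = p then x else 0)"
  by (rule component_eqI[of "{p}"]) auto

definition part where
  "part P x = (\<Sum>i | component x i \<noteq> 0. if P i then component x i else 0)"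

lemma part_superset:
  assumes "finite I" "{i. component x i \<noteq> 0} \<subseteq> I"
  shows "part P x = (\<Sum>i\<in>I. if P i then component x i else 0)"
  unfolding part_def using assms by (intro sum.mono_neutral_left) auto

lemma part_add: "part P (x + y) = part P x + part P y"
proof -
  define I where "I = {i. component x i \<noteq> 0} \<union> {i. component y i \<noteq> 0}"
  have I: "finite I" by (simp add: I_def finite_component)
  have "part P (x + y) = (\<Sum>i\<in>I. if P i then component (x + y) i else 0)"
    using I by (intro part_superset) (auto simp: I_def component_add)
  also have "\<dots> = (\<Sum>i\<in>I. if P i then component x i else 0) + (\<Sum>i\<in>I. if P i then component y i else 0)"
    unfolding component_add by (subst sum.distrib[symmetric]) (auto intro!: sum.cong)
  also have "\<dots> = part P x + part P y"
    using I by (subst (1 2) part_superset[of I]) (auto simp: I_def)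
  finally show ?thesis .
qed

lemma part_scale: "part P (s c x) = s c (part P x)"
proof -
  have "part P (s c x) = (\<Sum>i | component x i \<noteq> 0. if P i then component (s c x) i else 0)"
    by (intro part_superset finite_component) (auto simp: component_scale)
  then show ?thesis by (auto simp: part_def component_scale scale_sum_right intro!: sum.cong)
qed

lemma part_homogeneous: "x \<in> V p \<Longrightarrow> part P x = (if P p then x else 0)"
  by (cases "x = 0") (auto simp: part_def component_homogeneous if_distrib[of "\<lambda>x. x = 0"] cong: if_cong)

lemma homogeneous_induct [case_names homogeneous add]:
  assumes "\<And>p x. x \<in> V p \<Longrightarrow> P x" "\<And>x y. P x \<Longrightarrow> P y \<Longrightarrow> P (x + y)"
  shows "P x"
proof -
  have "P (\<Sum>i\<in>I. component x i)" if "finite I" for I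
    using that by induction (auto intro: assms component_in V_zero)
  then show ?thesis using sum_component finite_component by metis
qed

abbreviation ev where "ev \<equiv> part even"
abbreviation od where "od \<equiv> part odd"

text \<open>The parity involution x \<mapsto> (-1)^|x| x, extended to inhomogeneous vectors.
  Together with \<open>ev\<close> and \<open>od\<close> it expresses Koszul signs, because these
  depend only on the parities of degrees.\<close>

definition th where "th x = ev x - od x"

lemma part_zero [simp]: "part P 0 = 0"
  using part_homogeneous[OF V_zero] by simp

lemma ev_od: "ev x + od x = x"
  by (induction x rule: homogeneous_induct) (auto simp: part_homogeneous part_add algebra_simps)

lemma th_zero [simp]: "th 0 = 0"
  and th_add: "th (x + y) = th x + th y"
  and th_scale: "th (s c x) = s c (th x)"
  by (simp_all add: th_def part_add part_scale scale_right_diff_distrib)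

lemma th_homogeneous: "x \<in> V p \<Longrightarrow> th x = (if even p then x else - x)"
  by (simp add: th_def part_homogeneous)

lemma th_in: "x \<in> V p \<Longrightarrow> th x \<in> V p"
  by (simp add: th_homogeneous V_neg)

lemma part_in: "x \<in> V p \<Longrightarrow> part P x \<in> V p"
  by (simp add: part_homogeneous)

lemma part_minus: "part P (- x) = - part P x"
  using part_add[of P x "- x"] by (simp add: eq_neg_iff_add_eq_0 add.commute)

lemma th_th [simp]: "th (th x) = x"
  by (induction x rule: homogeneous_induct) (auto simp: th_homogeneous[OF V_neg] th_homogeneous th_add)

lemma part_th: "ev (th x) = ev x" "od (th x) = - od x" "th (ev x) = ev x" "th (od x) = - od x"
  by (induction x rule: homogeneous_induct)
    (auto simp: th_homogeneous th_add part_add part_homogeneous part_minus)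

lemma part_idem [simp]: "ev (ev x) = ev x" "od (od x) = od x" "ev (od x) = 0" "od (ev x) = 0"
proof -
  show "ev (ev x) = ev x" "od (od x) = od x" "ev (od x) = 0" "od (ev x) = 0"
    by (induction x rule: homogeneous_induct) (auto simp: part_homogeneous part_add)
qed

text \<open>Under a multilinear function this produces, for a homogeneous word \<open>a\<close>, the
  sign (-1)^(n|a|) of moving something of degree \<open>n\<close> past \<open>a\<close>; see
  \<open>multilinear_tw_homogeneous\<close>.\<close>

definition tw :: "int \<Rightarrow> 'v list \<Rightarrow> 'v list" where
  "tw n a = (if even n then a else map th a)"

lemma th_comp_th [simp]: "th \<circ> th = id"
  by (simp add: fun_eq_iff)

lemma map_th_th [simp]: "map th (map th a) = a"
  by (simp add: map_idI)

section \<open>Multilinear and graded symmetric functions of words\<close>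

text \<open>All word lengths at once, that is, a linear map on the tensor algebra; the value at the
  empty word is unconstrained.\<close>

definition multilinear :: "('k \<Rightarrow> 'w::ab_group_add \<Rightarrow> 'w) \<Rightarrow> ('v list \<Rightarrow> 'w) \<Rightarrow> bool" where
  "multilinear sc t \<longleftrightarrow>
     (\<forall>us ws x y. t (us @ (x + y) # ws) = t (us @ x # ws) + t (us @ y # ws)) \<and>
     (\<forall>us ws x c. t (us @ s c x # ws) = sc c (t (us @ x # ws)))"

definition graded_symmetric :: "('k \<Rightarrow> 'w::ab_group_add \<Rightarrow> 'w) \<Rightarrow> ('v list \<Rightarrow> 'w) \<Rightarrow> bool" where
  "graded_symmetric sc t \<longleftrightarrow> multilinear sc t \<and>
     (\<forall>us ws x y p q. x \<in> V p \<and> y \<in> V q \<longrightarrow>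
        t (us @ x # y # ws) = sc ((-1) powi (p * q)) (t (us @ y # x # ws)))"

definition multilinear2 where
  "multilinear2 sc F \<longleftrightarrow> (\<forall>a. multilinear sc (F a)) \<and> (\<forall>b. multilinear sc (\<lambda>a. F a b))"

definition graded_symmetric2 where
  "graded_symmetric2 sc F \<longleftrightarrow>
     (\<forall>a. graded_symmetric sc (F a)) \<and> (\<forall>b. graded_symmetric sc (\<lambda>a. F a b))"

lemma graded_symmetricD: "graded_symmetric sc t \<Longrightarrow> multilinear sc t"
  by (simp add: graded_symmetric_def)

lemma graded_symmetric2_multilinear2: "graded_symmetric2 sc F \<Longrightarrow> multilinear2 sc F"
  by (simp add: graded_symmetric2_def multilinear2_def graded_symmetricD)

lemma multilinear_add: "multilinear sc t \<Longrightarrow> t (us @ (x + y) # ws) = t (us @ x # ws) + t (us @ y # ws)"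
  and multilinear_scale: "multilinear sc t \<Longrightarrow> t (us @ s c x # ws) = sc c (t (us @ x # ws))"
  by (simp_all add: multilinear_def)

lemmas multilinear_add_Cons = multilinear_add[where us = "[]", simplified]
  and multilinear_scale_Cons = multilinear_scale[where us = "[]", simplified]

lemma multilinear_zero: "multilinear sc t \<Longrightarrow> t (us @ 0 # ws) = 0"
  using multilinear_add[of sc t us 0 0 ws] by simp

lemma multilinear_zero_mem: "multilinear sc t \<Longrightarrow> 0 \<in> set xs \<Longrightarrow> t xs = 0"
  using multilinear_zero by (metis split_list)

lemma multilinear_minus: "multilinear sc t \<Longrightarrow> t (us @ (- x) # ws) = - t (us @ x # ws)"
  using multilinear_add[of sc t us x "- x" ws] multilinear_zero[of sc t us ws]
  by (simp add: eq_neg_iff_add_eq_0 add.commute)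

lemmas multilinear_zero_Cons = multilinear_zero[where us = "[]", simplified]
  and multilinear_minus_Cons = multilinear_minus[where us = "[]", simplified]

lemma multilinear_Cons: "multilinear sc t \<Longrightarrow> multilinear sc (\<lambda>a. t (x # a))"
  unfolding multilinear_def by (metis append_Cons)

lemma multilinear_append: "multilinear sc t \<Longrightarrow> multilinear sc (\<lambda>a. t (a @ b))"
  unfolding multilinear_def by simp

lemma multilinear_map_th: "multilinear sc t \<Longrightarrow> multilinear sc (\<lambda>a. t (map th a))"
  unfolding multilinear_def by (simp add: th_add th_scale)

lemma multilinear_fun_add:
  "vector_space sc \<Longrightarrow> multilinear sc t \<Longrightarrow> multilinear sc t' \<Longrightarrow> multilinear sc (\<lambda>a. t a + t' a)"
  unfolding multilinear_def by (simp add: vector_space.vector_space_assms(1))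

lemma graded_symmetric_Cons: "graded_symmetric sc t \<Longrightarrow> graded_symmetric sc (\<lambda>a. t (x # a))"
  unfolding graded_symmetric_def using multilinear_Cons by (metis append_Cons)

lemma graded_symmetric_append: "graded_symmetric sc t \<Longrightarrow> graded_symmetric sc (\<lambda>a. t (a @ b))"
  unfolding graded_symmetric_def by (simp add: multilinear_append)

lemma graded_symmetric_map_th: "graded_symmetric sc t \<Longrightarrow> graded_symmetric sc (\<lambda>a. t (map th a))"
  unfolding graded_symmetric_def by (simp add: multilinear_map_th th_in)

lemma graded_symmetric_tw: "graded_symmetric sc t \<Longrightarrow> graded_symmetric sc (\<lambda>a. t (tw n a))"
  by (cases "even n") (simp_all add: tw_def graded_symmetric_map_th)

lemma graded_symmetric_fun_add:
  "vector_space sc \<Longrightarrow> graded_symmetric sc t \<Longrightarrow> graded_symmetric sc t' \<Longrightarrow>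
     graded_symmetric sc (\<lambda>a. t a + t' a)"
  unfolding graded_symmetric_def
  by (simp add: multilinear_fun_add vector_space.vector_space_assms(1))

lemma graded_symmetric_zero: "vector_space sc \<Longrightarrow> graded_symmetric sc (\<lambda>a. 0)"
proof -
  assume "vector_space sc"
  then interpret W: vector_space sc .
  show ?thesis by (simp add: graded_symmetric_def multilinear_def)
qed

lemma graded_symmetric_comp:
  assumes "Vector_Spaces.linear sc sc' g" "graded_symmetric sc t"
  shows "graded_symmetric sc' (\<lambda>a. g (t a))"
proof -
  interpret g: Vector_Spaces.linear sc sc' g by fact
  show ?thesis using assms(2) by (simp add: graded_symmetric_def multilinear_def g.add g.scale)
qed

text \<open>Every letter is a sum of homogeneous ones. The induction runs over the suffix
  \<open>ws\<close> of arbitrary letters and appends the components of its first letter to the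
  homogeneous prefix \<open>us\<close>.\<close>

lemma homogeneous_ext:
  assumes t: "multilinear sc t" "multilinear sc t'"
    and eq: "\<And>ds ys. homog V ds ys \<Longrightarrow> length ys = length xs \<Longrightarrow> t ys = t' ys"
  shows "t xs = t' xs"
proof -
  have "t (us @ ws) = t' (us @ ws)" if "homog V ds us" "length us + length ws = length xs" for ds us ws
    using that
  proof (induction ws arbitrary: ds us)
    case Nil
    then show ?case using eq by simp
  next
    case (Cons x ws)
    show ?case
    proof (induction x rule: homogeneous_induct)
      case (homogeneous p x)
      have "homog V (ds @ [p]) (us @ [x])"
        using Cons.prems homogeneous by (simp add: homog_def list_all2_appendI)
      from Cons.IH[OF this] show ?case using Cons.prems by simp
    next
      case (add x y)
      then show ?case by (simp add: multilinear_add[OF t(1)] multilinear_add[OF t(2)])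
    qed
  qed
  from this[of "[]" "[]" xs] show ?thesis by (simp add: homog_def)
qed

context
  fixes sc :: "'k \<Rightarrow> 'w::ab_group_add \<Rightarrow> 'w"
  assumes vs: "vector_space sc"
begin

interpretation W: vector_space sc by (rule vs)

lemma graded_symmetric_map_th_homogeneous:
  assumes "multilinear sc t" "homog V ds a"
  shows "t (us @ map th a) = sc ((-1) powi sum_list ds) (t (us @ a))"
  using assms(2)
proof (induction ds a arbitrary: us rule: list_induct2')
  case (4 d ds x a)
  then have x: "x \<in> V d" and a: "homog V ds a" by (simp_all add: homog_def)
  have "t (us @ map th (x # a)) = t ((us @ [th x]) @ map th a)" by simp
  also have "\<dots> = sc ((-1) powi sum_list ds) (t ((us @ [th x]) @ a))" by (rule "4.IH"[OF a])
  also have "\<dots> = sc ((-1) powi sum_list (d # ds)) (t (us @ x # a))"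
    using x by (auto simp: th_homogeneous powi_minus_one multilinear_minus[OF assms(1)])
  finally show ?case by simp
qed (simp_all add: homog_def)

lemma multilinear_tw_homogeneous:
  assumes "multilinear sc t" "homog V ds a"
  shows "t (tw n a) = sc ((-1) powi (n * sum_list ds)) (t a)"
  using graded_symmetric_map_th_homogeneous[OF assms, of "[]"]
  by (auto simp: tw_def powi_minus_one)

text \<open>Only \<open>x\<close> is homogeneous here: for odd \<open>x\<close> the sign (-1)^|y| is
  carried by \<open>th y\<close>, which is additive in \<open>y\<close>.\<close>

lemma graded_symmetric_swap:
  assumes t: "graded_symmetric sc t" and x: "x \<in> V p"
  shows "t (us @ (if even p then y else th y) # x # ws) = t (us @ x # y # ws)"
proof (induction y rule: homogeneous_induct)
  case (homogeneous q y)
  have eq: "t (us @ x # y # ws) = sc ((-1) powi (p * q)) (t (us @ y # x # ws))"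
    using t x homogeneous unfolding graded_symmetric_def by blast
  show ?case unfolding eq
    by (simp add: powi_minus_one th_homogeneous[OF homogeneous]
        multilinear_minus[OF graded_symmetricD[OF t]])
next
  case (add y z)
  note m = multilinear_add[OF graded_symmetricD[OF t]]
  have "t (us @ x # (y + z) # ws) = t (us @ x # y # ws) + t (us @ x # z # ws)"
    using m[of "us @ [x]"] by simp
  then show ?case using add by (auto simp: th_add m split: if_splits)
qed

lemma graded_symmetric_move:
  assumes t: "graded_symmetric sc t" and x: "x \<in> V p"
  shows "t (us @ tw p a @ x # ws) = t (us @ x # a @ ws)"
proof (induction a arbitrary: us)
  case (Cons y a)
  let ?y = "if even p then y else th y"
  have "t (us @ tw p (y # a) @ x # ws) = t ((us @ [?y]) @ tw p a @ x # ws)"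
    by (simp add: tw_def)
  also have "\<dots> = t (us @ ?y # x # a @ ws)" using Cons[of "us @ [?y]"] by simp
  also have "\<dots> = t (us @ x # y # a @ ws)" by (rule graded_symmetric_swap[OF t x])
  finally show ?case by simp
qed (simp add: tw_def)

text \<open>The even part of \<open>x\<close> passes \<open>a\<close> without a sign, the odd part
  with the sign (-1)^|a|. The left-hand side is the pair of summands that \<open>unshuffle\<close>
  produces for a letter sent to the right factor.\<close>

lemma graded_symmetric_move_parts:
  assumes t: "graded_symmetric sc t"
  shows "t (a @ ev x # b) + t (map th a @ od x # b) = t (x # a @ b)"
proof (induction x rule: homogeneous_induct)
  case (homogeneous p x)
  have "t (tw p a @ x # b) = t (x # a @ b)"
    using graded_symmetric_move[OF t homogeneous, of "[]"] by simp
  then show ?case using graded_symmetricD[OF t]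
    by (auto simp: part_homogeneous[OF homogeneous] tw_def multilinear_zero split: if_splits)
next
  case (add x y)
  note m = multilinear_add[OF graded_symmetricD[OF t]]
  have "t ((x + y) # a @ b) = t (x # a @ b) + t (y # a @ b)" using m[of "[]"] by simp
  moreover have "t (a @ ev (x + y) # b) = t (a @ ev x # b) + t (a @ ev y # b)"
    "t (map th a @ od (x + y) # b) = t (map th a @ od x # b) + t (map th a @ od y # b)"
    by (simp_all only: part_add m)
  ultimately show ?case by (simp only: add[symmetric] ac_simps)
qed

end

section \<open>Sums over unshuffles of a word\<close>

text \<open>The sum of \<open>F a b\<close> over the terms \<open>a \<otimes> b\<close> of the unshuffle coproduct of the word \<open>xs\<close> in the
  unital tensor algebra.  A letter joins the left factor, or moves past the left factor to the
  right one; the sign of the latter is produced by applying the parity involution to the left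
  factor when the letter is odd, which makes sense for inhomogeneous letters.\<close>

primrec unshuffle ::
  "'v list \<Rightarrow> ('v list \<Rightarrow> 'v list \<Rightarrow> 'w::ab_group_add) \<Rightarrow> 'w" where
  "unshuffle [] F = F [] []"
| "unshuffle (x # xs) F =
     unshuffle xs (\<lambda>a b. F (x # a) b + F a (ev x # b) + F (map th a) (od x # b))"

lemma unshuffle_linear:
  assumes "\<And>x y. g (x + y) = g x + g y"
  shows "g (unshuffle xs F) = unshuffle xs (\<lambda>a b. g (F a b))"
  by (induction xs arbitrary: F) (simp_all add: assms)

lemma unshuffle_add:
  "unshuffle xs (\<lambda>a b. F a b + G a b) = unshuffle xs F + unshuffle xs G"
proof (induction xs arbitrary: F G)
  case (Cons x xs)
  show ?case by (simp add: Cons.IH[symmetric] ac_simps)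
qed simp

lemma unshuffle_zero [simp]: "unshuffle xs (\<lambda>a b. 0) = 0"
  by (induction xs) simp_all

lemma unshuffle_cong:
  assumes "\<And>a b. length a + length b = length xs \<Longrightarrow> F a b = G a b"
  shows "unshuffle xs F = unshuffle xs G"
  using assms
proof (induction xs arbitrary: F G)
  case (Cons x xs)
  show ?case by (simp, rule Cons.IH) (simp add: Cons.prems)
qed simp

lemma unshuffle_map_th:
  "unshuffle (map th xs) F = unshuffle xs (\<lambda>a b. F (map th a) (map th b))"
  by (induction xs arbitrary: F) (simp_all add: part_th)

lemma unshuffle_Nil_right:
  "unshuffle xs (\<lambda>a b. if b = [] then g a else 0) = g xs"
  by (induction xs arbitrary: g) simp_all

lemma unshuffle_homogeneous_Cons:
  assumes x: "x \<in> V p" and F: "\<And>a. multilinear sc (F a)"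
  shows "unshuffle (x # xs) F = unshuffle xs (\<lambda>a b. F (x # a) b + F (tw p a) (x # b))"
  using multilinear_zero_Cons[OF F] by (simp add: part_homogeneous[OF x] tw_def)

end

section \<open>Shuffles\<close>

text \<open>A shuffle of \<open>n + 1\<close> positions arises from one of \<open>n\<close> positions by inserting the value
  \<open>0\<close> at the beginning of one of the two blocks, that is, at position \<open>0\<close> or \<open>i\<close>.\<close>

definition insert_zero :: "nat \<Rightarrow> (nat \<Rightarrow> nat) \<Rightarrow> nat \<Rightarrow> nat" where
  "insert_zero p \<sigma> k = (if k < p then Suc (\<sigma> k) else if k = p then 0 else Suc (\<sigma> (k - 1)))"

definition delete_zero :: "nat \<Rightarrow> (nat \<Rightarrow> nat) \<Rightarrow> nat \<Rightarrow> nat" where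
  "delete_zero p \<sigma> k = \<sigma> (if k < p then k else Suc k) - 1"

lemma finite_shuffle_perms: "finite (shuffle_perms i m)"
  by (rule finite_subset[OF _ finite_permutations[of "{..<i + m}"]]) (auto simp: shuffle_perms_def)

lemma shuffle_perms_permutes: "\<sigma> \<in> shuffle_perms i m \<Longrightarrow> \<sigma> permutes {..<i + m}"
  by (simp add: shuffle_perms_def)

lemma delete_insert_zero [simp]: "delete_zero p (insert_zero p \<sigma>) = \<sigma>"
  by (auto simp: delete_zero_def insert_zero_def fun_eq_iff)

lemma inj_insert_zero: "inj (insert_zero p)"
  by (rule inj_on_inverseI) (rule delete_insert_zero)

lemma permutes_lessThan_iff:
  "\<sigma> permutes {..<n :: nat} \<longleftrightarrow> inj \<sigma> \<and> (\<forall>k<n. \<sigma> k < n) \<and> (\<forall>k\<ge>n. \<sigma> k = k)"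
proof
  assume \<sigma>: "\<sigma> permutes {..<n}"
  then show "inj \<sigma> \<and> (\<forall>k<n. \<sigma> k < n) \<and> (\<forall>k\<ge>n. \<sigma> k = k)"
    using permutes_in_image[OF \<sigma>] permutes_not_in[OF \<sigma>] permutes_inj[OF \<sigma>] by auto
next
  assume r: "inj \<sigma> \<and> (\<forall>k<n. \<sigma> k < n) \<and> (\<forall>k\<ge>n. \<sigma> k = k)"
  then have "inj_on \<sigma> {..<n}" "\<sigma> ` {..<n} \<subseteq> {..<n}" by (auto intro: inj_on_subset)
  then have "bij_betw \<sigma> {..<n} {..<n}"
    by (simp add: bij_betw_def endo_inj_surj)
  then show "\<sigma> permutes {..<n}" using r by (intro bij_imp_permutes) auto
qed

lemma insert_zero_permutes:
  assumes "\<sigma> permutes {..<n}" "p \<le> n"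
  shows "insert_zero p \<sigma> permutes {..<Suc n}"
proof -
  have r: "inj \<sigma>" "\<And>k. k < n \<Longrightarrow> \<sigma> k < n" "\<And>k. k \<ge> n \<Longrightarrow> \<sigma> k = k"
    using assms by (auto simp: permutes_lessThan_iff)
  have "inj (insert_zero p \<sigma>)"
  proof (rule injI)
    fix k l assume kl: "insert_zero p \<sigma> k = insert_zero p \<sigma> l"
    let ?g = "\<lambda>k. if k < p then k else k - 1"
    have g: "insert_zero p \<sigma> k = (if k = p then 0 else Suc (\<sigma> (?g k)))" for k
      by (simp add: insert_zero_def)
    show "k = l"
    proof (cases "k = p \<or> l = p")
      case True
      then show ?thesis using kl by (auto simp: g split: if_splits)
    next
      case False
      then have "\<sigma> (?g k) = \<sigma> (?g l)" using kl by (simp only: g if_False) simp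
      then have "?g k = ?g l" by (rule injD[OF r(1)])
      then show ?thesis using False by (auto split: if_splits)
    qed
  qed
  moreover have "insert_zero p \<sigma> k < Suc n" if "k < Suc n" for k
    using r(2)[of k] r(2)[of "k - 1"] that assms(2) by (auto simp: insert_zero_def)
  moreover have "insert_zero p \<sigma> k = k" if "k \<ge> Suc n" for k
    using r(3)[of "k - 1"] that assms(2) by (auto simp: insert_zero_def)
  ultimately show ?thesis by (simp add: permutes_lessThan_iff)
qed

lemma delete_zero:
  assumes "\<sigma> permutes {..<Suc n}" "p \<le> n" "\<sigma> p = 0"
  shows "delete_zero p \<sigma> permutes {..<n}" and "insert_zero p (delete_zero p \<sigma>) = \<sigma>"
proof -
  have r: "inj \<sigma>" "\<And>k. k < Suc n \<Longrightarrow> \<sigma> k < Suc n" "\<And>k. k \<ge> Suc n \<Longrightarrow> \<sigma> k = k"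
    using assms by (auto simp: permutes_lessThan_iff)
  have pos: "\<sigma> k > 0" if "k \<noteq> p" for k
    using injD[OF r(1), of k p] that assms(3) by auto
  let ?f = "\<lambda>k. if k < p then k else Suc k"
  have fp: "\<sigma> (?f k) > 0" for k by (rule pos) auto
  have "inj (delete_zero p \<sigma>)"
  proof (rule injI)
    fix k l assume "delete_zero p \<sigma> k = delete_zero p \<sigma> l"
    then have "\<sigma> (?f k) - 1 = \<sigma> (?f l) - 1" by (simp only: delete_zero_def)
    with fp[of k] fp[of l] have "\<sigma> (?f k) = \<sigma> (?f l)" by linarith
    then have "?f k = ?f l" by (rule injD[OF r(1)])
    then show "k = l" by (auto split: if_splits)
  qed
  moreover have "delete_zero p \<sigma> k < n" if "k < n" for k
  proof -
    have "\<sigma> (?f k) < Suc n" using that by (intro r(2)) auto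
    with fp[of k] have "\<sigma> (?f k) - 1 < n" by linarith
    then show ?thesis by (simp only: delete_zero_def)
  qed
  moreover have "delete_zero p \<sigma> k = k" if "k \<ge> n" for k
    using that assms(2) r(3)[of "Suc k"] by (auto simp: delete_zero_def)
  ultimately show "delete_zero p \<sigma> permutes {..<n}" by (simp add: permutes_lessThan_iff)
  show "insert_zero p (delete_zero p \<sigma>) = \<sigma>"
  proof
    fix k
    show "insert_zero p (delete_zero p \<sigma>) k = \<sigma> k"
      using pos[of k] assms(3) by (auto simp: insert_zero_def delete_zero_def)
  qed
qed

lemma insert_zero_shuffle_iff:
  assumes "\<sigma> permutes {..<i + m}"
  shows "insert_zero 0 \<sigma> \<in> shuffle_perms (Suc i) m \<longleftrightarrow> \<sigma> \<in> shuffle_perms i m"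
    and "insert_zero i \<sigma> \<in> shuffle_perms i (Suc m) \<longleftrightarrow> \<sigma> \<in> shuffle_perms i m"
proof -
  have p: "insert_zero 0 \<sigma> permutes {..<Suc (i + m)}" "insert_zero i \<sigma> permutes {..<Suc (i + m)}"
    using assms by (simp_all add: insert_zero_permutes)
  have m0: "strict_mono_on {..<Suc i} (insert_zero 0 \<sigma>) \<longleftrightarrow> strict_mono_on {..<i} \<sigma>"
    "strict_mono_on {Suc i..<Suc i + m} (insert_zero 0 \<sigma>) \<longleftrightarrow> strict_mono_on {i..<i + m} \<sigma>"
    "strict_mono_on {..<i} (insert_zero i \<sigma>) \<longleftrightarrow> strict_mono_on {..<i} \<sigma>"
    "strict_mono_on {i..<i + Suc m} (insert_zero i \<sigma>) \<longleftrightarrow> strict_mono_on {i..<i + m} \<sigma>"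
  proof -
    have shift: "strict_mono_on {Suc a..<Suc b} (insert_zero q \<sigma>) \<longleftrightarrow> strict_mono_on {a..<b} \<sigma>"
      if "q \<le> a" for a b q
    proof
      assume l: "strict_mono_on {Suc a..<Suc b} (insert_zero q \<sigma>)"
      show "strict_mono_on {a..<b} \<sigma>"
      proof (rule strict_mono_onI)
        fix r t assume "r \<in> {a..<b}" "t \<in> {a..<b}" "r < t"
        then show "\<sigma> r < \<sigma> t"
          using strict_mono_onD[OF l, of "Suc r" "Suc t"] that by (simp add: insert_zero_def)
      qed
    next
      assume l: "strict_mono_on {a..<b} \<sigma>"
      show "strict_mono_on {Suc a..<Suc b} (insert_zero q \<sigma>)"
      proof (rule strict_mono_onI)
        fix r t assume "r \<in> {Suc a..<Suc b}" "t \<in> {Suc a..<Suc b}" "r < t"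
        then show "insert_zero q \<sigma> r < insert_zero q \<sigma> t"
          using strict_mono_onD[OF l, of "r - 1" "t - 1"] that by (auto simp: insert_zero_def)
      qed
    qed
    have zero: "strict_mono_on {q..<Suc b} (insert_zero q \<sigma>) \<longleftrightarrow> strict_mono_on {Suc q..<Suc b} (insert_zero q \<sigma>)"
      for b q
    proof
      assume l: "strict_mono_on {Suc q..<Suc b} (insert_zero q \<sigma>)"
      show "strict_mono_on {q..<Suc b} (insert_zero q \<sigma>)"
      proof (rule strict_mono_onI)
        fix r t assume rt: "r \<in> {q..<Suc b}" "t \<in> {q..<Suc b}" "r < t"
        show "insert_zero q \<sigma> r < insert_zero q \<sigma> t"
        proof (cases "r = q")
          case True
          then show ?thesis using rt by (simp add: insert_zero_def)
        next
          case False
          then show ?thesis using rt strict_mono_onD[OF l, of r t] by simp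
        qed
      qed
    qed (auto simp: strict_mono_on_def)
    show "strict_mono_on {..<Suc i} (insert_zero 0 \<sigma>) \<longleftrightarrow> strict_mono_on {..<i} \<sigma>"
      using zero[of 0 i] shift[of 0 0 i] by (simp add: atLeast0LessThan)
    show "strict_mono_on {Suc i..<Suc i + m} (insert_zero 0 \<sigma>) \<longleftrightarrow> strict_mono_on {i..<i + m} \<sigma>"
      using shift[of 0 i "i + m"] by simp
    show "strict_mono_on {i..<i + Suc m} (insert_zero i \<sigma>) \<longleftrightarrow> strict_mono_on {i..<i + m} \<sigma>"
      using zero[of i "i + m"] shift[of i i "i + m"] by simp
    show "strict_mono_on {..<i} (insert_zero i \<sigma>) \<longleftrightarrow> strict_mono_on {..<i} \<sigma>"
      by (auto simp: strict_mono_on_def insert_zero_def)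
  qed
  show "insert_zero 0 \<sigma> \<in> shuffle_perms (Suc i) m \<longleftrightarrow> \<sigma> \<in> shuffle_perms i m"
    "insert_zero i \<sigma> \<in> shuffle_perms i (Suc m) \<longleftrightarrow> \<sigma> \<in> shuffle_perms i m"
    using assms p m0 by (simp_all add: shuffle_perms_def)
qed

text \<open>The value 0 is the least one and \<sigma> increases on both blocks, so it can only be
  taken at the start of a block.\<close>

lemma shuffle_zero_position:
  assumes "\<sigma> \<in> shuffle_perms i m" "0 < i + m"
  shows "(0 < i \<and> \<sigma> 0 = 0) \<or> (0 < m \<and> \<sigma> i = 0)"
proof -
  have \<sigma>: "\<sigma> permutes {..<i + m}" and m1: "strict_mono_on {..<i} \<sigma>"
    and m2: "strict_mono_on {i..<i + m} \<sigma>"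
    using assms(1) by (simp_all add: shuffle_perms_def)
  obtain p where p: "\<sigma> p = 0" using permutes_surj[OF \<sigma>] by (metis surjD)
  have "p < i + m" using p \<sigma> assms(2) by (metis gr_implies_not0 lessThan_iff permutes_not_in)
  then consider "p < i" "p = 0" | "p < i" "0 < p" | "p = i" "0 < m" | "i < p" by linarith
  then show ?thesis
  proof cases
    case 2
    then show ?thesis using strict_mono_onD[OF m1, of 0 p] p by simp
  next
    case 4
    then show ?thesis using strict_mono_onD[OF m2, of i p] p \<open>p < i + m\<close> by simp
  qed (use p in auto)
qed

lemma shuffle_perms_insert_zero:
  assumes "i + m = Suc n"
  shows "shuffle_perms i m =
    (if i = 0 then {} else insert_zero 0 ` shuffle_perms (i - 1) m) \<union>
    (if m = 0 then {} else insert_zero i ` shuffle_perms i (m - 1))" (is "_ = ?A \<union> ?B")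
proof (intro set_eqI iffI)
  fix \<sigma> assume \<sigma>: "\<sigma> \<in> shuffle_perms i m"
  then have perm: "\<sigma> permutes {..<Suc n}" using assms by (simp add: shuffle_perms_def)
  consider "0 < i" "\<sigma> 0 = 0" | "0 < m" "\<sigma> i = 0"
    using shuffle_zero_position[OF \<sigma>] assms by auto
  then show "\<sigma> \<in> ?A \<union> ?B"
  proof cases
    case 1
    note d = delete_zero[OF perm _ 1(2), simplified]
    have "delete_zero 0 \<sigma> \<in> shuffle_perms (i - 1) m"
      using insert_zero_shuffle_iff(1)[of "delete_zero 0 \<sigma>" "i - 1" m] d \<sigma> 1(1) assms by simp
    then show ?thesis using d(2) 1(1) by (auto intro!: image_eqI)
  next
    case 2
    have "i \<le> n" using 2 assms by simp
    note d = delete_zero[OF perm this 2(2)]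
    have "delete_zero i \<sigma> \<in> shuffle_perms i (m - 1)"
      using insert_zero_shuffle_iff(2)[of "delete_zero i \<sigma>" i "m - 1"] d \<sigma> 2(1) assms by simp
    then show ?thesis using d(2) 2(1) by (auto intro!: image_eqI)
  qed
next
  fix \<sigma> assume "\<sigma> \<in> ?A \<union> ?B"
  then show "\<sigma> \<in> shuffle_perms i m"
  proof
    assume "\<sigma> \<in> ?A"
    then obtain \<tau> where \<tau>: "0 < i" "\<sigma> = insert_zero 0 \<tau>" "\<tau> \<in> shuffle_perms (i - 1) m"
      by (auto split: if_splits)
    then show ?thesis
      using insert_zero_shuffle_iff(1)[OF shuffle_perms_permutes[OF \<tau>(3)]] by simp
  next
    assume "\<sigma> \<in> ?B"
    then obtain \<tau> where \<tau>: "0 < m" "\<sigma> = insert_zero i \<tau>" "\<tau> \<in> shuffle_perms i (m - 1)"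
      by (auto split: if_splits)
    then show ?thesis
      using insert_zero_shuffle_iff(2)[OF shuffle_perms_permutes[OF \<tau>(3)]] by simp
  qed
qed

text \<open>Pascal's rule for shuffles. The two summands correspond to the two places a first letter
  can go in the recursion of \<open>unshuffle\<close>.\<close>

lemma sum_shuffle_perms_Suc:
  fixes g :: "nat \<Rightarrow> (nat \<Rightarrow> nat) \<Rightarrow> 'w::ab_group_add"
  shows "(\<Sum>i\<le>Suc n. \<Sum>\<sigma>\<in>shuffle_perms i (Suc n - i). g i \<sigma>) =
    (\<Sum>i\<le>n. \<Sum>\<sigma>\<in>shuffle_perms i (n - i). g (Suc i) (insert_zero 0 \<sigma>) + g i (insert_zero i \<sigma>))"
proof -
  let ?A = "\<lambda>i. if i = 0 then {} else insert_zero 0 ` shuffle_perms (i - 1) (Suc n - i)"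
  let ?B = "\<lambda>i. if Suc n - i = 0 then {} else insert_zero i ` shuffle_perms i (Suc n - i - 1)"
  have "(\<Sum>\<sigma>\<in>shuffle_perms i (Suc n - i). g i \<sigma>) = (\<Sum>\<sigma>\<in>?A i. g i \<sigma>) + (\<Sum>\<sigma>\<in>?B i. g i \<sigma>)"
    if "i \<le> Suc n" for i
  proof -
    have eq: "shuffle_perms i (Suc n - i) = ?A i \<union> ?B i"
      using that by (intro shuffle_perms_insert_zero) simp
    \<comment> \<open>For \<open>i > 0\<close> the two families differ at position 0, where the
      first takes the value 0 and the second a successor; for \<open>i = 0\<close> the first is
      empty.\<close>
    have disj: "?A i \<inter> ?B i = {}"
    proof -
      have "insert_zero 0 \<sigma> 0 \<noteq> insert_zero i \<tau> 0" if "i \<noteq> 0" for \<sigma> \<tau>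
        using that by (simp add: insert_zero_def)
      then show ?thesis by (auto split: if_splits) metis+
    qed
    show ?thesis unfolding eq
      by (intro sum.union_disjoint disj) (simp_all add: finite_shuffle_perms)
  qed
  then have "(\<Sum>i\<le>Suc n. \<Sum>\<sigma>\<in>shuffle_perms i (Suc n - i). g i \<sigma>) =
      (\<Sum>i\<le>Suc n. \<Sum>\<sigma>\<in>?A i. g i \<sigma>) + (\<Sum>i\<le>Suc n. \<Sum>\<sigma>\<in>?B i. g i \<sigma>)"
    by (simp add: sum.distrib)
  also have "(\<Sum>i\<le>Suc n. \<Sum>\<sigma>\<in>?A i. g i \<sigma>) = (\<Sum>i\<le>n. \<Sum>\<sigma>\<in>shuffle_perms i (n - i). g (Suc i) (insert_zero 0 \<sigma>))"
    unfolding sum.atMost_Suc_shift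
    by (simp add: sum.reindex inj_on_subset[OF inj_insert_zero])
  also have "(\<Sum>i\<le>Suc n. \<Sum>\<sigma>\<in>?B i. g i \<sigma>) = (\<Sum>i\<le>n. \<Sum>\<sigma>\<in>shuffle_perms i (n - i). g i (insert_zero i \<sigma>))"
  proof -
    have "(\<Sum>\<sigma>\<in>?B i. g i \<sigma>) = (\<Sum>\<sigma>\<in>shuffle_perms i (n - i). g i (insert_zero i \<sigma>))" if "i \<le> n" for i
      using that by (simp add: sum.reindex inj_on_subset[OF inj_insert_zero])
    then show ?thesis by simp
  qed
  finally show ?thesis by (simp add: sum.distrib)
qed

lemma permute_list_insert_zero:
  assumes "\<sigma> permutes {..<length xs}" "p \<le> length xs"
  shows "permute_list (insert_zero p \<sigma>) (x # xs) =
    take p (permute_list \<sigma> xs) @ x # drop p (permute_list \<sigma> xs)"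
proof (rule nth_equalityI)
  fix k assume "k < length (permute_list (insert_zero p \<sigma>) (x # xs))"
  then have k: "k < Suc (length xs)" by simp
  have "insert_zero p \<sigma> permutes {..<length (x # xs)}"
    using insert_zero_permutes[OF assms] by simp
  then have 1: "permute_list (insert_zero p \<sigma>) (x # xs) ! k = (x # xs) ! insert_zero p \<sigma> k"
    using k by (simp add: permute_list_nth)
  have [simp]: "permute_list \<sigma> xs ! j = xs ! \<sigma> j" if "j < length xs" for j
    using that assms by (simp add: permute_list_nth)
  consider "k < p" | "k = p" | "p < k" by linarith
  then show "permute_list (insert_zero p \<sigma>) (x # xs) ! k =
      (take p (permute_list \<sigma> xs) @ x # drop p (permute_list \<sigma> xs)) ! k"
  proof cases
    case 3
    then have "k = Suc (k - 1)" "p + (k - Suc p) = k - 1" by simp_all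
    then show ?thesis using 3 k assms(2)
      by (simp add: 1 insert_zero_def nth_append nth_Cons')
  qed (unfold 1, use k assms(2) in \<open>simp_all add: insert_zero_def nth_append\<close>)
qed (use assms in simp)

lemma powi_minus_one_sum:
  "(\<Prod>i\<in>I. (-1 :: 'k::field) powi (f i)) = (-1) powi (\<Sum>i\<in>I. f i)"
  by (induction I rule: infinite_finite_induct) (auto simp: power_int_add)

text \<open>The inversions of the new permutation are the shifted old ones together with the pairs
  \<open>(k, p)\<close> for \<open>k < p\<close>: the letter with index 0 stands behind
  \<open>p\<close> letters and has to pass them all.\<close>

lemma koszul_sign_insert_zero:
  assumes \<sigma>: "\<sigma> permutes {..<length ds}" and p: "p \<le> length ds"
  shows "(koszul_sign (d # ds) (insert_zero p \<sigma>) :: 'k::field) =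
    (-1) powi (d * sum_list (take p (permute_list \<sigma> ds))) * koszul_sign ds \<sigma>"
proof -
  let ?\<sigma> = "insert_zero p \<sigma>" and ?n = "length ds"
  let ?f = "\<lambda>k. if k < p then k else Suc k"
  let ?I = "{(a, b). a < b \<and> b < ?n \<and> \<sigma> b < \<sigma> a}"
  let ?t = "\<lambda>(a, b). (-1 :: 'k) powi ((d # ds) ! ?\<sigma> a * (d # ds) ! ?\<sigma> b)"
  have f: "?\<sigma> (?f k) = Suc (\<sigma> k)" "?\<sigma> p = 0" for k by (auto simp: insert_zero_def)
  have inv: "{(a, b). a < b \<and> b < length (d # ds) \<and> ?\<sigma> b < ?\<sigma> a} =
      (\<lambda>(a, b). (?f a, ?f b)) ` ?I \<union> (\<lambda>k. (k, p)) ` {..<p}" (is "?L = ?R")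
  proof (intro subset_antisym subrelI)
    fix a b assume "(a, b) \<in> ?L"
    then have ab: "a < b" "b < length (d # ds)" "?\<sigma> b < ?\<sigma> a" by auto
    show "(a, b) \<in> ?R"
    proof (cases "b = p")
      case True
      then show ?thesis using ab by auto
    next
      case False
      have "a \<noteq> p" using ab(3) f(2) by auto
      define a' b' where "a' = (if a < p then a else a - 1)" and "b' = (if b < p then b else b - 1)"
      have fab: "?f a' = a" "?f b' = b" using False \<open>a \<noteq> p\<close> by (auto simp: a'_def b'_def)
      then have "\<sigma> b' < \<sigma> a'" using ab(3) f(1)[of a'] f(1)[of b'] by simp
      moreover have "a' < b'" using fab ab(1) by (auto split: if_splits)
      moreover have "b' < ?n" using ab(2) p False by (auto simp: b'_def)
      ultimately have "(a', b') \<in> ?I" by simp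
      then show ?thesis using fab by (intro UnI1 image_eqI[of _ _ "(a', b')"]) auto
    qed
  next
    fix a b assume "(a, b) \<in> ?R"
    then show "(a, b) \<in> ?L"
    proof
      assume "(a, b) \<in> (\<lambda>(a, b). (?f a, ?f b)) ` ?I"
      then obtain a' b' where ab: "a = ?f a'" "b = ?f b'" "a' < b'" "b' < ?n" "\<sigma> b' < \<sigma> a'" by auto
      have "?\<sigma> b < ?\<sigma> a" unfolding ab(1,2) f using ab(5) by simp
      moreover have "a < b" "b < length (d # ds)" using ab by auto
      ultimately show ?thesis by simp
    next
      assume "(a, b) \<in> (\<lambda>k. (k, p)) ` {..<p}"
      then show ?thesis using p by (auto simp: insert_zero_def)
    qed
  qed
  have disj: "(\<lambda>(a, b). (?f a, ?f b)) ` ?I \<inter> (\<lambda>k. (k, p)) ` {..<p} = {}"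
    by (auto split: if_splits)
  have inj: "inj_on (\<lambda>(a, b). (?f a, ?f b)) ?I"
    by (auto simp: inj_on_def split: if_splits)
  have fin: "finite ?I"
    by (rule finite_subset[of _ "{..<?n} \<times> {..<?n}"]) auto
  have "koszul_sign (d # ds) ?\<sigma> = (\<Prod>x\<in>?R. ?t x)"
    unfolding koszul_sign_def inv ..
  also have "\<dots> = (\<Prod>x\<in>(\<lambda>(a, b). (?f a, ?f b)) ` ?I. ?t x) * (\<Prod>x\<in>(\<lambda>k. (k, p)) ` {..<p}. ?t x)"
    using fin disj by (intro prod.union_disjoint) auto
  also have "(\<Prod>x\<in>(\<lambda>(a, b). (?f a, ?f b)) ` ?I. ?t x) = koszul_sign ds \<sigma>"
    unfolding koszul_sign_def prod.reindex[OF inj]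
    by (rule prod.cong) (simp_all add: case_prod_unfold f(1) del: if_image_distrib)
  also have "(\<Prod>x\<in>(\<lambda>k. (k, p)) ` {..<p}. ?t x) = (\<Prod>k<p. (-1) powi (ds ! \<sigma> k * d))"
    by (subst prod.reindex) (auto simp: inj_on_def insert_zero_def)
  also have "\<dots> = (-1) powi (\<Sum>k<p. ds ! \<sigma> k * d)" by (rule powi_minus_one_sum)
  also have "(\<Sum>k<p. ds ! \<sigma> k * d) = d * sum_list (take p (permute_list \<sigma> ds))"
  proof -
    have "sum_list (take p (permute_list \<sigma> ds)) = (\<Sum>k<p. ds ! \<sigma> k)"
      using p \<sigma> by (simp add: sum_list_sum_nth atLeast0LessThan permute_list_nth)
    then show ?thesis by (simp add: sum_distrib_left mult.commute)
  qed
  finally show ?thesis by (simp add: mult.commute)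
qed

lemma homog_permute:
  assumes "homog V ds xs" "\<sigma> permutes {..<length xs}"
  shows "homog V (permute_list \<sigma> ds) (permute_list \<sigma> xs)"
proof -
  have len: "length ds = length xs" using assms(1) by (auto simp: homog_def list_all2_lengthD)
  have "\<sigma> i < length xs" if "i < length xs" for i
    using permutes_in_image[OF assms(2), of i] that by simp
  then show ?thesis using assms len
    by (simp add: homog_def list_all2_conv_all_nth permute_list_nth)
qed

lemma homog_take: "homog V ds xs \<Longrightarrow> homog V (take i ds) (take i xs)"
  and homog_drop: "homog V ds xs \<Longrightarrow> homog V (drop i ds) (drop i xs)"
  by (simp_all add: homog_def)

context graded_space
begin

text \<open>Both sides satisfy the same recursion. Sending the first letter left corresponds to
  inserting 0 at position 0, without sign; sending it right corresponds to inserting 0 at position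
  \<open>i\<close>, and the sign of passing the left block is what \<open>tw d\<close>
  contributes.\<close>

lemma unshuffle_shuffles:
  fixes sc :: "'k \<Rightarrow> 'w::ab_group_add \<Rightarrow> 'w"
  assumes "vector_space sc" "multilinear2 sc F" "homog V ds xs"
  shows "unshuffle xs F =
    (\<Sum>i\<le>length xs. \<Sum>\<sigma>\<in>shuffle_perms i (length xs - i).
       sc (koszul_sign ds \<sigma>) (F (take i (permute_list \<sigma> xs)) (drop i (permute_list \<sigma> xs))))"
  using assms(3,2)
proof (induction xs arbitrary: ds F)
  case Nil
  interpret W: vector_space sc by fact
  have "shuffle_perms 0 0 = {id}"
    by (auto simp: shuffle_perms_def strict_mono_on_def)
  moreover have "koszul_sign [] \<sigma> = (1::'k)" for \<sigma> by (simp add: koszul_sign_def)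
  ultimately show ?case using Nil by (simp add: homog_def)
next
  case (Cons x xs)
  interpret W: vector_space sc by fact
  obtain d es where ds: "ds = d # es" and x: "x \<in> V d" and xs: "homog V es xs"
    using Cons.prems(1) by (auto simp: homog_def list_all2_Cons2)
  have len: "length es = length xs" using xs by (auto simp: homog_def list_all2_lengthD)
  have mF: "multilinear sc (F a)" "multilinear sc (\<lambda>a. F a b)" for a b
    using Cons.prems(2) by (simp_all add: multilinear2_def)
  let ?G = "\<lambda>a b. F (x # a) b + F (tw d a) (x # b)"
  have "multilinear sc (\<lambda>a. F (tw d a) (x # b))" for b
    using mF(2) by (cases "even d") (simp_all add: tw_def multilinear_map_th[where t = "\<lambda>a. F a _"])
  then have G: "multilinear2 sc ?G"
    using mF assms(1) unfolding multilinear2_def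
    by (auto intro!: multilinear_fun_add multilinear_Cons[where t = "F _"]
        multilinear_Cons[where t = "\<lambda>a. F a _"])
  let ?k = "\<lambda>i. shuffle_perms i (length xs - i)" and ?y = "\<lambda>\<sigma>. permute_list \<sigma> xs"
  let ?g = "\<lambda>i \<sigma>. sc (koszul_sign ds \<sigma>)
    (F (take i (permute_list \<sigma> (x # xs))) (drop i (permute_list \<sigma> (x # xs))))"
  have "unshuffle (x # xs) F = unshuffle xs ?G"
    by (rule unshuffle_homogeneous_Cons[OF x mF(1)])
  also have "\<dots> = (\<Sum>i\<le>length xs. \<Sum>\<sigma>\<in>?k i. sc (koszul_sign es \<sigma>) (?G (take i (?y \<sigma>)) (drop i (?y \<sigma>))))"
    by (rule Cons.IH[OF xs G])
  also have "\<dots> = (\<Sum>i\<le>length xs. \<Sum>\<sigma>\<in>?k i. ?g (Suc i) (insert_zero 0 \<sigma>) + ?g i (insert_zero i \<sigma>))"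
  proof (intro sum.cong refl)
    fix i \<sigma> assume i: "i \<in> {..length xs}" and "\<sigma> \<in> ?k i"
    then have \<sigma>: "\<sigma> permutes {..<length xs}" using shuffle_perms_permutes by fastforce
    have 1: "?g (Suc i) (insert_zero 0 \<sigma>) = sc (koszul_sign es \<sigma>) (F (x # take i (?y \<sigma>)) (drop i (?y \<sigma>)))"
      using \<sigma> by (simp add: ds koszul_sign_insert_zero len permute_list_insert_zero)
    have "homog V (take i (permute_list \<sigma> es)) (take i (?y \<sigma>))"
      by (intro homog_take homog_permute xs \<sigma>)
    note tw = multilinear_tw_homogeneous[OF assms(1) mF(2) this, of d]
    have 2: "?g i (insert_zero i \<sigma>) = sc (koszul_sign es \<sigma>) (F (tw d (take i (?y \<sigma>))) (x # drop i (?y \<sigma>)))"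
      using \<sigma> i by (simp add: ds koszul_sign_insert_zero len permute_list_insert_zero tw mult.commute)
    show "sc (koszul_sign es \<sigma>) (?G (take i (?y \<sigma>)) (drop i (?y \<sigma>))) =
        ?g (Suc i) (insert_zero 0 \<sigma>) + ?g i (insert_zero i \<sigma>)"
      unfolding 1 2 by (rule W.scale_right_distrib)
  qed
  also have "\<dots> = (\<Sum>i\<le>Suc (length xs). \<Sum>\<sigma>\<in>shuffle_perms i (Suc (length xs) - i). ?g i \<sigma>)"
    by (rule sum_shuffle_perms_Suc[symmetric])
  finally show ?case by simp
qed

end

text \<open>This and the next two rules turn quantification over the relation sets
  \<open>sym_rels\<close> and \<open>tensor_rels\<close> into plain quantifiers, so that
  annihilating them reads as a list of identities.\<close>

lemma ball_setcompr3:
  "(\<forall>r\<in>{f a b c | a b c. P a b c}. Q r) \<longleftrightarrow> (\<forall>a b c. P a b c \<longrightarrow> Q (f a b c))"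
  by blast

lemma ball_setcompr4:
  "(\<forall>r\<in>{f a b c d | a b c d. P a b c d}. Q r) \<longleftrightarrow> (\<forall>a b c d. P a b c d \<longrightarrow> Q (f a b c d))"
  by blast

lemma ball_setcompr6:
  "(\<forall>r\<in>{f a b c d e g | a b c d e g. P a b c d e g}. Q r) \<longleftrightarrow>
     (\<forall>a b c d e g. P a b c d e g \<longrightarrow> Q (f a b c d e g))"
  by blast

type_synonym ('k, 'v) word_coset = "('v list \<Rightarrow>\<^sub>0 'k) set"

context graded_space
begin

section \<open>Coassociativity and cocommutativity of the unshuffle coproduct\<close>

context
  fixes sc :: "'k \<Rightarrow> 'w::ab_group_add \<Rightarrow> 'w"
  assumes vs: "vector_space sc"
begin

interpretation W: vector_space sc by (rule vs)

lemma graded_symmetric2_unshuffle_step: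
  assumes F: "graded_symmetric2 sc F"
  shows "graded_symmetric2 sc (\<lambda>a b. F (x # a) b + F a (ev x # b) + F (map th a) (od x # b))"
proof -
  have F1: "graded_symmetric sc (F a)" and F2: "graded_symmetric sc (\<lambda>a. F a b)" for a b
    using F by (simp_all add: graded_symmetric2_def)
  show ?thesis
    unfolding graded_symmetric2_def
    by (intro allI conjI graded_symmetric_fun_add vs F1 F2 graded_symmetric_Cons[where t = "F _"]
        graded_symmetric_Cons[where t = "\<lambda>a. F a _"] graded_symmetric_map_th[where t = "\<lambda>a. F a _"])
qed

text \<open>Dually, the unshuffle coproduct respects the relations of the symmetric algebra. Letters
  in \<open>us\<close> are absorbed into \<open>F\<close>, whose symmetry survives by
  \<open>graded_symmetric2_unshuffle_step\<close>. For two letters exchanged at the head, the terms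
  with both on one side use the symmetry of \<open>F\<close>; with one on each side the sign comes
  from \<open>th\<close> applied to the letter on the left.\<close>

lemma graded_symmetric_unshuffle:
  assumes "graded_symmetric2 sc F"
  shows "graded_symmetric sc (\<lambda>xs. unshuffle xs F)"
  unfolding graded_symmetric_def multilinear_def
proof (intro conjI allI impI)
  fix us ws x y
  show "unshuffle (us @ (x + y) # ws) F = unshuffle (us @ x # ws) F + unshuffle (us @ y # ws) F"
    using assms
  proof (induction us arbitrary: F)
    case Nil
    then have m: "multilinear sc (F a)" "multilinear sc (\<lambda>a. F a b)" for a b
      by (simp_all add: graded_symmetric2_def graded_symmetricD)
    show ?case
      by (simp add: unshuffle_add[symmetric] part_add multilinear_add_Cons[OF m(1)]
          multilinear_add_Cons[OF m(2)] ac_simps)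
  qed (simp add: graded_symmetric2_unshuffle_step)
next
  fix us ws x c
  show "unshuffle (us @ s c x # ws) F = sc c (unshuffle (us @ x # ws) F)"
    using assms
  proof (induction us arbitrary: F)
    case Nil
    then have m: "multilinear sc (F a)" "multilinear sc (\<lambda>a. F a b)" for a b
      by (simp_all add: graded_symmetric2_def graded_symmetricD)
    show ?case
      by (simp add: unshuffle_linear[of "sc c", OF W.scale_right_distrib] part_scale
          multilinear_scale_Cons[OF m(1)] multilinear_scale_Cons[OF m(2)] W.scale_right_distrib)
  qed (simp add: graded_symmetric2_unshuffle_step)
next
  fix us ws x y p q
  assume xy: "x \<in> V p \<and> y \<in> V q"
  show "unshuffle (us @ x # y # ws) F = sc ((-1) powi (p * q)) (unshuffle (us @ y # x # ws) F)"
    using assms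
  proof (induction us arbitrary: F)
    case Nil
    then have F1: "graded_symmetric sc (F a)" and F2: "graded_symmetric sc (\<lambda>a. F a b)" for a b
      by (simp_all add: graded_symmetric2_def)
    note m = F1[THEN graded_symmetricD] F2[THEN graded_symmetricD]
    have s1: "F a (x # y # b) = sc ((-1) powi (p * q)) (F a (y # x # b))" for a b
      using F1[of a] xy unfolding graded_symmetric_def by (metis append_Nil)
    have s2: "F (x # y # a) b = sc ((-1) powi (p * q)) (F (y # x # a) b)" for a b
      using F2[of b] xy unfolding graded_symmetric_def by (metis append_Nil)
    have x: "x \<in> V p" and y: "y \<in> V q" using xy by simp_all
    note simps = part_homogeneous[OF x] part_homogeneous[OF y] th_homogeneous[OF x]
      th_homogeneous[OF y] multilinear_zero_Cons[OF m(1)] multilinear_zero[OF m(1), of _ "[_]", simplified]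
      multilinear_minus_Cons[OF m(2)] multilinear_zero_Cons[OF m(2)]
    show ?case
      unfolding append_Nil unshuffle.simps
        unshuffle_linear[of "sc ((-1) powi (p * q))", OF W.scale_right_distrib]
      by (rule arg_cong[of _ _ "unshuffle ws"], intro ext)
        (cases "even p"; cases "even q"; simp add: simps s1 s2 powi_minus_one)
  qed (simp add: graded_symmetric2_unshuffle_step)
qed

end

text \<open>For each letter the choices left and right contribute the same value, since
  \<open>graded_symmetric_move_parts\<close> brings it back to the front and absorbs the sign. Thus
  each letter doubles the sum.\<close>

lemma unshuffle_append:
  fixes sc :: "'k \<Rightarrow> 'w::ab_group_add \<Rightarrow> 'w"
  assumes t: "graded_symmetric sc t" and vs: "vector_space sc"
  shows "unshuffle xs (\<lambda>a b. t (a @ b)) = sc (2 ^ length xs) (t xs)"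
  using t
proof (induction xs arbitrary: t)
  case Nil
  interpret W: vector_space sc by fact
  show ?case by simp
next
  case (Cons x xs)
  interpret W: vector_space sc by fact
  have "unshuffle (x # xs) (\<lambda>a b. t (a @ b)) = unshuffle xs (\<lambda>a b. t (x # a @ b) + t (x # a @ b))"
    by (simp add: add.assoc graded_symmetric_move_parts[OF vs Cons.prems])
  also have "\<dots> = sc (2 ^ length xs) (t (x # xs)) + sc (2 ^ length xs) (t (x # xs))"
    using Cons.IH[OF graded_symmetric_Cons[OF Cons.prems]] by (simp add: unshuffle_add)
  also have "\<dots> = sc (2 ^ length (x # xs)) (t (x # xs))"
    by (simp add: W.scale_left_distrib[symmetric])
  finally show ?case .
qed

text \<open>A letter joins one of three factors, with the same sign in either bracketing. Splitting
  the parts of \<open>x\<close> once more also produces the letters \<open>od (ev x)\<close> and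
  \<open>ev (od x)\<close>, which are 0; the hypothesis removes the terms in which they reach the
  third factor.\<close>

lemma unshuffle_coassoc:
  assumes "\<And>a b c. 0 \<in> set c \<Longrightarrow> H a b c = 0"
  shows "unshuffle xs (\<lambda>a b. unshuffle b (H a)) =
    unshuffle xs (\<lambda>a b. unshuffle a (\<lambda>a' a''. H a' a'' b))"
  using assms
proof (induction xs arbitrary: H)
  case (Cons x xs)
  \<comment> \<open>The five summands: \<open>x\<close> in the first factor, then its even and odd
    parts in the second and in the third; an odd part applies the parity involution to the factors
    it passes.\<close>
  define H' where "H' = (\<lambda>a b c. H (x # a) b c + H a (ev x # b) c + H (map th a) (od x # b) c
    + H a b (ev x # c) + H (map th a) (map th b) (od x # c))"
  have z: "H a b (0 # c) = 0" for a b c by (rule Cons.prems) simp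
  have "unshuffle (x # xs) (\<lambda>a b. unshuffle b (H a)) = unshuffle xs (\<lambda>a b. unshuffle b (H' a))"
    by (simp add: unshuffle_add[symmetric] z H'_def ac_simps)
  also have "\<dots> = unshuffle xs (\<lambda>a b. unshuffle a (\<lambda>a' a''. H' a' a'' b))"
    by (rule Cons.IH) (simp add: H'_def Cons.prems)
  also have "\<dots> = unshuffle (x # xs) (\<lambda>a b. unshuffle a (\<lambda>a' a''. H a' a'' b))"
    by (simp add: unshuffle_add[symmetric] unshuffle_map_th H'_def ac_simps)
  finally show ?case .
qed simp

text \<open>The sign \<open>(-1)\<^bsup>|a||b|\<^esup>\<close> of exchanging the two factors is written as
  \<open>(1 + (-1)\<^bsup>|a|\<^esup> + (-1)\<^bsup>|b|\<^esup> - (-1)\<^bsup>|a|+|b|\<^esup>) / 2\<close>.\<close>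

lemma unshuffle_cocomm:
  fixes F :: "'v list \<Rightarrow> 'v list \<Rightarrow> 'k"
  assumes "multilinear2 (*) F"
  shows "unshuffle xs F = unshuffle xs (\<lambda>a b.
    (F b a + F b (map th a) + F (map th b) a - F (map th b) (map th a)) / 2)"
  using assms
proof (induction xs arbitrary: F)
  case (Cons x xs)
  have m: "multilinear (*) (F a)" "multilinear (*) (\<lambda>a. F a b)" for a b
    using Cons.prems by (simp_all add: multilinear2_def)
  note vs = scalar_vs
  let ?F = "\<lambda>a b. F (x # a) b + F a (ev x # b) + F (map th a) (od x # b)"
  have step: "multilinear2 (*) ?F"
    unfolding multilinear2_def
    by (intro allI conjI multilinear_fun_add vs m multilinear_Cons[where t = "F _"]
        multilinear_Cons[where t = "\<lambda>a. F a _"] multilinear_map_th[where t = "\<lambda>a. F a _"])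
  have split: "F (x # a) b = F (ev x # a) b + F (od x # a) b" "F a (x # b) = F a (ev x # b) + F a (od x # b)" for a b
    using multilinear_add_Cons[OF m(1), of a "ev x" "od x" b]
      multilinear_add_Cons[OF m(2), of "ev x" "od x" a b] by (simp_all add: ev_od)
  have tsplit: "F (th x # a) b = F (ev x # a) b - F (od x # a) b" "F a (th x # b) = F a (ev x # b) - F a (od x # b)" for a b
    using multilinear_add_Cons[OF m(1), of a "ev x" "- od x" b] multilinear_minus_Cons[OF m(1), of a "od x" b]
      multilinear_add_Cons[OF m(2), of "ev x" "- od x" a b] multilinear_minus_Cons[OF m(2), of "od x" a b]
    by (simp_all add: th_def)
  have "unshuffle (x # xs) F = unshuffle xs ?F" by simp
  also have "\<dots> = unshuffle xs (\<lambda>a b.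
    (?F b a + ?F b (map th a) + ?F (map th b) a - ?F (map th b) (map th a)) / 2)"
    by (rule Cons.IH[OF step])
  also have "\<dots> = unshuffle (x # xs) (\<lambda>a b.
    (F b a + F b (map th a) + F (map th b) a - F (map th b) (map th a)) / 2)"
    by (simp add: split tsplit part_th multilinear_minus_Cons[OF m(1)] multilinear_minus_Cons[OF m(2)]
        diff_divide_distrib add_divide_distrib algebra_simps)
  finally show ?case .
qed simp

section \<open>The symmetric coalgebra and its square\<close>

lemma annihilates_sym_rels:
  assumes vs: "vector_space sc"
  shows "annihilates sc (sym_rels s V) t \<longleftrightarrow> graded_symmetric sc t"
proof -
  interpret W: vector_space sc by fact
  show ?thesis
    unfolding annihilates_def sym_rels_def graded_symmetric_def multilinear_def ball_Un conj_assoc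
      ball_setcompr4 ball_setcompr6
    by (simp add: W.lext_diff W.lext_add algebra_simps)
qed

sublocale sym: free_quotient "{w :: 'v list. w \<noteq> []}" "sym_rels s V"
proof
  fix r assume "r \<in> sym_rels s V"
  then show "keys r \<subseteq> {w. w \<noteq> []}"
    unfolding sym_rels_def
    by (auto simp: in_keys_iff lookup_minus lookup_single when_def split: if_splits)
qed

lemma sym_ker_eq: "sym_ker s V = sym.K"
  by (simp add: sym_ker_def)

lemma sym_space_eq: "sym_space s V = sym.Q"
  by (auto simp: sym_space_def sym.Q_def sym_ker_eq)

sublocale tens: free_quotient "sym.Q \<times> sym.Q" "tensor_rels sym.Q sym.K"
proof
  fix r assume "r \<in> tensor_rels sym.Q sym.K"
  then show "keys r \<subseteq> sym.Q \<times> sym.Q"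
    unfolding tensor_rels_def
    by (auto simp: in_keys_iff lookup_minus lookup_single when_def split: if_splits)
qed

lemma sym_tensor_ker_eq: "sym_tensor_ker s V = tens.K"
  by (simp add: tensor_ker_def sym_ker_eq sym_space_eq)

lemma sym_tensor_space_eq: "sym_tensor_space s V = tens.Q"
  by (simp add: tensor_space_def tens.Q_def tensor_ker_def sym_ker_eq sym_space_eq)

text \<open>These are the functionals on SV \<otimes> SV; by \<open>biadditive_iff\<close> they are
  the functions bilinear on pairs of classes.\<close>

definition biadditive :: "(('k, 'v) word_coset \<times> ('k, 'v) word_coset \<Rightarrow> 'k) \<Rightarrow> bool" where
  "biadditive \<gamma> \<longleftrightarrow> annihilates (*) (tensor_rels sym.Q sym.K) \<gamma>"

lemma biadditive_iff:
  "biadditive \<gamma> \<longleftrightarrow>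
    (\<forall>A B C. A \<in> sym.Q \<and> B \<in> sym.Q \<and> C \<in> sym.Q \<longrightarrow> \<gamma> (A + B, C) = \<gamma> (A, C) + \<gamma> (B, C)) \<and>
    (\<forall>A B C. A \<in> sym.Q \<and> B \<in> sym.Q \<and> C \<in> sym.Q \<longrightarrow> \<gamma> (A, B + C) = \<gamma> (A, B) + \<gamma> (A, C)) \<and>
    (\<forall>A B c. A \<in> sym.Q \<and> B \<in> sym.Q \<longrightarrow> \<gamma> (coset_scale sym.K c A, B) = c * \<gamma> (A, B)) \<and>
    (\<forall>A B c. A \<in> sym.Q \<and> B \<in> sym.Q \<longrightarrow> \<gamma> (A, coset_scale sym.K c B) = c * \<gamma> (A, B))"
  unfolding biadditive_def annihilates_def tensor_rels_def ball_Un conj_assoc ball_setcompr3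
  by (simp add: scalar.lext_diff scalar.lext_add algebra_simps)


lemma annihilates_iff:
  "annihilates (*) (sym_rels s V) t \<longleftrightarrow> graded_symmetric (*) t"
  by (rule annihilates_sym_rels) (rule scalar_vs)

abbreviation cls :: "'v list \<Rightarrow> ('k, 'v) word_coset" where
  "cls w \<equiv> single w 1 +o sym.K"

lemma sym_mon_eq: "sym_mon s V w = cls w"
  by (simp add: sym_mon_def sym_ker_eq)

lemma graded_symmetric_cls:
  assumes "vector_space sc" "sym.linear_on sc g"
  shows "graded_symmetric sc (\<lambda>a. if a = [] then 0 else g (cls a))"
proof -
  have "(\<lambda>a. if a = [] then 0 else g (cls a)) = (\<lambda>a. if a \<in> {w. w \<noteq> []} then g (cls a) else 0)"
    by auto
  then show ?thesis
    using sym.linear_on_annihilates[OF assms] annihilates_sym_rels[OF assms(1)] by simp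
qed

lemma biadditive_linear_on:
  assumes "biadditive \<gamma>"
  shows "B \<in> sym.Q \<Longrightarrow> sym.linear_on (*) (\<lambda>A. \<gamma> (A, B))"
    and "A \<in> sym.Q \<Longrightarrow> sym.linear_on (*) (\<lambda>B. \<gamma> (A, B))"
  using assms by (simp_all add: biadditive_iff sym.linear_on_def)

definition on_words :: "(('k, 'v) word_coset \<times> ('k, 'v) word_coset \<Rightarrow> 'k) \<Rightarrow> 'v list \<Rightarrow> 'v list \<Rightarrow> 'k"
  where "on_words \<gamma> a b = (if a = [] \<or> b = [] then 0 else \<gamma> (cls a, cls b))"

text \<open>Vanishing on empty words discards the terms w \<otimes> 1 and 1 \<otimes> w of the
  unital unshuffle sum, so \<open>unshuffle w \<beta>\<close> pairs \<beta> with the reduced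
  coproduct. By \<open>reduced_on_words\<close> and \<open>tensor_eval\<close> these functions are
  exactly the functionals on SV \<otimes> SV read on words.\<close>

definition reduced :: "('v list \<Rightarrow> 'v list \<Rightarrow> 'k) \<Rightarrow> bool" where
  "reduced \<beta> \<longleftrightarrow> graded_symmetric2 (*) \<beta> \<and> (\<forall>b. \<beta> [] b = 0) \<and> (\<forall>a. \<beta> a [] = 0)"

lemma reduced_on_words:
  assumes "biadditive \<gamma>"
  shows "reduced (on_words \<gamma>)"
proof -
  note vs = scalar_vs
  have "graded_symmetric (*) (on_words \<gamma> a)" for a
  proof (cases "a = []")
    case False
    then have "sym.linear_on (*) (\<lambda>B. \<gamma> (cls a, B))"
      by (intro biadditive_linear_on(2)[OF assms]) simp
    from graded_symmetric_cls[OF vs this] show ?thesis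
      using False by (simp add: on_words_def[abs_def] cong: if_cong)
  qed (simp add: on_words_def[abs_def] graded_symmetric_zero[OF vs])
  moreover have "graded_symmetric (*) (\<lambda>a. on_words \<gamma> a b)" for b
  proof (cases "b = []")
    case False
    then have "sym.linear_on (*) (\<lambda>A. \<gamma> (A, cls b))"
      by (intro biadditive_linear_on(1)[OF assms]) simp
    from graded_symmetric_cls[OF vs this] show ?thesis
      using False by (simp add: on_words_def[abs_def] cong: if_cong)
  qed (simp add: on_words_def[abs_def] graded_symmetric_zero[OF vs])
  ultimately show ?thesis by (simp add: reduced_def graded_symmetric2_def on_words_def)
qed

definition tensor_eval ::
  "('v list \<Rightarrow> 'v list \<Rightarrow> 'k) \<Rightarrow> ('k, 'v) word_coset \<times> ('k, 'v) word_coset \<Rightarrow> 'k" where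
  "tensor_eval \<beta> = (\<lambda>(A, B). coset_eval (*) (\<lambda>a. coset_eval (*) (\<beta> a) B) A)"

text \<open>One variable can be evaluated at a time: for a fixed second class the inner value is a
  finite linear combination of values \<open>\<beta> a b\<close> at fixed words \<open>b\<close>,
  hence again graded symmetric in \<open>a\<close>.\<close>

lemma tensor_eval:
  assumes "reduced \<beta>"
  shows "biadditive (tensor_eval \<beta>)" and "on_words (tensor_eval \<beta>) = \<beta>"
proof -
  note vs = scalar_vs
  have \<beta>1: "annihilates (*) (sym_rels s V) (\<beta> a)" for a
    using assms by (simp add: reduced_def graded_symmetric2_def annihilates_iff)
  have \<beta>2: "annihilates (*) (sym_rels s V) (\<lambda>a. coset_eval (*) (\<beta> a) B)" for B
    unfolding annihilates_def coset_eval_def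
  proof
    fix r assume r: "r \<in> sym_rels s V"
    have "lext (*) (\<lambda>a. \<beta> a b) r = 0" for b
      using assms r annihilates_iff
      by (auto simp: reduced_def graded_symmetric2_def annihilates_def)
    then show "lext (*) (\<lambda>a. lext (*) (\<beta> a) (SOME f. f \<in> B)) r = 0"
      by (simp add: lext_commute[of \<beta>])
  qed
  show "biadditive (tensor_eval \<beta>)"
    unfolding biadditive_iff tensor_eval_def
    by (auto simp: sym.coset_eval_add[OF vs \<beta>2] sym.coset_eval_scale[OF vs \<beta>2]
        sym.coset_eval_add[OF vs \<beta>1] sym.coset_eval_scale[OF vs \<beta>1]
        sym.coset_eval_fun_add[OF vs] sym.coset_eval_fun_scale[OF vs])
  show "on_words (tensor_eval \<beta>) = \<beta>"
    using assms
    by (auto simp: on_words_def tensor_eval_def fun_eq_iff sym.coset_eval_single[OF vs \<beta>2]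
        sym.coset_eval_single[OF vs \<beta>1] reduced_def)
qed

sublocale cop: free_quotient_pair "{w :: 'v list. w \<noteq> []}" "sym_rels s V"
  "sym.Q \<times> sym.Q" "tensor_rels sym.Q sym.K"
  by unfold_locales

sublocale end': free_quotient_pair "{w :: 'v list. w \<noteq> []}" "sym_rels s V"
  "{w :: 'v list. w \<noteq> []}" "sym_rels s V"
  by unfold_locales

sublocale tend: free_quotient_pair "sym.Q \<times> sym.Q" "tensor_rels sym.Q sym.K"
  "sym.Q \<times> sym.Q" "tensor_rels sym.Q sym.K"
  by unfold_locales

end

lemma permute_list_Nil_iff [simp]: "permute_list \<sigma> xs = [] \<longleftrightarrow> xs = []"
  by (simp flip: length_0_conv)

context graded_space
begin

lemmas coalgebra_eqs = sym_mon_eq sym_space_eq sym_ker_eq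
  sym_tensor_ker_eq[unfolded sym_space_eq sym_ker_eq]
  sym_tensor_space_eq[unfolded sym_space_eq sym_ker_eq]

section \<open>The reduced coproduct of the symmetric coalgebra\<close>

lemma keys_unshuffle:
  "(\<And>a b. keys (F a b) \<subseteq> S) \<Longrightarrow> keys (unshuffle xs F) \<subseteq> S"
  by (induction xs arbitrary: F) (simp_all add: keys_add_subsetI)

definition tensor_word ::
  "'v list \<Rightarrow> 'v list \<Rightarrow> (('k, 'v) word_coset \<times> ('k, 'v) word_coset) \<Rightarrow>\<^sub>0 'k" where
  "tensor_word a b = (if a = [] \<or> b = [] then 0 else single (cls a, cls b) 1)"

definition coproduct where
  "coproduct = cop.lift (\<lambda>w. unshuffle w tensor_word)"

lemma lext_unshuffle_tensor_word:
  "lext (*) \<gamma> (unshuffle w tensor_word) = unshuffle w (on_words \<gamma>)"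
proof -
  have "lext (*) \<gamma> (tensor_word a b) = on_words \<gamma> a b" for a b
    by (simp add: tensor_word_def on_words_def)
  then show ?thesis by (simp add: unshuffle_linear[of "lext (*) \<gamma>", OF scalar.lext_add])
qed

lemma graded_symmetric_unshuffle_reduced:
  "reduced \<beta> \<Longrightarrow> graded_symmetric (*) (\<lambda>w. unshuffle w \<beta>)"
  by (rule graded_symmetric_unshuffle) (simp_all add: reduced_def scalar_vs)

lemma coproduct_annihilates:
  "annihilates (*) (tensor_rels sym.Q sym.K) \<gamma> \<Longrightarrow>
     annihilates (*) (sym_rels s V) (\<lambda>w. lext (*) \<gamma> (unshuffle w tensor_word))"
  using graded_symmetric_unshuffle_reduced[OF reduced_on_words]
  by (simp add: lext_unshuffle_tensor_word annihilates_iff biadditive_def)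

lemma coproduct_coset_hom: "coproduct \<in> coset_hom sym.Q sym.K tens.Q tens.K"
  unfolding coproduct_def
  by (rule cop.lift_coset_hom[OF coproduct_annihilates])
    (assumption, rule keys_unshuffle, simp add: tensor_word_def)

lemma dual_coproduct:
  assumes "biadditive \<gamma>"
  shows "cop.dual (*) coproduct \<gamma> = (\<lambda>w. unshuffle w (on_words \<gamma>))"
proof
  fix w
  show "cop.dual (*) coproduct \<gamma> w = unshuffle w (on_words \<gamma>)"
  proof (cases "w = []")
    case False
    then show ?thesis
      using cop.dual_lift[OF scalar_vs coproduct_annihilates] assms
      by (simp add: coproduct_def biadditive_def lext_unshuffle_tensor_word)
  qed (simp add: cop.dual_def on_words_def)
qed

lemma coproduct_homogeneous:
  assumes xs: "xs \<noteq> []" "homog V ds xs"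
  shows "coproduct (cls xs) =
    (\<Sum>i\<in>{1..<length xs}. \<Sum>\<sigma>\<in>shuffle_perms i (length xs - i).
       let ys = permute_list \<sigma> xs
       in single (cls (take i ys), cls (drop i ys)) (koszul_sign ds \<sigma>)) +o tens.K"
proof -
  have "coproduct (cls xs) = unshuffle xs tensor_word +o tens.K"
    using xs(1) by (simp add: coproduct_def cop.lift_coset[OF coproduct_annihilates])
  also have "\<dots> = (\<Sum>i\<in>{1..<length xs}. \<Sum>\<sigma>\<in>shuffle_perms i (length xs - i).
       let ys = permute_list \<sigma> xs
       in single (cls (take i ys), cls (drop i ys)) (koszul_sign ds \<sigma>)) +o tens.K"
    (is "_ = ?R +o _")
  proof (rule tens.coset_eq_functionals)
    fix \<gamma> :: "('k, 'v) word_coset \<times> ('k, 'v) word_coset \<Rightarrow> 'k"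
    assume "annihilates (*) (tensor_rels sym.Q sym.K) \<gamma>"
    then have "reduced (on_words \<gamma>)" by (simp add: reduced_on_words biadditive_def)
    then have m: "multilinear2 (*) (on_words \<gamma>)"
      by (simp add: reduced_def graded_symmetric2_multilinear2)
    let ?g = "\<lambda>i \<sigma>. koszul_sign ds \<sigma> *
      on_words \<gamma> (take i (permute_list \<sigma> xs)) (drop i (permute_list \<sigma> xs))"
    have "lext (*) \<gamma> (unshuffle xs tensor_word) =
        (\<Sum>i\<le>length xs. \<Sum>\<sigma>\<in>shuffle_perms i (length xs - i). ?g i \<sigma>)"
      by (simp add: lext_unshuffle_tensor_word
          unshuffle_shuffles[OF scalar_vs m xs(2)])
    \<comment> \<open>The terms with \<open>i = 0\<close> and \<open>i = length xs\<close> drop out,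
      because \<open>on_words\<close> is 0 on an empty factor.\<close>
    also have "\<dots> = (\<Sum>i\<in>{1..<length xs}. \<Sum>\<sigma>\<in>shuffle_perms i (length xs - i). ?g i \<sigma>)"
      by (intro sum.mono_neutral_right) (auto simp: on_words_def not_less)
    also have "\<dots> = lext (*) \<gamma> ?R"
      by (auto simp: scalar.lext_sum Let_def on_words_def intro!: sum.cong)
    finally show "lext (*) \<gamma> (unshuffle xs tensor_word) = lext (*) \<gamma> ?R" .
  qed
  finally show ?thesis .
qed

text \<open>The formula on homogeneous words determines the map: the transpose of any candidate is
  multilinear in the word, so \<open>homogeneous_ext\<close> fixes it on all words, and a map of
  quotients is determined by its transpose.\<close>

lemma sym_coproduct_eq: "sym_coproduct s V = coproduct"
  unfolding sym_coproduct_def coalgebra_eqs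
proof (rule the_equality)
  let ?P = "\<lambda>\<Delta>. \<Delta> \<in> coset_hom sym.Q sym.K tens.Q tens.K \<and> (\<forall>ds xs. xs \<noteq> [] \<and> homog V ds xs \<longrightarrow>
    \<Delta> (cls xs) = (\<Sum>i\<in>{1..<length xs}. \<Sum>\<sigma>\<in>shuffle_perms i (length xs - i).
       let ys = permute_list \<sigma> xs
       in single (cls (take i ys), cls (drop i ys)) (koszul_sign ds \<sigma>)) +o tens.K)"
  show "?P coproduct" using coproduct_coset_hom coproduct_homogeneous by blast
  fix \<Delta> assume \<Delta>: "?P \<Delta>"
  show "\<Delta> = coproduct"
  proof (rule cop.coset_hom_eqI)
    show "\<Delta> \<in> coset_hom sym.Q sym.K tens.Q tens.K" using \<Delta> by blast
    fix \<gamma> :: "('k, 'v) word_coset \<times> ('k, 'v) word_coset \<Rightarrow> 'k" and w :: "'v list"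
    assume \<gamma>: "annihilates (*) (tensor_rels sym.Q sym.K) \<gamma>" and w: "w \<in> {w. w \<noteq> []}"
    have m: "multilinear (*) (cop.dual (*) \<phi> \<gamma>)" if "\<phi> \<in> coset_hom sym.Q sym.K tens.Q tens.K" for \<phi>
      using cop.dual_annihilates[OF scalar_vs that \<gamma>]
      by (simp add: annihilates_iff graded_symmetricD)
    show "cop.dual (*) \<Delta> \<gamma> w = cop.dual (*) coproduct \<gamma> w"
    proof (rule homogeneous_ext[OF m m])
      fix ds ys assume ys: "homog V ds ys" "length ys = length w"
      then have ne: "ys \<noteq> []" using w by auto
      have "\<Delta> (cls ys) = coproduct (cls ys)"
        unfolding coproduct_homogeneous[OF ne ys(1)] using \<Delta> ys(1) ne by blast
      then show "cop.dual (*) \<Delta> \<gamma> ys = cop.dual (*) coproduct \<gamma> ys"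
        by (simp add: cop.dual_def)
    qed (use \<Delta> coproduct_coset_hom in blast)+
  qed (rule coproduct_coset_hom)
qed

section \<open>Coderivations in dual form\<close>

abbreviation hom :: "(('k, 'v) word_coset \<Rightarrow> ('k, 'v) word_coset) set" where
  "hom \<equiv> coset_hom sym.Q sym.K sym.Q sym.K"

abbreviation dual where "dual \<equiv> end'.dual"

lemma graded_symmetric_dual:
  "vector_space sc \<Longrightarrow> \<phi> \<in> hom \<Longrightarrow> graded_symmetric sc t \<Longrightarrow> graded_symmetric sc (dual sc \<phi> t)"
  using end'.dual_annihilates[of sc \<phi> t] by (simp add: annihilates_sym_rels)

lemma dual_Nil [simp]: "dual sc \<phi> t [] = 0"
  by (simp add: end'.dual_def)

lemma dual_cong:
  assumes "\<phi> \<in> hom" "\<And>w. w \<noteq> [] \<Longrightarrow> t w = t' w"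
  shows "dual sc \<phi> t = dual sc \<phi> t'"
proof
  fix w show "dual sc \<phi> t w = dual sc \<phi> t' w"
    using assms end'.coset_hom_in_Q[OF assms(1), of "cls w"]
    by (auto simp: end'.dual_def intro!: sym.coset_eval_cong)
qed

text \<open>\<open>twist n\<close> is the map \<open>a \<mapsto> (-1)\<^bsup>n|a|\<^esup> a\<close>.\<close>

definition twist where
  "twist n = end'.lift (\<lambda>w. single (tw n w) 1)"

lemma tw_Nil_iff [simp]: "tw n w = [] \<longleftrightarrow> w = []" "tw n [] = []"
  by (simp_all add: tw_def)

lemma twist_annihilates:
  "annihilates (*) (sym_rels s V) t \<Longrightarrow>
     annihilates (*) (sym_rels s V) (\<lambda>w. lext (*) t (single (tw n w) 1))"
  by (simp add: annihilates_iff graded_symmetric_tw)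

lemma twist_hom: "twist n \<in> hom"
  unfolding twist_def by (rule end'.lift_coset_hom[OF twist_annihilates]) simp_all

lemma twist_cls: "w \<noteq> [] \<Longrightarrow> twist n (cls w) = cls (tw n w)"
  by (simp add: twist_def end'.lift_coset[OF twist_annihilates])

abbreviation homogeneous_words :: "int \<Rightarrow> ('k, 'v) word_coset" where
  "homogeneous_words d \<equiv> {single xs 1 | xs. xs \<noteq> [] \<and> (\<exists>ds. homog V ds xs \<and> sum_list ds = d)}"

lemma sym_degree_cases:
  assumes "A \<in> sym_degree s V d"
  obtains f where "A = f +o sym.K" "keys f \<subseteq> {w. w \<noteq> []}"
    "f \<in> free.span (homogeneous_words d)"
proof -
  obtain f where f: "A = f +o sym.K"
    "f \<in> free.span (homogeneous_words d)"
    using assms by (auto simp: sym_degree_def sym_ker_eq)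
  from f(2) have "keys f \<subseteq> {w. w \<noteq> []}"
  proof (induction rule: free.span_induct)
    case base
    show ?case by (simp add: free.subspace_def keys_add_subsetI keys_pscale_subsetI)
  qed auto
  then show ?thesis using f that by blast
qed

lemma sym_degree_in_Q: "A \<in> sym_degree s V d \<Longrightarrow> A \<in> sym.Q"
  by (erule sym_degree_cases) auto

lemma cls_in_sym_degree:
  "xs \<noteq> [] \<Longrightarrow> homog V ds xs \<Longrightarrow> cls xs \<in> sym_degree s V (sum_list ds)"
  unfolding sym_degree_def sym_ker_eq by (blast intro: free.span_base)

lemma coset_eval_tw_sym_degree:
  assumes "A \<in> sym_degree s V d" "graded_symmetric (*) t"
  shows "coset_eval (*) (\<lambda>w. t (tw n w)) A = (-1) powi (n * d) * coset_eval (*) t A"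
proof -
  note vs = scalar_vs
  obtain f where f: "A = f +o sym.K" "keys f \<subseteq> {w. w \<noteq> []}"
    "f \<in> free.span (homogeneous_words d)"
    using sym_degree_cases[OF assms(1)] .
  from f(3) have "lext (*) (\<lambda>w. t (tw n w)) f = (-1) powi (n * d) * lext (*) t f"
  proof (induction rule: free.span_induct)
    case base
    show ?case
      by (intro free.subspaceI) (simp_all add: scalar.lext_add scalar.lext_pscale distrib_left mult.left_commute)
  next
    case (step r)
    then obtain ds xs where "r = single xs 1" "homog V ds xs" "sum_list ds = d" by blast
    then show ?case
      using multilinear_tw_homogeneous[OF vs graded_symmetricD[OF assms(2)], of ds xs n] by simp
  qed
  then show ?thesis using assms(2)
    by (simp add: f(1) sym.coset_eval_coset[OF vs] annihilates_iff graded_symmetric_tw)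
qed

lemma twist_sym_degree:
  assumes "A \<in> sym_degree s V d"
  shows "twist n A = coset_scale sym.K ((-1) powi (n * d)) A"
proof (rule sym.Q_eqI)
  note vs = scalar_vs
  note A = sym_degree_in_Q[OF assms]
  show "twist n A \<in> sym.Q" by (rule end'.coset_hom_in_Q[OF twist_hom A])
  show "coset_scale sym.K ((-1) powi (n * d)) A \<in> sym.Q" using A by simp
  fix t :: "'v list \<Rightarrow> 'k" assume t: "annihilates (*) (sym_rels s V) t"
  have "coset_eval (*) t (twist n A) = coset_eval (*) (dual (*) (twist n) t) A"
    by (rule end'.coset_eval_dual[OF vs twist_hom t A])
  also have "\<dots> = coset_eval (*) (\<lambda>w. t (tw n w)) A"
    by (rule sym.coset_eval_cong[OF A])
      (simp add: end'.dual_def twist_cls sym.coset_eval_single[OF vs t])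
  also have "\<dots> = coset_eval (*) t (coset_scale sym.K ((-1) powi (n * d)) A)"
    using t by (simp add: coset_eval_tw_sym_degree[OF assms] annihilates_iff
        sym.coset_eval_scale[OF vs t A])
  finally show "coset_eval (*) t (twist n A) =
    coset_eval (*) t (coset_scale sym.K ((-1) powi (n * d)) A)" .
qed

section \<open>The operator D \<otimes> 1 + 1 \<otimes> D on the tensor square\<close>

abbreviation "tensor_hom \<equiv> coset_hom tens.Q tens.K tens.Q tens.K"

text \<open>The sign (-1)^(n|A|) is carried by \<open>twist n A\<close>, so the operator is given on
  all pairs of classes and not only for homogeneous \<open>A\<close>.\<close>

definition tensor_map where
  "tensor_map n \<phi> = tend.lift (\<lambda>(A, B).
     single (\<phi> A, B) 1 + single (twist n A, \<phi> B) 1)"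

context
  fixes \<phi> assumes \<phi>: "\<phi> \<in> hom"
begin

lemma biadditive_tensor_map:
  assumes "biadditive \<gamma>"
  shows "biadditive (\<lambda>(A, B). \<gamma> (\<phi> A, B) + \<gamma> (twist n A, \<phi> B))"
  using assms \<phi> twist_hom[of n] unfolding biadditive_iff
  by (auto simp: coset_hom_def PiE_iff algebra_simps)

lemma tensor_map_annihilates:
  "annihilates (*) (tensor_rels sym.Q sym.K) \<gamma> \<Longrightarrow> annihilates (*) (tensor_rels sym.Q sym.K)
     (\<lambda>x. lext (*) \<gamma> (case x of (A, B) \<Rightarrow>
       single (\<phi> A, B) 1 + single (twist n A, \<phi> B) 1))"
  using biadditive_tensor_map[of \<gamma> n]
  by (simp add: biadditive_def scalar.lext_add case_prod_unfold)

lemma tensor_map_coset_hom: "tensor_map n \<phi> \<in> tensor_hom"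
  unfolding tensor_map_def
proof (rule tend.lift_coset_hom[OF tensor_map_annihilates])
  fix x assume "x \<in> sym.Q \<times> sym.Q"
  then obtain A B where "x = (A, B)" "A \<in> sym.Q" "B \<in> sym.Q" by blast
  then show "keys (case x of (A, B) \<Rightarrow>
      single (\<phi> A, B) 1 + single (twist n A, \<phi> B) 1) \<subseteq> sym.Q \<times> sym.Q"
    using end'.coset_hom_in_Q[OF \<phi>] end'.coset_hom_in_Q[OF twist_hom]
    by (simp add: keys_add_subsetI)
qed

lemma dual_tensor_map:
  assumes "biadditive \<gamma>" "A \<in> sym.Q" "B \<in> sym.Q"
  shows "tend.dual (*) (tensor_map n \<phi>) \<gamma> (A, B) = \<gamma> (\<phi> A, B) + \<gamma> (twist n A, \<phi> B)"
  using assms tend.dual_lift[OF scalar_vs tensor_map_annihilates, of \<gamma> "(A, B)" n]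
  by (simp add: tensor_map_def biadditive_def scalar.lext_add)

lemma tensor_map_homogeneous:
  assumes A: "A \<in> sym_degree s V a" and B: "B \<in> sym.Q"
  shows "tensor_map n \<phi> (single (A, B) 1 +o tens.K) =
    (single (\<phi> A, B) 1 + single (A, \<phi> B) ((-1) powi (n * a))) +o tens.K"
proof -
  note AQ = sym_degree_in_Q[OF A]
  have "tensor_map n \<phi> (single (A, B) 1 +o tens.K) =
      (single (\<phi> A, B) 1 + single (twist n A, \<phi> B) 1) +o tens.K"
    using AQ B by (simp add: tensor_map_def tend.lift_coset[OF tensor_map_annihilates])
  also have "\<dots> = (single (\<phi> A, B) 1 + single (A, \<phi> B) ((-1) powi (n * a))) +o tens.K"
  proof (rule tens.coset_eq_functionals)
    fix \<gamma> :: "('k, 'v) word_coset \<times> ('k, 'v) word_coset \<Rightarrow> 'k"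
    assume "annihilates (*) (tensor_rels sym.Q sym.K) \<gamma>"
    then have "biadditive \<gamma>" by (simp add: biadditive_def)
    then have "\<gamma> (coset_scale sym.K c A, \<phi> B) = c * \<gamma> (A, \<phi> B)" for c
      using AQ end'.coset_hom_in_Q[OF \<phi> B] by (simp add: biadditive_iff)
    then show "lext (*) \<gamma> (single (\<phi> A, B) 1 + single (twist n A, \<phi> B) 1) =
        lext (*) \<gamma> (single (\<phi> A, B) 1 + single (A, \<phi> B) ((-1) powi (n * a)))"
      by (simp add: scalar.lext_add twist_sym_degree[OF A])
  qed
  finally show ?thesis .
qed

text \<open>The defining description constrains only pairs whose first entry is homogeneous. With
  the second entry fixed, the transpose is linear in the first, hence determined by words and then
  by homogeneous words.\<close>

lemma tensor_coder_eq: "tensor_coder s V n \<phi> = tensor_map n \<phi>"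
  unfolding tensor_coder_def coalgebra_eqs
proof (rule the_equality)
  let ?P = "\<lambda>T. T \<in> tensor_hom \<and>
    (\<forall>a. \<forall>A\<in>sym_degree s V a. \<forall>B\<in>sym.Q. T (single (A, B) 1 +o tens.K) =
      (single (\<phi> A, B) 1 + single (A, \<phi> B) ((-1) powi (n * a))) +o tens.K)"
  show "?P (tensor_map n \<phi>)" using tensor_map_coset_hom tensor_map_homogeneous by blast
  fix T assume T: "?P T"
  show "T = tensor_map n \<phi>"
  proof (rule tend.coset_hom_eqI)
    show T1: "T \<in> tensor_hom" using T by blast
    note vs = scalar_vs
    fix \<gamma> :: "('k, 'v) word_coset \<times> ('k, 'v) word_coset \<Rightarrow> 'k" and x
    assume \<gamma>: "annihilates (*) (tensor_rels sym.Q sym.K) \<gamma>" and "x \<in> sym.Q \<times> sym.Q"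
    then obtain A B where x: "x = (A, B)" "A \<in> sym.Q" "B \<in> sym.Q" by blast
    have bi: "biadditive (tend.dual (*) T' \<gamma>)" if "T' \<in> tensor_hom" for T'
      using tend.dual_annihilates[OF vs that \<gamma>] by (simp add: biadditive_def)
    let ?d = "\<lambda>T A. tend.dual (*) T \<gamma> (A, B)"
    have lin: "sym.linear_on (*) (?d T')" if "T' \<in> tensor_hom" for T'
      by (rule biadditive_linear_on(1)[OF bi[OF that] x(3)])
    have eq: "?d T (cls w) = ?d (tensor_map n \<phi>) (cls w)" if w: "w \<noteq> []" for w
    proof -
      let ?h = "\<lambda>T w. if w = [] then 0 else ?d T (cls w)"
      have "?h T w = ?h (tensor_map n \<phi>) w"
      proof (rule homogeneous_ext[of "(*)"])
        show "multilinear (*) (?h T)" "multilinear (*) (?h (tensor_map n \<phi>))"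
          using graded_symmetric_cls[OF vs lin] T1 tensor_map_coset_hom
          by (simp_all add: graded_symmetricD)
        fix ds ys assume ys: "homog V ds ys" "length ys = length w"
        then have ne: "ys \<noteq> []" using w by auto
        from cls_in_sym_degree[OF ne ys(1)]
        have "T (single (cls ys, B) 1 +o tens.K) =
            tensor_map n \<phi> (single (cls ys, B) 1 +o tens.K)"
          using T tensor_map_homogeneous x(3) by simp
        then show "?h T ys = ?h (tensor_map n \<phi>) ys" by (simp add: tend.dual_def)
      qed
      then show ?thesis using w by simp
    qed
    have "?d T A = ?d (tensor_map n \<phi>) A"
      unfolding sym.linear_on_eval[OF vs lin[OF T1] x(2)]
        sym.linear_on_eval[OF vs lin[OF tensor_map_coset_hom] x(2)]
      by (rule sym.coset_eval_cong[OF x(2)]) (use eq in simp)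
    then show "tend.dual (*) T \<gamma> x = tend.dual (*) (tensor_map n \<phi>) \<gamma> x" by (simp add: x(1))
  qed (rule tensor_map_coset_hom)
qed

end

text \<open>The transpose of \<open>tensor_map n \<phi>\<close> on functions of two words: when
  \<phi> acts in the second variable, \<open>tw n\<close> on the first supplies the sign of passing
  it.\<close>

definition tensor_dual where
  "tensor_dual n \<phi> \<beta> a b = dual (*) \<phi> (\<lambda>a. \<beta> a b) a + dual (*) \<phi> (\<beta> (tw n a)) b"

text \<open>The transpose of the identity \<Delta> D = (D \<otimes> 1 + 1 \<otimes> D) \<Delta>,
  stated without the tensor quotient.\<close>

definition coderivation where
  "coderivation n \<phi> \<longleftrightarrow> (\<forall>\<beta> w. reduced \<beta> \<longrightarrow>
     dual (*) \<phi> (\<lambda>w. unshuffle w \<beta>) w = unshuffle w (tensor_dual n \<phi> \<beta>))"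

lemma dual_zero: "dual (*) \<phi> (\<lambda>w. 0) = (\<lambda>w. 0)"
  by (rule end'.dual_fun_zero) (rule scalar_vs)

lemma tensor_dual_Nil:
  assumes "reduced \<beta>"
  shows "tensor_dual n \<phi> \<beta> [] b = 0" "tensor_dual n \<phi> \<beta> a [] = 0"
proof -
  have "\<beta> [] = (\<lambda>b. 0)" "(\<lambda>a. \<beta> a []) = (\<lambda>a. 0)"
    using assms by (auto simp: reduced_def)
  then show "tensor_dual n \<phi> \<beta> [] b = 0" "tensor_dual n \<phi> \<beta> a [] = 0"
    by (simp_all add: tensor_dual_def dual_zero)
qed

lemma on_words_tensor_map:
  assumes \<phi>: "\<phi> \<in> hom" and \<gamma>: "biadditive \<gamma>"
  shows "on_words (tend.dual (*) (tensor_map n \<phi>) \<gamma>) = tensor_dual n \<phi> (on_words \<gamma>)"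
proof (intro ext)
  fix a b
  note vs = scalar_vs
  show "on_words (tend.dual (*) (tensor_map n \<phi>) \<gamma>) a b = tensor_dual n \<phi> (on_words \<gamma>) a b"
  proof (cases "a = [] \<or> b = []")
    case True
    then show ?thesis using tensor_dual_Nil[OF reduced_on_words[OF \<gamma>]] by (auto simp: on_words_def)
  next
    case False
    then have Q: "cls a \<in> sym.Q" "cls b \<in> sym.Q" "cls (tw n a) \<in> sym.Q"
      "\<phi> (cls a) \<in> sym.Q" "\<phi> (cls b) \<in> sym.Q"
      by (auto intro!: end'.coset_hom_in_Q[OF \<phi>])
    have "\<gamma> (\<phi> (cls a), cls b) = coset_eval (*) (\<lambda>a. on_words \<gamma> a b) (\<phi> (cls a))"
      unfolding sym.linear_on_eval[OF vs biadditive_linear_on(1)[OF \<gamma> Q(2)] Q(4)]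
      by (rule sym.coset_eval_cong[OF Q(4)]) (use False in \<open>simp add: on_words_def\<close>)
    moreover have "\<gamma> (cls (tw n a), \<phi> (cls b)) = coset_eval (*) (on_words \<gamma> (tw n a)) (\<phi> (cls b))"
      unfolding sym.linear_on_eval[OF vs biadditive_linear_on(2)[OF \<gamma> Q(3)] Q(5)]
      by (rule sym.coset_eval_cong[OF Q(5)]) (use False in \<open>simp add: on_words_def\<close>)
    ultimately show ?thesis
      using False Q by (simp add: on_words_def[of "tend.dual _ _ _"] dual_tensor_map[OF \<phi> \<gamma>]
          twist_cls tensor_dual_def end'.dual_def)
  qed
qed

text \<open>Graded symmetry in the variable that \<phi> does not act on is inherited from a
  functional: \<beta> is lifted to SV \<otimes> SV, pulled back along \<open>tensor_map\<close>, and
  read on words again.\<close>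

lemma reduced_tensor_dual:
  assumes "\<phi> \<in> hom" "reduced \<beta>"
  shows "reduced (tensor_dual n \<phi> \<beta>)"
proof -
  note \<gamma> = tensor_eval[OF assms(2)]
  have "biadditive (tend.dual (*) (tensor_map n \<phi>) (tensor_eval \<beta>))"
    using tend.dual_annihilates[OF scalar_vs tensor_map_coset_hom[OF assms(1)]] \<gamma>(1)
    by (simp add: biadditive_def)
  from reduced_on_words[OF this] show ?thesis
    by (simp add: on_words_tensor_map[OF assms(1) \<gamma>(1)] \<gamma>(2))
qed

text \<open>Both sides of the coproduct identity are tested on functionals, pulled back to SV
  through the two maps of each composite (\<open>left\<close> and \<open>right\<close>). By
  \<open>tensor_eval\<close> every reduced function occurs, so nothing is lost.\<close>

lemma coderivation_iff:
  assumes \<phi>: "\<phi> \<in> hom"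
  shows "(\<forall>A\<in>sym.Q. sym_coproduct s V (\<phi> A) = tensor_coder s V n \<phi> (sym_coproduct s V A)) \<longleftrightarrow>
    coderivation n \<phi>" (is "?L \<longleftrightarrow> _")
proof -
  note vs = scalar_vs
  have \<phi>Q: "\<phi> A \<in> sym.Q" if "A \<in> sym.Q" for A by (rule end'.coset_hom_in_Q[OF \<phi> that])
  have left: "coset_eval (*) \<gamma> (coproduct (\<phi> A)) =
      coset_eval (*) (dual (*) \<phi> (\<lambda>w. unshuffle w (on_words \<gamma>))) A"
    if \<gamma>: "biadditive \<gamma>" and A: "A \<in> sym.Q" for \<gamma> A
  proof -
    note g = \<gamma>[unfolded biadditive_def]
    have "coset_eval (*) \<gamma> (coproduct (\<phi> A)) = coset_eval (*) (cop.dual (*) coproduct \<gamma>) (\<phi> A)"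
      by (rule cop.coset_eval_dual[OF vs coproduct_coset_hom g \<phi>Q[OF A]])
    also have "\<dots> = coset_eval (*) (dual (*) \<phi> (cop.dual (*) coproduct \<gamma>)) A"
      by (rule end'.coset_eval_dual[OF vs \<phi> cop.dual_annihilates[OF vs coproduct_coset_hom g] A])
    finally show ?thesis by (simp add: dual_coproduct[OF \<gamma>])
  qed
  have right: "coset_eval (*) \<gamma> (tensor_map n \<phi> (coproduct A)) =
      coset_eval (*) (\<lambda>w. unshuffle w (tensor_dual n \<phi> (on_words \<gamma>))) A"
    if \<gamma>: "biadditive \<gamma>" and A: "A \<in> sym.Q" for \<gamma> A
  proof -
    note g = \<gamma>[unfolded biadditive_def] and T = tensor_map_coset_hom[OF \<phi>]
    note g' = tend.dual_annihilates[OF vs T[of n] g]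
    have "coset_eval (*) \<gamma> (tensor_map n \<phi> (coproduct A)) =
        coset_eval (*) (tend.dual (*) (tensor_map n \<phi>) \<gamma>) (coproduct A)"
      by (rule tend.coset_eval_dual[OF vs T g cop.coset_hom_in_Q[OF coproduct_coset_hom A]])
    also have "\<dots> = coset_eval (*) (cop.dual (*) coproduct (tend.dual (*) (tensor_map n \<phi>) \<gamma>)) A"
      by (rule cop.coset_eval_dual[OF vs coproduct_coset_hom g' A])
    finally show ?thesis
      using g' by (simp add: dual_coproduct biadditive_def on_words_tensor_map[OF \<phi> \<gamma>])
  qed
  show ?thesis
    unfolding sym_coproduct_eq tensor_coder_eq[OF \<phi>]
  proof
    assume L: "\<forall>A\<in>sym.Q. coproduct (\<phi> A) = tensor_map n \<phi> (coproduct A)"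
    show "coderivation n \<phi>"
      unfolding coderivation_def
    proof (intro allI impI)
      fix \<beta> w assume \<beta>: "reduced \<beta>"
      note \<gamma> = tensor_eval[OF \<beta>]
      show "dual (*) \<phi> (\<lambda>w. unshuffle w \<beta>) w = unshuffle w (tensor_dual n \<phi> \<beta>)"
      proof (cases "w = []")
        case True
        then show ?thesis by (simp add: tensor_dual_Nil[OF \<beta>])
      next
        case False
        then have w: "cls w \<in> sym.Q" by simp
        have "graded_symmetric (*) (dual (*) \<phi> (\<lambda>w. unshuffle w \<beta>))"
          by (intro graded_symmetric_dual vs \<phi> graded_symmetric_unshuffle_reduced \<beta>)
        then have 1: "coset_eval (*) (dual (*) \<phi> (\<lambda>w. unshuffle w \<beta>)) (cls w) =
            dual (*) \<phi> (\<lambda>w. unshuffle w \<beta>) w"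
          by (simp add: sym.coset_eval_single[OF vs] annihilates_iff)
        from graded_symmetric_unshuffle_reduced[OF reduced_tensor_dual[OF \<phi> \<beta>]]
        have 2: "coset_eval (*) (\<lambda>w. unshuffle w (tensor_dual n \<phi> \<beta>)) (cls w) =
            unshuffle w (tensor_dual n \<phi> \<beta>)"
          by (simp add: sym.coset_eval_single[OF vs] annihilates_iff)
        show ?thesis
          using left[OF \<gamma>(1) w] right[OF \<gamma>(1) w] L[rule_format, OF w] 1 2 \<gamma>(2) by simp
      qed
    qed
  next
    assume R: "coderivation n \<phi>"
    show "\<forall>A\<in>sym.Q. coproduct (\<phi> A) = tensor_map n \<phi> (coproduct A)"
    proof
      fix A assume A: "A \<in> sym.Q"
      show "coproduct (\<phi> A) = tensor_map n \<phi> (coproduct A)"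
      proof (rule tens.Q_eqI)
        show "coproduct (\<phi> A) \<in> tens.Q" "tensor_map n \<phi> (coproduct A) \<in> tens.Q"
          by (intro cop.coset_hom_in_Q[OF coproduct_coset_hom] tend.coset_hom_in_Q[OF tensor_map_coset_hom[OF \<phi>]] \<phi>Q A)+
        fix \<gamma> :: "('k, 'v) word_coset \<times> ('k, 'v) word_coset \<Rightarrow> 'k"
        assume "annihilates (*) (tensor_rels sym.Q sym.K) \<gamma>"
        then have \<gamma>: "biadditive \<gamma>" by (simp add: biadditive_def)
        have "dual (*) \<phi> (\<lambda>w. unshuffle w (on_words \<gamma>)) =
            (\<lambda>w. unshuffle w (tensor_dual n \<phi> (on_words \<gamma>)))"
          using R reduced_on_words[OF \<gamma>] by (auto simp: coderivation_def)
        then show "coset_eval (*) \<gamma> (coproduct (\<phi> A)) = coset_eval (*) \<gamma> (tensor_map n \<phi> (coproduct A))"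
          by (simp add: left[OF \<gamma> A] right[OF \<gamma> A])
      qed
    qed
  qed
qed


section \<open>Coderivations are determined by their corestriction\<close>

text \<open>The projection of SV onto V as a vector-valued function of words;
  \<open>dual s D letter\<close> is then the corestriction of \<open>D\<close>.\<close>

definition letter :: "'v list \<Rightarrow> 'v" where
  "letter w = (case w of [x] \<Rightarrow> x | _ \<Rightarrow> 0)"

lemma letter_simps [simp]: "letter [] = 0" "letter [x] = x" "letter (x # y # w) = 0"
  by (simp_all add: letter_def)

lemma letter_append: "letter (us @ x # ws) = (if us = [] \<and> ws = [] then x else 0)"
  by (cases us; cases ws; cases "tl us") (auto simp: letter_def split: list.splits)

lemma graded_symmetric_letter: "graded_symmetric s letter"
  unfolding graded_symmetric_def multilinear_def by (auto simp: letter_append)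

lemma linear_Cons:
  assumes "vector_space sc" "multilinear sc t"
  shows "Vector_Spaces.linear s sc (\<lambda>x. t (x # w))"
proof -
  interpret W: vector_space sc by fact
  show ?thesis
    by unfold_locales (simp_all add: scale_right_distrib scale_left_distrib W.scale_right_distrib
        W.scale_left_distrib multilinear_add_Cons[OF assms(2)] multilinear_scale_Cons[OF assms(2)])
qed

lemma dual_comp:
  assumes "Vector_Spaces.linear sc sc' g"
  shows "dual sc' \<phi> (\<lambda>w. g (t w)) w = g (dual sc \<phi> t w)"
proof -
  interpret g: Vector_Spaces.linear sc sc' g by fact
  show ?thesis by (simp add: end'.dual_def coset_eval_def linear_comp_lext[OF assms] g.zero)
qed

lemma graded_symmetric_prepend: "graded_symmetric sc t \<Longrightarrow> graded_symmetric sc (\<lambda>b. t (a @ b))"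
proof (induction a arbitrary: t)
  case (Cons x a)
  from Cons.IH[OF graded_symmetric_Cons[OF Cons.prems]] show ?case by simp
qed simp

lemma graded_symmetric_nonempty:
  "graded_symmetric sc t \<Longrightarrow> vector_space sc \<Longrightarrow> graded_symmetric sc (\<lambda>a. if a = [] then 0 else t a)"
  by (simp add: graded_symmetric_def multilinear_def)

text \<open>Only terms with all letters on the right survive. The letters arrive there split into
  even and odd parts, which multilinearity recombines.\<close>

lemma unshuffle_Nil_left:
  assumes "multilinear sc g"
  shows "unshuffle xs (\<lambda>a b. if a = [] then g b else 0) = g xs"
  using assms
proof (induction xs arbitrary: g)
  case (Cons x xs)
  have "g (x # b) = g (ev x # b) + g (od x # b)" for b
    using multilinear_add_Cons[OF Cons.prems, of "ev x" "od x" b] by (simp add: ev_od)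
  then have "unshuffle (x # xs) (\<lambda>a b. if a = [] then g b else 0) =
      unshuffle xs (\<lambda>a b. if a = [] then g (x # b) else 0)"
    by (auto intro!: unshuffle_cong)
  also have "\<dots> = g (x # xs)" by (rule Cons.IH[OF multilinear_Cons[OF Cons.prems]])
  finally show ?case .
qed simp

text \<open>Multiplication \<open>a \<otimes> b \<mapsto> a \<odot> b\<close> composed with the reduced coproduct is \<open>2\<^sup>n - 2\<close> on
  words of length \<open>n\<close>.  So every functional that vanishes on letters factors through the
  coproduct, and a coderivation is determined on words of length \<open>n\<close> by its corestriction and
  by its values on shorter words.\<close>

lemma coderivation_unique:
  assumes \<phi>: "\<phi> \<in> hom" "coderivation n \<phi>" and \<psi>: "\<psi> \<in> hom" "coderivation n \<psi>"
    and eq: "dual s \<phi> letter = dual s \<psi> letter"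
  shows "\<phi> = \<psi>"
proof -
  note vs = scalar_vs
  have main: "dual (*) \<phi> t w = dual (*) \<psi> t w" if "graded_symmetric (*) t" for t w
    using that
  proof (induction w arbitrary: t rule: length_induct)
    case (1 w)
    note t = "1.prems"
    \<comment> \<open>Dividing by 2^n - 2 makes the functional factor through the coproduct. This
      number is 0 for n = 1, so letters are treated apart, and the value at the empty word is set to
      0.\<close>
    define t' where "t' w = (if length w \<le> 1 then 0 else t w / (2 ^ length w - 2))" for w
    define \<beta> where "\<beta> a b = (if a = [] \<or> b = [] then 0 else t' (a @ b))" for a b
    have t': "graded_symmetric (*) t'"
      using t unfolding graded_symmetric_def multilinear_def t'_def
      by (simp add: add_divide_distrib)
    have "graded_symmetric (*) (\<beta> a)" for a
      using graded_symmetric_nonempty[OF graded_symmetric_prepend[OF t'] vs, of a] graded_symmetric_zero[OF vs]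
      by (cases "a = []") (simp_all add: \<beta>_def[abs_def])
    moreover have "graded_symmetric (*) (\<lambda>a. \<beta> a b)" for b
      using graded_symmetric_nonempty[OF graded_symmetric_append[OF t'] vs, of b]
        graded_symmetric_zero[OF vs]
      by (cases "b = []") (simp_all add: \<beta>_def[abs_def])
    ultimately have \<beta>: "reduced \<beta>"
      by (simp add: reduced_def graded_symmetric2_def \<beta>_def)
    \<comment> \<open>On a single letter the first summand is 0; on a longer word
      \<open>letter w\<close> is 0, and so is the second summand.\<close>
    have split: "t w = unshuffle w \<beta> + t [letter w]" if w: "w \<noteq> []" for w
    proof -
      \<comment> \<open>Restores the terms with an empty factor, which turns the reduced sum into
        the full one; for two empty words both sides are 0 because \<open>t' [] = 0\<close>.\<close>
      have "\<beta> a b + ((if b = [] then t' a else 0) + (if a = [] then t' b else 0)) = t' (a @ b)" for a b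
        by (simp add: \<beta>_def t'_def)
      then have "unshuffle w \<beta> + (t' w + t' w) = unshuffle w (\<lambda>a b. t' (a @ b))"
        unfolding unshuffle_Nil_right[of w t', symmetric]
        by (subst (2) unshuffle_Nil_right,
            subst unshuffle_Nil_left[OF graded_symmetricD[OF t'], of w, symmetric])
          (simp add: unshuffle_add[symmetric])
      also have "\<dots> = 2 ^ length w * t' w" by (rule unshuffle_append[OF t' vs])
      finally have u: "unshuffle w \<beta> = (2 ^ length w - 2) * t' w" by (simp add: algebra_simps)
      show ?thesis
      proof (cases "length w = 1")
        case True
        then show ?thesis using u by (auto simp: t'_def length_Suc_conv)
      next
        case False
        then obtain x y v where v: "w = x # y # v" using w by (cases w; cases "tl w") auto
        have "(2 :: 'k) ^ length w - 2 \<noteq> 0"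
        proof -
          have "(2 :: nat) ^ length w \<noteq> 2" unfolding v by simp
          then have "(of_nat (2 ^ length w) :: 'k) \<noteq> of_nat 2" by (simp only: of_nat_eq_iff not_False_eq_True)
          then show ?thesis by simp
        qed
        then show ?thesis using u v multilinear_zero_Cons[OF graded_symmetricD[OF t]]
          by (simp add: t'_def)
      qed
    qed
    have dual_split: "dual (*) \<chi> t w = unshuffle w (tensor_dual n \<chi> \<beta>) + t [dual s \<chi> letter w]"
      if \<chi>: "\<chi> \<in> hom" "coderivation n \<chi>" for \<chi>
    proof -
      have "dual (*) \<chi> t = dual (*) \<chi> (\<lambda>w. unshuffle w \<beta> + t [letter w])"
        by (rule dual_cong[OF \<chi>(1)]) (rule split)
      also have "\<dots> = (\<lambda>w. dual (*) \<chi> (\<lambda>w. unshuffle w \<beta>) w + dual (*) \<chi> (\<lambda>w. t [letter w]) w)"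
        by (rule end'.dual_fun_add[OF vs])
      finally show ?thesis
        using \<chi>(2) \<beta> dual_comp[OF linear_Cons[OF vs graded_symmetricD[OF t], of "[]"]]
        by (simp add: coderivation_def)
    qed
    \<comment> \<open>Only splittings into two nonempty words count; both are shorter than
      \<open>w\<close>, so the induction hypothesis applies in each variable.\<close>
    have "unshuffle w (tensor_dual n \<phi> \<beta>) = unshuffle w (tensor_dual n \<psi> \<beta>)"
    proof (rule unshuffle_cong)
      fix a b :: "'v list" assume len: "length a + length b = length w"
      show "tensor_dual n \<phi> \<beta> a b = tensor_dual n \<psi> \<beta> a b"
      proof (cases "a = [] \<or> b = []")
        case False
        then have "0 < length a" "0 < length b" by simp_all
        then have "length a < length w" "length b < length w" using len by linarith+
        then show ?thesis
          using "1.IH" \<beta> by (simp add: tensor_dual_def reduced_def graded_symmetric2_def)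
      qed (auto simp: tensor_dual_Nil[OF \<beta>])
    qed
    then show ?case using dual_split[OF \<phi>] dual_split[OF \<psi>] eq by simp
  qed
  show ?thesis
    by (rule end'.coset_hom_eqI[OF \<phi>(1) \<psi>(1)]) (simp add: main annihilates_iff)
qed

section \<open>The coderivation with a given corestriction\<close>

text \<open>A degree 1 map from SV to V as a function of words; the empty word, which does not
  belong to SV, gets the value 0.\<close>

definition corestriction :: "('v list \<Rightarrow> 'v) \<Rightarrow> bool" where
  "corestriction d \<longleftrightarrow> graded_symmetric s d \<and> d [] = 0 \<and>
     (\<forall>ds xs. homog V ds xs \<longrightarrow> d xs \<in> V (sum_list ds + 1))"

text \<open>The summand with \<open>a\<close> empty is the word \<open>0 # b\<close>, which is
  nonzero in the free space but represents 0 in SV once \<open>d [] = 0\<close>.\<close>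

definition coder_of where
  "coder_of d = end'.lift (\<lambda>w. unshuffle w (\<lambda>a b. single (d a # b) 1))"

lemma unshuffle_mem:
  assumes "homog V ds xs"
    and "\<And>a b es fs. homog V es a \<Longrightarrow> homog V fs b \<Longrightarrow> sum_list es + sum_list fs = sum_list ds \<Longrightarrow> F a b \<in> U"
    and U: "\<And>x y. x \<in> U \<Longrightarrow> y \<in> U \<Longrightarrow> x + y \<in> U"
  shows "unshuffle xs F \<in> U"
  using assms(1,2)
proof (induction ds xs arbitrary: F rule: list_induct2')
  case 1
  have "F [] [] \<in> U" by (rule 1(2)[of "[]" _ "[]"]) (simp_all add: homog_def)
  then show ?case by simp
next
  case (4 d ds x xs)
  then have x: "x \<in> V d" and xs: "homog V ds xs" by (simp_all add: homog_def)
  have th: "homog V es (map th a)" if "homog V es a" for es a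
    using that by (auto simp: homog_def list_all2_conv_all_nth th_in)
  show ?case
    unfolding unshuffle.simps
  proof (rule "4.IH"[OF xs])
    fix a b es fs
    assume ab: "homog V es a" "homog V fs b" "sum_list es + sum_list fs = sum_list ds"
    have "F (x # a) b \<in> U"
      using ab x by (intro "4.prems"(2)[of "d # es" _ fs]) (simp_all add: homog_def)
    moreover have "F a (ev x # b) \<in> U"
      using ab x by (intro "4.prems"(2)[of es _ "d # fs"]) (simp_all add: homog_def part_in)
    moreover have "F (map th a) (od x # b) \<in> U"
      using ab x th[OF ab(1)] by (intro "4.prems"(2)[of es _ "d # fs"]) (simp_all add: homog_def part_in)
    ultimately show "F (x # a) b + F a (ev x # b) + F (map th a) (od x # b) \<in> U"
      by (intro U)
  qed
qed (simp_all add: homog_def)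

lemma graded_symmetric2_insert:
  assumes "vector_space sc" "graded_symmetric s d" "graded_symmetric sc t"
  shows "graded_symmetric2 sc (\<lambda>a b. t (d a # b))"
  unfolding graded_symmetric2_def
  using graded_symmetric_Cons[OF assms(3)]
    graded_symmetric_comp[OF linear_Cons[OF assms(1) graded_symmetricD[OF assms(3)]] assms(2)]
  by blast

context
  fixes d assumes d: "corestriction d"
begin

lemma graded_symmetric_corestriction: "graded_symmetric s d"
  and corestriction_Nil: "d [] = 0"
  and corestriction_in: "homog V ds xs \<Longrightarrow> d xs \<in> V (sum_list ds + 1)"
  using d by (simp_all add: corestriction_def)

text \<open>The degree of \<open>d\<close> is odd, so \<open>d\<close> anticommutes with the parity
  involution.\<close>

lemma corestriction_map_th: "d (map th a) = - th (d a)"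
proof -
  note m = graded_symmetricD[OF graded_symmetric_corestriction]
  have "multilinear s (\<lambda>a. - th (d a))"
    using m by (simp add: multilinear_def th_add th_scale)
  with multilinear_map_th[OF m] show ?thesis
  proof (rule homogeneous_ext)
    fix ds ys assume "homog V ds ys"
    then show "d (map th ys) = - th (d ys)"
      using multilinear_tw_homogeneous[OF vector_space_axioms m, of ds ys 1]
        th_homogeneous[OF corestriction_in[of ds ys]]
      by (auto simp: tw_def powi_minus_one)
  qed
qed

lemma lext_unshuffle_insert:
  assumes "vector_space sc"
  shows "lext sc t (unshuffle w (\<lambda>a b. single (d a # b) 1)) =
    unshuffle w (\<lambda>a b. t (d a # b))"
proof -
  interpret W: vector_space sc by fact
  show ?thesis by (simp add: unshuffle_linear[of "lext sc t", OF W.lext_add])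
qed

lemma coder_of_annihilates:
  assumes "annihilates (*) (sym_rels s V) t"
  shows "annihilates (*) (sym_rels s V)
    (\<lambda>w. lext (*) t (unshuffle w (\<lambda>a b. single (d a # b) 1)))"
  using assms graded_symmetric_unshuffle[OF scalar_vs
      graded_symmetric2_insert[OF scalar_vs graded_symmetric_corestriction]]
  by (simp add: lext_unshuffle_insert scalar_vs annihilates_iff)

lemma coder_of_hom: "coder_of d \<in> hom"
  unfolding coder_of_def
  by (rule end'.lift_coset_hom[OF coder_of_annihilates], assumption, rule keys_unshuffle) simp

lemma dual_coder_of:
  assumes "vector_space sc" "graded_symmetric sc t"
  shows "dual sc (coder_of d) t = (\<lambda>w. unshuffle w (\<lambda>a b. t (d a # b)))"
proof
  fix w
  show "dual sc (coder_of d) t w = unshuffle w (\<lambda>a b. t (d a # b))"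
  proof (cases "w = []")
    case True
    then show ?thesis
      using multilinear_zero_Cons[OF graded_symmetricD[OF assms(2)]]
      by (simp add: corestriction_Nil)
  next
    case False
    then show ?thesis
      using end'.dual_lift[OF assms(1) coder_of_annihilates] assms
      by (simp add: coder_of_def annihilates_sym_rels lext_unshuffle_insert)
  qed
qed

lemma dual_coder_of_letter: "dual s (coder_of d) letter = d"
proof -
  have "letter (d a # b) = (if b = [] then d a else 0)" for a b by (cases b) simp_all
  then show ?thesis
    by (simp add: dual_coder_of[OF vector_space_axioms graded_symmetric_letter] unshuffle_Nil_right)
qed

text \<open>In the coproduct of d(a) \<odot> b the new letter lies in the left factor
  (\<open>H1\<close>) or in the right one (\<open>H2\<close>). Coassociativity turns the first sum
  into that of D \<otimes> 1. In the second, the three words are the argument of \<open>d\<close>,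
  the left factor and the remainder of the right factor; cocommutativity exchanges the first two,
  and regrouping gives the sum of 1 \<otimes> D (\<open>H3\<close>).\<close>

lemma coderivation_coder_of: "coderivation 1 (coder_of d)"
  unfolding coderivation_def
proof (intro allI impI)
  fix \<beta> w assume \<beta>: "reduced \<beta>"
  note vs = scalar_vs
  have \<beta>1: "graded_symmetric (*) (\<beta> a)" and \<beta>2: "graded_symmetric (*) (\<lambda>a. \<beta> a b)" for a b
    using \<beta> by (simp_all add: reduced_def graded_symmetric2_def)
  note m1 = \<beta>1[THEN graded_symmetricD] and m2 = \<beta>2[THEN graded_symmetricD]
  have z: "\<beta> a b = 0" if "0 \<in> set b" for a b by (rule multilinear_zero_mem[OF m1 that])
  define H1 where "H1 a b c = \<beta> (d a # b) c" for a b c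
  define H2 where "H2 a b c = \<beta> b (ev (d a) # c) + \<beta> (map th b) (od (d a) # c)" for a b c
  define H3 where "H3 a b c = \<beta> (map th a) (d b # c)" for a b c
  have td: "tensor_dual 1 (coder_of d) \<beta> =
    (\<lambda>a b. unshuffle a (\<lambda>a' a''. \<beta> (d a' # a'') b) + unshuffle b (\<lambda>b' b''. \<beta> (map th a) (d b' # b'')))"
    by (intro ext) (simp add: tensor_dual_def dual_coder_of[OF vs \<beta>1] dual_coder_of[OF vs \<beta>2] tw_def)
  have "dual (*) (coder_of d) (\<lambda>w. unshuffle w \<beta>) w =
      unshuffle w (\<lambda>a b. unshuffle b (H1 a)) + unshuffle w (\<lambda>a b. unshuffle b (H2 a))"
    using dual_coder_of[OF vs graded_symmetric_unshuffle_reduced[OF \<beta>]]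
    by (simp add: unshuffle_add[symmetric] H1_def[abs_def] H2_def[abs_def] add.assoc)
  also have "unshuffle w (\<lambda>a b. unshuffle b (H1 a)) =
      unshuffle w (\<lambda>a b. unshuffle a (\<lambda>a' a''. H1 a' a'' b))"
    by (rule unshuffle_coassoc) (simp add: H1_def z)
  also have "unshuffle w (\<lambda>a b. unshuffle b (H2 a)) =
      unshuffle w (\<lambda>a b. unshuffle a (\<lambda>a' a''. H2 a' a'' b))"
    by (rule unshuffle_coassoc) (simp add: H2_def z)
  also have "\<dots> = unshuffle w (\<lambda>a b. unshuffle a (\<lambda>a' a''. H3 a' a'' b))"
  proof -
    have "unshuffle c (\<lambda>a a'. H3 a a' b) = unshuffle c (\<lambda>a a'. H2 a a' b)" for b c
    proof -
      have "multilinear2 (*) (\<lambda>a a'. H3 a a' b)"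
        unfolding multilinear2_def H3_def
        using multilinear_map_th[OF m2] graded_symmetric2_insert[OF vs graded_symmetric_corestriction \<beta>1]
        by (simp add: graded_symmetric2_def graded_symmetricD)
      from unshuffle_cocomm[OF this, of c] have "unshuffle c (\<lambda>a a'. H3 a a' b) =
        unshuffle c (\<lambda>a a'. (H3 a' a b + H3 a' (map th a) b + H3 (map th a') a b - H3 (map th a') (map th a) b) / 2)" .
      also have "\<dots> = unshuffle c (\<lambda>a a'. H2 a a' b)"
      proof (rule arg_cong[of _ _ "unshuffle c"], intro ext)
        fix a a'
        \<comment> \<open>With \<open>d a\<close> split by parity, the four-term expression for the
          exchange sign collapses to the two summands of \<open>H2\<close>: the even part keeps
          \<open>a'\<close>, the odd part applies \<open>th\<close> to it.\<close>
        have e: "\<beta> u (d a # b) = \<beta> u (ev (d a) # b) + \<beta> u (od (d a) # b)"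
          "\<beta> u (- th (d a) # b) = \<beta> u (od (d a) # b) - \<beta> u (ev (d a) # b)" for u
          using multilinear_add_Cons[OF m1, of u "ev (d a)" "od (d a)" b]
            multilinear_add_Cons[OF m1, of u "od (d a)" "- ev (d a)" b]
            multilinear_minus_Cons[OF m1, of u "ev (d a)" b]
          by (simp_all add: ev_od th_def)
        show "(H3 a' a b + H3 a' (map th a) b + H3 (map th a') a b - H3 (map th a') (map th a) b) / 2 = H2 a a' b"
          unfolding H3_def H2_def corestriction_map_th map_th_th e by (simp add: field_simps)
      qed
      finally show ?thesis .
    qed
    then show ?thesis by simp
  qed
  also have "\<dots> = unshuffle w (\<lambda>a b. unshuffle b (H3 a))"
    by (rule unshuffle_coassoc[symmetric]) (simp add: H3_def z)
  also have "unshuffle w (\<lambda>a b. unshuffle a (\<lambda>a' a''. H1 a' a'' b)) + \<dots> =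
      unshuffle w (tensor_dual 1 (coder_of d) \<beta>)"
    by (simp add: unshuffle_add[symmetric] td H1_def[abs_def] H3_def[abs_def])
  finally show "dual (*) (coder_of d) (\<lambda>w. unshuffle w \<beta>) w =
    unshuffle w (tensor_dual 1 (coder_of d) \<beta>)" .
qed

lemma coder_of_sym_degree:
  assumes "A \<in> sym_degree s V e"
  shows "coder_of d A \<in> sym_degree s V (e + 1)"
proof -
  let ?M = "\<lambda>w. unshuffle w (\<lambda>a b. single (d a # b) (1 :: 'k))"
  obtain f where f: "A = f +o sym.K" "keys f \<subseteq> {w. w \<noteq> []}" "f \<in> free.span (homogeneous_words e)"
    using sym_degree_cases[OF assms] .
  from f(3) have "lext pscale ?M f \<in> free.span (homogeneous_words (e + 1))"
  proof (induction rule: free.span_induct)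
    case base
    show ?case
      by (intro free.subspaceI)
        (simp_all add: free.lext_add free.lext_pscale free.span_zero free.span_add free.span_scale)
  next
    case (step r)
    then obtain ds xs where r: "r = single xs 1" "homog V ds xs" "sum_list ds = e" by blast
    have "?M xs \<in> free.span (homogeneous_words (e + 1))"
    proof (rule unshuffle_mem[OF r(2)])
      fix a b es fs
      assume ab: "homog V es a" "homog V fs b" "sum_list es + sum_list fs = sum_list ds"
      then have "homog V ((sum_list es + 1) # fs) (d a # b)" "sum_list ((sum_list es + 1) # fs) = e + 1"
        using corestriction_in[OF ab(1)] r(3) by (simp_all add: homog_def)
      then show "single (d a # b) 1 \<in> free.span (homogeneous_words (e + 1))"
        by (intro free.span_base) blast
    qed (rule free.span_add)
    then show ?case by (simp add: r(1))
  qed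
  moreover have "coder_of d A = lext pscale ?M f +o sym.K"
    unfolding coder_of_def f(1) by (rule end'.lift_coset[OF coder_of_annihilates f(2)])
  ultimately show ?thesis by (auto simp: sym_degree_def sym_ker_eq)
qed

lemma coder_of_Coder: "coder_of d \<in> Coder s V 1"
  unfolding Coder_def coalgebra_eqs
  using coder_of_hom coder_of_sym_degree coderivation_coder_of coderivation_iff[OF coder_of_hom, of 1]
  by simp

end

lemma Coder_hom: "D \<in> Coder s V n \<Longrightarrow> D \<in> hom"
  and Coder_coderivation: "D \<in> Coder s V n \<Longrightarrow> coderivation n D"
  and Coder_sym_degree: "D \<in> Coder s V n \<Longrightarrow> A \<in> sym_degree s V e \<Longrightarrow> D A \<in> sym_degree s V (e + n)"
  unfolding Coder_def coalgebra_eqs using coderivation_iff[of D n] by auto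

lemma corestriction_Coder:
  assumes D: "D \<in> Coder s V 1"
  shows "corestriction (dual s D letter)"
  unfolding corestriction_def
proof (intro conjI allI impI)
  show "graded_symmetric s (dual s D letter)"
    by (intro graded_symmetric_dual vector_space_axioms Coder_hom[OF D] graded_symmetric_letter)
  fix ds xs assume xs: "homog V ds xs"
  show "dual s D letter xs \<in> V (sum_list ds + 1)"
  proof (cases "xs = []")
    case False
    have "D (cls xs) \<in> sym_degree s V (sum_list ds + 1)"
      by (intro Coder_sym_degree[OF D] cls_in_sym_degree False xs)
    then obtain f where f: "D (cls xs) = f +o sym.K" "keys f \<subseteq> {w. w \<noteq> []}"
      "f \<in> free.span (homogeneous_words (sum_list ds + 1))"
      by (rule sym_degree_cases)
    from f(3) have "lext s letter f \<in> V (sum_list ds + 1)"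
    proof (induction rule: free.span_induct)
      case base
      show ?case
        by (intro free.subspaceI) (simp_all add: lext_add lext_pscale V_add V_scale)
    next
      case (step r)
      then obtain es ys where r: "r = single ys 1" "homog V es ys" "sum_list es = sum_list ds + 1"
        by blast
      then have "letter ys \<in> V (sum_list ds + 1)"
        by (auto simp: letter_def homog_def list_all2_Cons2 split: list.splits)
      then show ?case by (simp add: r(1))
    qed
    then show ?thesis
      using False f(1) graded_symmetric_letter
      by (simp add: end'.dual_def sym.coset_eval_coset annihilates_sym_rels vector_space_axioms)
  qed simp
qed simp

lemma coder_of_corestriction:
  assumes D: "D \<in> Coder s V 1"
  shows "coder_of (dual s D letter) = D"
proof -
  note c = corestriction_Coder[OF D]
  show ?thesis
    by (rule coderivation_unique[OF coder_of_hom[OF c] coderivation_coder_of[OF c]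
        Coder_hom[OF D] Coder_coderivation[OF D] dual_coder_of_letter[OF c]])
qed

section \<open>The anticommutator of odd coderivations\<close>

text \<open>For two maps of degree 1 the graded commutator has the sign -(-1)^1 = 1. The restriction
  makes the result extensional, as members of \<open>hom\<close> are.\<close>

definition anticommutator where
  "anticommutator \<phi> \<psi> = (\<lambda>A\<in>sym.Q. \<phi> (\<psi> A) + \<psi> (\<phi> A))"

lemma anticommutator_hom:
  assumes "\<phi> \<in> hom" "\<psi> \<in> hom"
  shows "anticommutator \<phi> \<psi> \<in> hom"
proof -
  have scale_add: "coset_scale sym.K c (A + B) = coset_scale sym.K c A + coset_scale sym.K c B"
    if "A \<in> sym.Q" "B \<in> sym.Q" for A B c
    using that by (elim sym.Q_cases)
      (simp add: sym.coset_scale_coset sym.coset_add free.scale_right_distrib)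
  show ?thesis
    using assms by (auto simp: coset_hom_def anticommutator_def PiE_iff scale_add ac_simps)
qed

lemma dual_anticommutator:
  assumes vs: "vector_space sc" and \<phi>: "\<phi> \<in> hom" and \<psi>: "\<psi> \<in> hom" and t: "graded_symmetric sc t"
  shows "dual sc (anticommutator \<phi> \<psi>) t = (\<lambda>w. dual sc \<psi> (dual sc \<phi> t) w + dual sc \<phi> (dual sc \<psi> t) w)"
proof
  fix w
  show "dual sc (anticommutator \<phi> \<psi>) t w = dual sc \<psi> (dual sc \<phi> t) w + dual sc \<phi> (dual sc \<psi> t) w"
  proof (cases "w = []")
    case False
    then have w: "cls w \<in> sym.Q" by simp
    note t' = t[folded annihilates_sym_rels[OF vs]]
    have Q: "\<phi> (cls w) \<in> sym.Q" "\<psi> (cls w) \<in> sym.Q"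
      by (intro end'.coset_hom_in_Q[OF \<phi> w] end'.coset_hom_in_Q[OF \<psi> w])+
    have Q': "\<phi> (\<psi> (cls w)) \<in> sym.Q" "\<psi> (\<phi> (cls w)) \<in> sym.Q"
      by (intro end'.coset_hom_in_Q[OF \<phi> Q(2)] end'.coset_hom_in_Q[OF \<psi> Q(1)])+
    have "coset_eval sc t (anticommutator \<phi> \<psi> (cls w)) =
        coset_eval sc (dual sc \<phi> t) (\<psi> (cls w)) + coset_eval sc (dual sc \<psi> t) (\<phi> (cls w))"
      unfolding end'.coset_eval_dual[OF vs \<phi> t' Q(2), symmetric]
        end'.coset_eval_dual[OF vs \<psi> t' Q(1), symmetric]
      using w by (simp add: anticommutator_def sym.coset_eval_add[OF vs t' Q'])
    then show ?thesis using False by (simp add: end'.dual_def)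
  qed simp
qed

text \<open>Each transpose is a finite sum over a representative of a class, and the two sums are
  exchanged. No sign arises here; in \<open>tensor_dual\<close> the signs come from
  \<open>tw\<close>.\<close>

lemma dual_commute:
  "dual (*) \<phi> (\<lambda>b. dual (*) \<psi> (\<lambda>a. \<beta> a b) a) b = dual (*) \<psi> (\<lambda>a. dual (*) \<phi> (\<beta> a) b) a"
proof (cases "a = [] \<or> b = []")
  case True
  then show ?thesis by (auto simp: dual_zero)
next
  case False
  then show ?thesis by (simp add: end'.dual_def coset_eval_def lext_commute[of "\<lambda>b a. \<beta> a b"])
qed

lemma dual_Coder_map_th:
  assumes D: "D \<in> Coder s V 1" and t: "graded_symmetric (*) t"
  shows "dual (*) D (\<lambda>w. t (map th w)) w = - dual (*) D t (map th w)"
proof -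
  note vs = scalar_vs and g = graded_symmetric_dual[OF scalar_vs Coder_hom[OF D]]
  note m = graded_symmetricD[OF g[OF t]]
  have "multilinear (*) (dual (*) D (\<lambda>w. t (map th w)))"
    by (intro graded_symmetricD g graded_symmetric_map_th t)
  moreover have "multilinear (*) (\<lambda>w. - dual (*) D t (map th w))"
    using multilinear_map_th[OF m] by (simp add: multilinear_def)
  ultimately show ?thesis
  proof (rule homogeneous_ext)
    fix ds ys assume ys: "homog V ds ys"
    show "dual (*) D (\<lambda>w. t (map th w)) ys = - dual (*) D t (map th ys)"
    proof (cases "ys = []")
      case False
      have "D (cls ys) \<in> sym_degree s V (sum_list ds + 1)"
        by (intro Coder_sym_degree[OF D] cls_in_sym_degree False ys)
      from coset_eval_tw_sym_degree[OF this t, of 1]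
      have "dual (*) D (\<lambda>w. t (map th w)) ys = (-1) powi (sum_list ds + 1) * dual (*) D t ys"
        using False by (simp add: end'.dual_def tw_def)
      moreover have "dual (*) D t (map th ys) = (-1) powi (sum_list ds) * dual (*) D t ys"
        using multilinear_tw_homogeneous[OF vs m ys, of 1] by (simp add: tw_def)
      ultimately show ?thesis by (simp add: powi_minus_one)
    qed simp
  qed
qed

text \<open>Composing two operators of the form D \<otimes> 1 + 1 \<otimes> D yields the
  compositions in each factor and two cross terms. Because both maps are odd, the sum of the cross
  terms changes sign when \<phi> and \<psi> exchange roles, so it cancels in the
  anticommutator.\<close>

lemma coderivation_anticommutator:
  assumes \<phi>: "\<phi> \<in> Coder s V 1" and \<psi>: "\<psi> \<in> Coder s V 1"
  shows "coderivation 2 (anticommutator \<phi> \<psi>)"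
  unfolding coderivation_def
proof (intro allI impI)
  fix \<beta> w assume \<beta>: "reduced \<beta>"
  note vs = scalar_vs and h = Coder_hom[OF \<phi>] Coder_hom[OF \<psi>]
  have \<beta>1: "graded_symmetric (*) (\<beta> a)" and \<beta>2: "graded_symmetric (*) (\<lambda>a. \<beta> a b)" for a b
    using \<beta> by (simp_all add: reduced_def graded_symmetric2_def)
  have two: "dual (*) \<zeta> (dual (*) \<chi> (\<lambda>w. unshuffle w \<beta>)) w =
      unshuffle w (tensor_dual 1 \<zeta> (tensor_dual 1 \<chi> \<beta>))"
    if "\<chi> \<in> Coder s V 1" "\<zeta> \<in> Coder s V 1" for \<chi> \<zeta>
  proof -
    have "dual (*) \<chi> (\<lambda>w. unshuffle w \<beta>) = (\<lambda>w. unshuffle w (tensor_dual 1 \<chi> \<beta>))"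
      using Coder_coderivation[OF that(1)] \<beta> by (auto simp: coderivation_def)
    then show ?thesis
      using Coder_coderivation[OF that(2)] reduced_tensor_dual[OF Coder_hom[OF that(1)] \<beta>]
      by (simp add: coderivation_def)
  qed
  \<comment> \<open>The cross term in which \<zeta> acts on the first word and \<chi> on the
    second.\<close>
  define X where "X \<chi> \<zeta> a b = dual (*) \<zeta> (\<lambda>a. dual (*) \<chi> (\<beta> (map th a)) b) a" for \<chi> \<zeta> a b
  have expand: "tensor_dual 1 \<zeta> (tensor_dual 1 \<chi> \<beta>) a b =
      dual (*) \<zeta> (dual (*) \<chi> (\<lambda>a. \<beta> a b)) a + X \<chi> \<zeta> a b - X \<zeta> \<chi> a b + dual (*) \<zeta> (dual (*) \<chi> (\<beta> a)) b"
    if \<chi>: "\<chi> \<in> Coder s V 1" and \<zeta>: "\<zeta> \<in> Coder s V 1" for \<chi> \<zeta> a b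
  proof -
    have "graded_symmetric (*) (\<lambda>a'. dual (*) \<zeta> (\<beta> a') b)"
    proof -
      \<comment> \<open>With \<open>n = 0\<close> there is no twist, so the function in question is
        a graded symmetric one minus the part acting on the first word.\<close>
      have "reduced (tensor_dual 0 \<zeta> \<beta>)" by (rule reduced_tensor_dual[OF Coder_hom[OF \<zeta>] \<beta>])
      then have 1: "graded_symmetric (*) (\<lambda>a. dual (*) \<zeta> (\<lambda>a. \<beta> a b) a + dual (*) \<zeta> (\<beta> a) b)"
        by (simp add: reduced_def graded_symmetric2_def tensor_dual_def tw_def)
      have "graded_symmetric (*) (\<lambda>a. - dual (*) \<zeta> (\<lambda>a. \<beta> a b) a)"
        using graded_symmetric_dual[OF vs Coder_hom[OF \<zeta>] \<beta>2[of b]]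
        by (simp add: graded_symmetric_def multilinear_def)
      from graded_symmetric_fun_add[OF vs 1 this] show ?thesis by simp
    qed
    from dual_Coder_map_th[OF \<chi> this, of a]
    have "dual (*) \<chi> (\<lambda>a'. dual (*) \<zeta> (\<beta> a') b) (map th a) = - X \<zeta> \<chi> a b"
      by (simp add: X_def)
    then have "dual (*) \<zeta> (\<lambda>b. dual (*) \<chi> (\<lambda>a'. \<beta> a' b) (map th a)) b = - X \<zeta> \<chi> a b"
      by (subst dual_commute[where \<phi> = \<zeta> and \<psi> = \<chi> and \<beta> = \<beta>])
    then show ?thesis
      by (simp add: tensor_dual_def[abs_def] tw_def end'.dual_fun_add[OF vs] X_def)
  qed
  have "dual (*) (anticommutator \<phi> \<psi>) (\<lambda>w. unshuffle w \<beta>) w =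
      unshuffle w (tensor_dual 1 \<psi> (tensor_dual 1 \<phi> \<beta>)) + unshuffle w (tensor_dual 1 \<phi> (tensor_dual 1 \<psi> \<beta>))"
    by (simp add: dual_anticommutator[OF vs h graded_symmetric_unshuffle_reduced[OF \<beta>]] two \<phi> \<psi>)
  also have "\<dots> = unshuffle w (tensor_dual 2 (anticommutator \<phi> \<psi>) \<beta>)"
    unfolding unshuffle_add[symmetric]
    by (rule arg_cong[of _ _ "unshuffle w"], intro ext)
      (simp add: expand \<phi> \<psi> tensor_dual_def[of 2] tw_def dual_anticommutator[OF vs h \<beta>1]
        dual_anticommutator[OF vs h \<beta>2])
  finally show "dual (*) (anticommutator \<phi> \<psi>) (\<lambda>w. unshuffle w \<beta>) w =
    unshuffle w (tensor_dual 2 (anticommutator \<phi> \<psi>) \<beta>)" .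
qed

abbreviation zero_map where "zero_map \<equiv> \<lambda>A\<in>sym.Q. sym.K"

lemma zero_map_hom: "zero_map \<in> hom"
  using sym.coset_scale_coset[of _ 0] by (auto simp: coset_hom_def)

lemma dual_zero_map: "vector_space sc \<Longrightarrow> graded_symmetric sc t \<Longrightarrow> dual sc zero_map t = (\<lambda>w. 0)"
  by (auto simp: end'.dual_def sym.coset_eval_K annihilates_sym_rels)

lemma anticommutator_eq_zero_iff:
  assumes "corestriction d" "corestriction e"
  shows "anticommutator (coder_of d) (coder_of e) = zero_map \<longleftrightarrow>
    (\<forall>w. unshuffle w (\<lambda>a b. d (e a # b) + e (d a # b)) = 0)"
proof -
  let ?B = "anticommutator (coder_of d) (coder_of e)"
  note D = coder_of_Coder[OF assms(1)] and E = coder_of_Coder[OF assms(2)]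
  note hD = Coder_hom[OF D] and hE = Coder_hom[OF E] and vs = scalar_vs
  have l: "dual s ?B letter = (\<lambda>w. unshuffle w (\<lambda>a b. d (e a # b) + e (d a # b)))"
    using graded_symmetric_corestriction[OF assms(1)] graded_symmetric_corestriction[OF assms(2)]
    by (simp add: dual_anticommutator[OF vector_space_axioms hD hE graded_symmetric_letter]
        dual_coder_of_letter[OF assms(1)] dual_coder_of_letter[OF assms(2)]
        dual_coder_of[OF assms(1) vector_space_axioms] dual_coder_of[OF assms(2) vector_space_axioms]
        unshuffle_add)
  have z: "dual s zero_map letter = (\<lambda>w. 0)"
    by (rule dual_zero_map[OF vector_space_axioms graded_symmetric_letter])
  have "coderivation 2 zero_map"
    unfolding coderivation_def
  proof (intro allI impI)
    fix \<beta> w assume \<beta>: "reduced \<beta>"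
    then have "tensor_dual 2 zero_map \<beta> = (\<lambda>a b. 0)"
      by (simp add: tensor_dual_def[abs_def] dual_zero_map[OF vs] reduced_def graded_symmetric2_def)
    then show "dual (*) zero_map (\<lambda>w. unshuffle w \<beta>) w = unshuffle w (tensor_dual 2 zero_map \<beta>)"
      by (simp add: dual_zero_map[OF vs graded_symmetric_unshuffle_reduced[OF \<beta>]])
  qed
  from coderivation_unique[OF anticommutator_hom[OF hD hE] coderivation_anticommutator[OF D E]
      zero_map_hom this]
  have "?B = zero_map \<longleftrightarrow> dual s ?B letter = dual s zero_map letter" by auto
  then show ?thesis unfolding l z by (simp add: fun_eq_iff)
qed

end

section \<open>Decalage\<close>

definition decalage_exp :: "int list \<Rightarrow> int" where
  "decalage_exp ds = (\<Sum>a<length ds. int (length ds - 1 - a) * ds ! a)"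

lemma decalage_exp_Nil [simp]: "decalage_exp [] = 0"
  by (simp add: decalage_exp_def)

lemma decalage_exp_Cons [simp]:
  "decalage_exp (d # ds) = int (length ds) * d + decalage_exp ds"
  by (simp add: decalage_exp_def sum.lessThan_Suc_shift del: sum.lessThan_Suc)

lemma decalage_exp_append:
  "decalage_exp (ds @ es) =
     decalage_exp ds + int (length es) * sum_list ds + decalage_exp es"
  by (induction ds) (simp_all add: algebra_simps)

lemma decalage_exp_permute:
  assumes "\<sigma> permutes {..<length ds}"
  shows "decalage_exp (permute_list \<sigma> ds) = (\<Sum>a<length ds. int (length ds - 1 - a) * ds ! \<sigma> a)"
  using assms by (simp add: decalage_exp_def permute_list_nth)

lemma permutes_no_descent:
  assumes \<sigma>: "\<sigma> permutes {..<n}" and "\<And>a. Suc a < n \<Longrightarrow> \<sigma> a \<le> \<sigma> (Suc a)"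
  shows "\<sigma> = id"
proof -
  have "i \<le> \<sigma> i" if "i < n" for i
    using that
  proof (induction i)
    case (Suc i)
    have "\<sigma> i \<noteq> \<sigma> (Suc i)" using permutes_inj[OF \<sigma>] by (metis injD n_not_Suc_n)
    then show ?case using Suc assms(2)[of i] by simp
  qed simp
  then show ?thesis using permutes_natset_ge[OF \<sigma>] by simp
qed

lemma koszul_sign_id [simp]: "koszul_sign ds id = (1 :: 'k::field)"
  unfolding koszul_sign_def by (rule prod.neutral) auto

text \<open>By induction on inversions it suffices to exchange adjacent letters of degrees p and q.
  This changes the decalage exponent by p - q, and pq + 1 has the same parity as (p - 1)(q - 1) + p
  + q.\<close>

lemma skew_koszul_sign_decalage:
  assumes "\<sigma> permutes {..<length ds}"
  shows "skew_koszul_sign ds \<sigma> * (-1) powi decalage_exp ds =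
    (koszul_sign (map (\<lambda>d. d - 1) ds) \<sigma> * (-1) powi decalage_exp (permute_list \<sigma> ds) :: 'k::field)"
  using assms
proof (induction "card {(i, j). i < j \<and> j < length ds \<and> \<sigma> j < \<sigma> i}" arbitrary: \<sigma> rule: less_induct)
  case less
  note \<sigma> = less.prems
  let ?es = "map (\<lambda>d. d - 1) ds"
  show ?case
  proof (cases "\<exists>a. Suc a < length ds \<and> \<sigma> (Suc a) < \<sigma> a")
    case False
    then have "\<sigma> = id" using permutes_no_descent[OF \<sigma>] by (meson not_le)
    then show ?thesis by (simp add: skew_koszul_sign_def sign_id)
  next
    case True
    then obtain a where a: "Suc a < length ds" "\<sigma> (Suc a) < \<sigma> a" by blast
    define \<tau> where "\<tau> = Transposition.transpose a (Suc a)"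
    have \<tau>: "\<tau> permutes {..<length ds}" unfolding \<tau>_def using a by (intro permutes_swap_id) auto
    have \<sigma>\<tau>: "(\<sigma> \<circ> \<tau>) permutes {..<length ds}" by (rule permutes_compose[OF \<tau> \<sigma>])
    have lt: "\<sigma> a < length ds" "\<sigma> (Suc a) < length ds"
      using permutes_in_image[OF \<sigma>] a by auto
    define p q where "p = ds ! \<sigma> a" and "q = ds ! \<sigma> (Suc a)"
    note k = koszul_sign_transpose(1)[of \<sigma> ds a, where 'k = 'k, folded \<tau>_def, OF \<sigma> a]
    note inv = koszul_sign_transpose(2)[of \<sigma> ds a, folded \<tau>_def, OF \<sigma> a]
    have k': "koszul_sign ?es \<sigma> = (-1) powi ((p - 1) * (q - 1)) * (koszul_sign ?es (\<sigma> \<circ> \<tau>) :: 'k)"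
      using koszul_sign_transpose(1)[of \<sigma> ?es a, where 'k = 'k, folded \<tau>_def] \<sigma> a lt
      by (simp add: p_def q_def)
    have "permutation \<sigma>" "permutation \<tau>"
      using \<sigma> \<tau> by (auto intro: permutation_permutes[THEN iffD2])
    then have "sign (\<sigma> \<circ> \<tau>) = - sign \<sigma>"
      by (simp add: sign_compose) (simp add: \<tau>_def sign_swap_id)
    then have sk: "(skew_koszul_sign ds \<sigma> :: 'k) = - ((-1) powi (p * q)) * skew_koszul_sign ds (\<sigma> \<circ> \<tau>)"
      by (simp add: skew_koszul_sign_def k p_def q_def)
    let ?c = "\<lambda>k. int (length ds - 1 - k)"
    have "decalage_exp (permute_list \<sigma> ds) - decalage_exp (permute_list (\<sigma> \<circ> \<tau>) ds) =
        (\<Sum>k<length ds. ?c k * (ds ! \<sigma> k - ds ! \<sigma> (\<tau> k)))"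
      by (simp add: decalage_exp_permute[OF \<sigma>] decalage_exp_permute[OF \<sigma>\<tau>]
          sum_subtractf[symmetric] right_diff_distrib)
    \<comment> \<open>Only the two exchanged positions contribute, and their weights differ by
      1.\<close>
    also have "\<dots> = (\<Sum>k\<in>{a, Suc a}. ?c k * (ds ! \<sigma> k - ds ! \<sigma> (\<tau> k)))"
      using a by (intro sum.mono_neutral_right) (auto simp: \<tau>_def Transposition.transpose_def)
    also have "\<dots> = (?c a - ?c (Suc a)) * (p - q)"
      by (simp add: \<tau>_def p_def q_def algebra_simps)
    also have "?c a - ?c (Suc a) = 1" using a by simp
    finally have "decalage_exp (permute_list \<sigma> ds) =
        decalage_exp (permute_list (\<sigma> \<circ> \<tau>) ds) + (p - q)"
      by (simp only: mult_1_left diff_eq_eq add.commute)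
    then have e: "(-1) powi decalage_exp (permute_list \<sigma> ds) =
        ((-1) powi (p + q) * (-1) powi decalage_exp (permute_list (\<sigma> \<circ> \<tau>) ds) :: 'k)"
      by (simp add: powi_minus_one)
    have "skew_koszul_sign ds (\<sigma> \<circ> \<tau>) * (-1) powi decalage_exp ds =
      (koszul_sign ?es (\<sigma> \<circ> \<tau>) * (-1) powi decalage_exp (permute_list (\<sigma> \<circ> \<tau>) ds) :: 'k)"
      using less.hyps[OF inv \<sigma>\<tau>] .
    then show ?thesis
      unfolding sk k' e by (auto simp: powi_minus_one)
  qed
qed

lemma sum_list_shift: "sum_list (map (\<lambda>d. d + c) ds) = sum_list ds + int (length ds) * (c :: int)"
  by (induction ds) (simp_all add: algebra_simps)

lemma homog_desusp: "homog (desusp L) (map (\<lambda>d. d - 1) ds) xs \<longleftrightarrow> homog L ds xs"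
  and homog_desusp': "homog (desusp L) es xs \<longleftrightarrow> homog L (map (\<lambda>d. d + 1) es) xs"
  by (simp_all add: homog_def desusp_def list_all2_map1)

section \<open>Skew-symmetric families on L and symmetric maps on its desuspension\<close>

locale desuspended_space =
  fixes s :: "'k::field_char_0 \<Rightarrow> 'v::ab_group_add \<Rightarrow> 'v" and L :: "int \<Rightarrow> 'v set"
  assumes graded_L: "graded_vector_space s L"
begin

sublocale graded_space s "desusp L"
  by unfold_locales (rule graded_desusp[OF graded_L])

lemma subspace_L: "subspace (L i)"
  using graded_L by (rule subspace_graded)

lemma th_L: "x \<in> L p \<Longrightarrow> th x = (if even p then - x else x)"
  using th_homogeneous[of x "p - 1"] by (simp add: desusp_def)

text \<open>\<open>decale [x\<^sub>1, \<dots>, x\<^sub>k]\<close> multiplies each \<open>x\<^sub>a\<close> by \<open>(-1)\<^bsup>(k-a)|x\<^sub>a|\<^esup>\<close>, with degrees taken in \<open>L\<close>;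
  \<open>th\<close> uses the degrees of \<open>s\<^sup>-\<^sup>1 L\<close>.\<close>

primrec decale :: "'v list \<Rightarrow> 'v list" where
  "decale [] = []"
| "decale (x # xs) = (if even (length xs) then x else - th x) # decale xs"

text \<open>The maps of \<open>decalage\<close> for all arities in one function, defined on
  inhomogeneous letters too, since \<open>decale\<close> writes the signs by means of
  \<open>th\<close>; \<open>desuspend_decalage\<close> compares the two.\<close>

definition desuspend :: "(nat \<Rightarrow> 'v list \<Rightarrow> 'v) \<Rightarrow> 'v list \<Rightarrow> 'v" where
  "desuspend l xs = l (length xs) (decale xs)"

text \<open>Inverse to \<open>desuspend\<close> because \<open>decale\<close> is an involution; the
  guard restores the default values that \<open>skew_maps\<close> prescribes.\<close>

definition suspend :: "('v list \<Rightarrow> 'v) \<Rightarrow> nat \<Rightarrow> 'v list \<Rightarrow> 'v" where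
  "suspend d k xs = (if 1 \<le> k \<and> length xs = k then d (decale xs) else 0)"

lemma length_decale [simp]: "length (decale xs) = length xs"
  by (induction xs) simp_all

lemma th_minus: "th (- x) = - th x"
  by (simp add: th_def part_minus)

lemma decale_decale [simp]: "decale (decale xs) = xs"
  by (induction xs) (simp_all add: th_minus)

lemma multilinear_decale:
  assumes "multilinear sc t"
  shows "multilinear sc (\<lambda>xs. t (decale xs))"
  unfolding multilinear_def
proof (intro conjI allI)
  fix us ws x y
  show "t (decale (us @ (x + y) # ws)) = t (decale (us @ x # ws)) + t (decale (us @ y # ws))"
    using assms
  proof (induction us arbitrary: t)
    case Nil
    then show ?case
      using multilinear_add_Cons[OF Nil, of "- th x" "- th y"]
      by (simp add: multilinear_add_Cons[OF Nil] th_add)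
  next
    case (Cons u us)
    from Cons.IH[OF multilinear_Cons[OF Cons.prems]] show ?case by simp
  qed
next
  fix us ws x c
  show "t (decale (us @ s c x # ws)) = sc c (t (decale (us @ x # ws)))"
    using assms
  proof (induction us arbitrary: t)
    case Nil
    then show ?case
      using multilinear_scale_Cons[OF Nil, of c "- th x"]
      by (simp add: multilinear_scale_Cons[OF Nil] th_scale)
  next
    case (Cons u us)
    from Cons.IH[OF multilinear_Cons[OF Cons.prems]] show ?case by simp
  qed
qed

lemma decale_homogeneous:
  assumes "vector_space sc" "multilinear sc t" "homog L ds xs"
  shows "t (decale xs) = sc ((-1) powi decalage_exp ds) (t xs)"
  using assms(3,2)
proof (induction ds xs arbitrary: t rule: list_induct2')
  case 1
  interpret W: vector_space sc by fact
  show ?case by simp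
next
  case (4 d ds x xs)
  interpret W: vector_space sc by fact
  from 4(2) have x: "x \<in> L d" and xs: "homog L ds xs" by (simp_all add: homog_def)
  have len: "length ds = length xs" using xs by (auto simp: homog_def list_all2_lengthD)
  let ?y = "if even (length xs) then x else - th x"
  have "t (decale (x # xs)) = sc ((-1) powi decalage_exp ds) (t (?y # xs))"
    using "4.IH"[OF xs multilinear_Cons[OF "4.prems"(2)], of ?y] by simp
  also have "t (?y # xs) = sc ((-1) powi (int (length xs) * d)) (t (x # xs))"
    by (auto simp: th_L[OF x] powi_minus_one multilinear_minus_Cons[OF "4.prems"(2)])
  finally show ?case by (simp add: len power_int_add mult.commute)
qed (simp_all add: homog_def)

lemma graded_symmetric_permute:
  assumes vs: "vector_space sc" and t: "graded_symmetric sc t"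
    and xs: "homog (desusp L) es xs" and \<sigma>: "\<sigma> permutes {..<length xs}"
  shows "t (permute_list \<sigma> xs) = sc (koszul_sign es \<sigma>) (t xs)"
proof -
  interpret W: vector_space sc by fact
  have "lext sc t (single (permute_list \<sigma> xs) 1 - single xs (koszul_sign es \<sigma>)) = 0"
    using single_permute_mem_sym_ker[OF xs \<sigma>, of s] t
    by (intro W.lext_annihilates_span[of "sym_rels s (desusp L)"])
      (simp_all add: annihilates_sym_rels[OF vs] sym_ker_def)
  then show ?thesis by (simp add: W.lext_diff)
qed

lemma permute_transpose_adjacent:
  "permute_list (Transposition.transpose (length us) (Suc (length us))) (us @ y # x # ws) = us @ x # y # ws"
  (is "permute_list ?\<tau> ?zs = _")
proof (rule nth_equalityI)
  fix i assume "i < length (permute_list ?\<tau> ?zs)"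
  then have i: "i < length ?zs" by simp
  have "?\<tau> permutes {..<length ?zs}" by (intro permutes_swap_id) auto
  then have "permute_list ?\<tau> ?zs ! i = ?zs ! ?\<tau> i" using i by (simp add: permute_list_nth)
  then show "permute_list ?\<tau> ?zs ! i = (us @ x # y # ws) ! i"
    by (auto simp: Transposition.transpose_def nth_append nth_Cons' numeral_2_eq_2)
qed simp

context
  fixes l assumes l: "skew_maps s L l"
begin

lemma skew_maps_multilinear: "multilinear s (\<lambda>xs. l (length xs) xs)"
  using l by (auto simp: skew_maps_def multilinear_on_lists_def multilinear_def)

lemma multilinear_desuspend: "multilinear s (desuspend l)"
  using multilinear_decale[OF skew_maps_multilinear] by (simp add: desuspend_def[abs_def])

lemma desuspend_homogeneous:
  "homog L ds xs \<Longrightarrow> desuspend l xs = s ((-1) powi decalage_exp ds) (l (length xs) xs)"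
  using decale_homogeneous[OF vector_space_axioms skew_maps_multilinear] by (simp add: desuspend_def)

lemma desuspend_decalage:
  assumes "homog L ds xs"
  shows "desuspend l xs = decalage s l ds xs"
  using assms desuspend_homogeneous[OF assms]
  by (simp add: decalage_def decalage_exp_def homog_def list_all2_lengthD)

lemma desuspend_Nil: "desuspend l [] = 0"
  using l by (simp add: skew_maps_def desuspend_def)

lemma skew_maps_in:
  assumes "homog L ds xs" "xs \<noteq> []"
  shows "l (length xs) xs \<in> L (sum_list ds + 2 - int (length xs))"
  using l assms by (simp add: skew_maps_def Suc_le_eq)

lemma desuspend_permute:
  assumes xs: "homog L ds xs" and \<sigma>: "\<sigma> permutes {..<length xs}"
  shows "desuspend l (permute_list \<sigma> xs) = s (koszul_sign (map (\<lambda>d. d - 1) ds) \<sigma>) (desuspend l xs)"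
proof (cases "xs = []")
  case False
  have len: "length ds = length xs" using xs by (auto simp: homog_def list_all2_lengthD)
  let ?e = "\<lambda>ds. (-1 :: 'k) powi decalage_exp ds"
  have "desuspend l (permute_list \<sigma> xs) = s (?e (permute_list \<sigma> ds)) (l (length xs) (permute_list \<sigma> xs))"
    using desuspend_homogeneous[OF homog_permute[OF xs \<sigma>]] by simp
  also have "l (length xs) (permute_list \<sigma> xs) = s (skew_koszul_sign ds \<sigma>) (l (length xs) xs)"
    using l xs \<sigma> False by (simp add: skew_maps_def Suc_le_eq)
  also have "skew_koszul_sign ds \<sigma> = koszul_sign (map (\<lambda>d. d - 1) ds) \<sigma> * ?e (permute_list \<sigma> ds) * ?e ds"
  proof -
    have "skew_koszul_sign ds \<sigma> = skew_koszul_sign ds \<sigma> * ?e ds * ?e ds"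
      by (simp add: powi_minus_one)
    also have "skew_koszul_sign ds \<sigma> * ?e ds = koszul_sign (map (\<lambda>d. d - 1) ds) \<sigma> * ?e (permute_list \<sigma> ds)"
      using \<sigma> len by (intro skew_koszul_sign_decalage) simp
    finally show ?thesis .
  qed
  finally show ?thesis
    by (auto simp: desuspend_homogeneous[OF xs] powi_minus_one)
qed (simp add: desuspend_Nil)

text \<open>\<open>skew_maps\<close> speaks of permutations of homogeneous words, while the
  neighbours \<open>us\<close> and \<open>ws\<close> are arbitrary here. For homogeneous neighbours
  the permutation rule applies, and multilinearity extends the identity first to all
  \<open>us\<close> (\<open>half\<close>) and then to all \<open>ws\<close>.\<close>

lemma desuspend_swap:
  assumes x: "x \<in> desusp L p" and y: "y \<in> desusp L q"
  shows "desuspend l (us @ x # y # ws) = s ((-1) powi (p * q)) (desuspend l (us @ y # x # ws))"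
proof -
  let ?c = "(-1 :: 'k) powi (p * q)"
  note m = multilinear_desuspend
  have prepend: "multilinear s (\<lambda>b. desuspend l (a @ b))" for a
    using m unfolding multilinear_def by (metis append_assoc)
  have scale: "multilinear s (\<lambda>b. s ?c (t b))" if "multilinear s t" for t
    using that by (simp add: multilinear_def scale_right_distrib mult.commute)
  have hom: "desuspend l (us @ x # y # ws) = s ?c (desuspend l (us @ y # x # ws))"
    if us: "homog (desusp L) ds us" and ws: "homog (desusp L) es ws" for ds us es ws
  proof -
    let ?zs = "us @ y # x # ws" and ?fs = "ds @ q # p # es"
    let ?\<tau> = "Transposition.transpose (length us) (Suc (length us))"
    have zs: "homog (desusp L) ?fs ?zs" using us ws x y by (simp add: homog_def list_all2_appendI)
    have len: "length ds = length us" using us by (auto simp: homog_def list_all2_lengthD)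
    have lz: "length ?fs = length ?zs" using zs unfolding homog_def by (rule list_all2_lengthD)
    have \<tau>: "?\<tau> permutes {..<length ?fs}" by (intro permutes_swap_id) (auto simp: len)
    have "koszul_sign ?fs ?\<tau> = (?c :: 'k)"
      using koszul_sign_transpose(1)[OF \<tau>, of "length us", where 'k = 'k] len
      by (simp add: nth_append mult.commute)
    moreover have "desuspend l (permute_list ?\<tau> ?zs) = s (koszul_sign ?fs ?\<tau>) (desuspend l ?zs)"
      using desuspend_permute[of "map (\<lambda>d. d + 1) ?fs" ?zs ?\<tau>] zs \<tau> lz
      by (simp add: homog_desusp' o_def)
    ultimately show ?thesis by (simp only: permute_transpose_adjacent)
  qed
  have half: "desuspend l (us @ x # y # ws) = s ?c (desuspend l (us @ y # x # ws))"
    if ws: "homog (desusp L) es ws" for us es ws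
    by (rule homogeneous_ext[OF multilinear_append[OF m, of "x # y # ws"] scale[OF multilinear_append[OF m, of "y # x # ws"]]])
      (rule hom[OF _ ws])
  have t: "multilinear s (\<lambda>ws. desuspend l (us @ x # y # ws))" for x y
    using prepend[of "us @ [x, y]"] by simp
  show ?thesis
    by (rule homogeneous_ext[OF t scale[OF t]]) (rule half)
qed

lemma corestriction_desuspend: "corestriction (desuspend l)"
  unfolding corestriction_def graded_symmetric_def
proof (intro conjI allI impI)
  fix es xs assume "homog (desusp L) es xs"
  then have xs: "homog L (map (\<lambda>d. d + 1) es) xs" by (simp add: homog_desusp')
  have len: "length es = length xs" using list_all2_lengthD[OF xs[unfolded homog_def]] by simp
  show "desuspend l xs \<in> desusp L (sum_list es + 1)"
  proof (cases "xs = []")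
    case False
    have "l (length xs) xs \<in> desusp L (sum_list es + 1)"
      using skew_maps_in[OF xs False] by (simp add: sum_list_shift len desusp_def add.commute)
    then show ?thesis by (simp add: desuspend_homogeneous[OF xs] V_scale)
  qed (simp add: desuspend_Nil)
qed (simp_all add: multilinear_desuspend desuspend_Nil desuspend_swap)

lemma suspend_desuspend: "suspend (desuspend l) = l"
  using l by (auto simp: suspend_def desuspend_def skew_maps_def fun_eq_iff)

end

context
  fixes d assumes d: "corestriction d"
begin

lemma desuspend_suspend: "desuspend (suspend d) = d"
  by (auto simp: desuspend_def suspend_def fun_eq_iff Suc_le_eq corestriction_Nil[OF d])

lemma skew_maps_suspend: "skew_maps s L (suspend d)"
proof -
  note g = graded_symmetric_corestriction[OF d]
  note m = graded_symmetricD[OF g]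
  note vs = vector_space_axioms
  have "multilinear_on_lists s k (suspend d k)" for k
    using multilinear_decale[OF m] by (auto simp: multilinear_on_lists_def multilinear_def suspend_def)
  moreover have "suspend d k xs \<in> L (sum_list ds + 2 - int k) \<and>
      (\<forall>\<sigma>. \<sigma> permutes {..<k} \<longrightarrow> suspend d k (permute_list \<sigma> xs) = s (skew_koszul_sign ds \<sigma>) (suspend d k xs))"
    if k: "1 \<le> k" "length xs = k" and xs: "homog L ds xs" for k ds xs
  proof (intro conjI allI impI)
    have len: "length ds = length xs" using xs by (auto simp: homog_def list_all2_lengthD)
    have "d xs \<in> desusp L (sum_list (map (\<lambda>d. d + - 1) ds) + 1)"
      using xs by (intro corestriction_in[OF d]) (simp add: homog_desusp)
    then have "d xs \<in> L (sum_list ds + 2 - int k)"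
      unfolding sum_list_shift using k len by (simp add: desusp_def algebra_simps)
    then show "suspend d k xs \<in> L (sum_list ds + 2 - int k)"
      using k by (simp add: suspend_def decale_homogeneous[OF vs m xs] subspace_scale[OF subspace_L])
    fix \<sigma> assume "\<sigma> permutes {..<k}"
    then have \<sigma>: "\<sigma> permutes {..<length xs}" using k by simp
    let ?e = "\<lambda>ds. (-1 :: 'k) powi decalage_exp ds"
    have "d (decale (permute_list \<sigma> xs)) = s (?e (permute_list \<sigma> ds)) (d (permute_list \<sigma> xs))"
      by (rule decale_homogeneous[OF vs m homog_permute[OF xs \<sigma>]])
    also have "d (permute_list \<sigma> xs) = s (koszul_sign (map (\<lambda>d. d - 1) ds) \<sigma>) (d xs)"
      using xs \<sigma> by (intro graded_symmetric_permute vs g) (simp_all add: homog_desusp)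
    also have "s (?e (permute_list \<sigma> ds)) \<dots> = s (skew_koszul_sign ds \<sigma> * ?e ds) (d xs)"
      using skew_koszul_sign_decalage[of \<sigma> ds, where 'k = 'k] \<sigma> len by (simp add: mult.commute)
    also have "\<dots> = s (skew_koszul_sign ds \<sigma>) (d (decale xs))"
      by (simp add: decale_homogeneous[OF vs m xs])
    finally show "suspend d k (permute_list \<sigma> xs) = s (skew_koszul_sign ds \<sigma>) (suspend d k xs)"
      using k by (simp add: suspend_def)
  qed
  ultimately show ?thesis unfolding skew_maps_def by (auto simp: suspend_def)
qed

end

section \<open>Compatibility and anticommutators\<close>

text \<open>The polarised Jacobi expression: symmetrised in \<open>l\<close> and \<open>l'\<close>
  it is the compatibility sum, and for \<open>l = l'\<close> the symmetrisation is twice the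
  L-infinity relation.\<close>

definition jacobi where
  "jacobi l l' ds xs =
     (\<Sum>(i, j)\<in>{(i, j). 1 \<le> i \<and> 1 \<le> j \<and> i + j = length xs + 1}.
       \<Sum>\<sigma>\<in>shuffle_perms i (length xs - i).
         let ys = permute_list \<sigma> xs
         in s (skew_koszul_sign ds \<sigma> * (-1) ^ (i * (j - 1))) (l j (l' i (take i ys) # drop i ys)))"

text \<open>The inner and the outer decalage together have the exponent of the permuted word plus (n
  - i)(2 - i), whose parity is that of i(j - 1) for j = n + 1 - i. The permuted exponent is
  converted by \<open>skew_koszul_sign_decalage\<close>.\<close>

lemma unshuffle_jacobi:
  assumes l: "skew_maps s L l" and l': "skew_maps s L l'" and xs: "homog L ds xs"
  shows "unshuffle xs (\<lambda>a b. desuspend l (desuspend l' a # b)) =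
    s ((-1) powi decalage_exp ds) (jacobi l l' ds xs)"
proof -
  note vs = vector_space_axioms
  note g = graded_symmetric_corestriction[OF corestriction_desuspend[OF l]]
    and g' = graded_symmetric_corestriction[OF corestriction_desuspend[OF l']]
  let ?n = "length xs" and ?es = "map (\<lambda>d. d - 1) ds"
  have len: "length ds = ?n" using xs by (auto simp: homog_def list_all2_lengthD)
  let ?f = "\<lambda>i j \<sigma>. s (skew_koszul_sign ds \<sigma> * (-1) ^ (i * (j - 1)))
    (l j (l' i (take i (permute_list \<sigma> xs)) # drop i (permute_list \<sigma> xs)))"
  let ?F = "\<lambda>a b. desuspend l (desuspend l' a # b)"
  let ?h = "\<lambda>i \<sigma>. s (koszul_sign ?es \<sigma>) (?F (take i (permute_list \<sigma> xs)) (drop i (permute_list \<sigma> xs)))"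
  have summand: "?h i \<sigma> = s ((-1) powi decalage_exp ds) (?f i (?n + 1 - i) \<sigma>)"
    if i: "i \<in> {1..?n}" and "\<sigma> \<in> shuffle_perms i (?n - i)" for i \<sigma>
  proof -
    have \<sigma>: "\<sigma> permutes {..<?n}" using that shuffle_perms_permutes by fastforce
    define ys fs where "ys = permute_list \<sigma> xs" and "fs = permute_list \<sigma> ds"
    have ys: "homog L fs ys" unfolding ys_def fs_def by (rule homog_permute[OF xs \<sigma>])
    have lens: "length ys = ?n" "length fs = ?n" by (simp_all add: ys_def fs_def len)
    define z where "z = l' i (take i ys)"
    \<comment> \<open>The degree of \<open>z\<close> in L, since the inner operation has degree 2 -
      i.\<close>
    define p where "p = sum_list (take i fs) + 2 - int i"
    have take: "homog L (take i fs) (take i ys)" by (rule homog_take[OF ys])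
    have lt: "length (take i ys) = i" "take i ys \<noteq> []" using i lens by auto
    from lt have "z \<in> L p"
      using skew_maps_in[OF l' take] by (simp only: z_def p_def not_False_eq_True simp_thms)
    then have zs: "homog L (p # drop i fs) (z # drop i ys)"
      using homog_drop[OF ys, of i] by (simp add: homog_def)
    have "desuspend l' (take i ys) = s ((-1) powi decalage_exp (take i fs)) z"
      by (simp only: desuspend_homogeneous[OF l' take] z_def lt(1))
    then have "?F (take i ys) (drop i ys) =
        s ((-1) powi decalage_exp (take i fs)) (desuspend l (z # drop i ys))"
      by (simp add: multilinear_scale_Cons[OF graded_symmetricD[OF g]])
    also have "desuspend l (z # drop i ys) =
        s ((-1) powi decalage_exp (p # drop i fs)) (l (?n + 1 - i) (z # drop i ys))"
      using i lens by (simp add: desuspend_homogeneous[OF l zs] Suc_diff_le)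
    also have "s ((-1) powi decalage_exp (take i fs)) \<dots> =
        s ((-1) powi (decalage_exp (take i fs) + decalage_exp (p # drop i fs)))
          (l (?n + 1 - i) (z # drop i ys))"
      by (simp add: power_int_add)
    also have "decalage_exp (take i fs) + decalage_exp (p # drop i fs) =
        decalage_exp fs + int (?n - i) * (2 - int i)"
    proof -
      have "decalage_exp (take i fs @ drop i fs) = decalage_exp (take i fs) +
          int (?n - i) * sum_list (take i fs) + decalage_exp (drop i fs)"
        unfolding decalage_exp_append by (simp add: lens)
      then show ?thesis by (simp add: p_def lens algebra_simps)
    qed
    also have "((-1) powi (decalage_exp fs + int (?n - i) * (2 - int i)) :: 'k) =
        (-1) powi decalage_exp fs * (-1) ^ (i * (?n - i))"
      by (simp add: powi_minus_one minus_one_power_iff)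
    finally have "?F (take i ys) (drop i ys) =
        s ((-1) powi decalage_exp fs * (-1) ^ (i * (?n - i))) (l (?n + 1 - i) (z # drop i ys))" .
    then have "?h i \<sigma> = s (koszul_sign ?es \<sigma> * (-1) powi decalage_exp fs * (-1) ^ (i * (?n - i)))
        (l (?n + 1 - i) (z # drop i ys))"
      by (simp only: ys_def scale_scale mult.assoc)
    also have "koszul_sign ?es \<sigma> * (-1) powi decalage_exp fs =
        ((-1) powi decalage_exp ds * skew_koszul_sign ds \<sigma> :: 'k)"
      using skew_koszul_sign_decalage[of \<sigma> ds, where 'k = 'k] \<sigma> len by (simp add: fs_def mult.commute)
    finally have "?h i \<sigma> = s ((-1) powi decalage_exp ds * skew_koszul_sign ds \<sigma> * (-1) ^ (i * (?n - i)))
        (l (?n + 1 - i) (z # drop i ys))" .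
    moreover have "?n + 1 - i - 1 = ?n - i" by simp
    ultimately show ?thesis by (simp only: z_def ys_def scale_scale mult.assoc)
  qed
  have "unshuffle xs ?F = (\<Sum>i\<le>?n. \<Sum>\<sigma>\<in>shuffle_perms i (?n - i). ?h i \<sigma>)"
    using xs by (intro unshuffle_shuffles vs graded_symmetric2_multilinear2
        graded_symmetric2_insert g g') (simp add: homog_desusp)
  also have "\<dots> = (\<Sum>i\<in>{1..?n}. \<Sum>\<sigma>\<in>shuffle_perms i (?n - i). ?h i \<sigma>)"
    using multilinear_zero_Cons[OF graded_symmetricD[OF g]]
    by (intro sum.mono_neutral_right) (auto simp: not_le Suc_le_eq desuspend_Nil[OF l'])
  also have "\<dots> = (\<Sum>i\<in>{1..?n}. \<Sum>\<sigma>\<in>shuffle_perms i (?n - i). s ((-1) powi decalage_exp ds) (?f i (?n + 1 - i) \<sigma>))"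
    by (intro sum.cong refl summand)
  also have "\<dots> = s ((-1) powi decalage_exp ds)
      (\<Sum>i\<in>{1..?n}. \<Sum>\<sigma>\<in>shuffle_perms i (?n - i). ?f i (?n + 1 - i) \<sigma>)"
    by (simp only: scale_sum_right)
  also have "(\<Sum>i\<in>{1..?n}. \<Sum>\<sigma>\<in>shuffle_perms i (?n - i). ?f i (?n + 1 - i) \<sigma>) = jacobi l l' ds xs"
    unfolding jacobi_def Let_def
    by (rule sum.reindex_bij_witness[of _ fst "\<lambda>i. (i, ?n + 1 - i)"]) auto
  finally show ?thesis .
qed

lemma jacobi_iff_anticommutator:
  assumes l: "skew_maps s L l" and l': "skew_maps s L l'"
  shows "(\<forall>n\<ge>1. \<forall>ds xs. length xs = n \<and> homog L ds xs \<longrightarrow> jacobi l l' ds xs + jacobi l' l ds xs = 0) \<longleftrightarrow>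
    anticommutator (coder_of (desuspend l)) (coder_of (desuspend l')) = zero_map"
proof -
  note vs = vector_space_axioms
  note c = corestriction_desuspend[OF l] and c' = corestriction_desuspend[OF l']
  note g = graded_symmetric_corestriction[OF c] and g' = graded_symmetric_corestriction[OF c']
  let ?d = "desuspend l" and ?e = "desuspend l'"
  let ?U = "\<lambda>w. unshuffle w (\<lambda>a b. ?d (?e a # b) + ?e (?d a # b))"
  have U: "?U xs = s ((-1) powi decalage_exp ds) (jacobi l l' ds xs + jacobi l' l ds xs)"
    if "homog L ds xs" for ds xs
    by (simp add: unshuffle_add unshuffle_jacobi[OF l l' that] unshuffle_jacobi[OF l' l that]
        scale_right_distrib)
  have mU: "multilinear s ?U"
    unfolding unshuffle_add
    by (intro multilinear_fun_add vs graded_symmetricD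
        graded_symmetric_unshuffle graded_symmetric2_insert g g')
  have m0: "multilinear s (\<lambda>w. 0)" by (simp add: multilinear_def)
  show ?thesis
    unfolding anticommutator_eq_zero_iff[OF c c']
  proof (intro iffI allI impI)
    fix w
    assume j: "\<forall>n\<ge>1. \<forall>ds xs. length xs = n \<and> homog L ds xs \<longrightarrow> jacobi l l' ds xs + jacobi l' l ds xs = 0"
    show "?U w = 0"
    proof (rule homogeneous_ext[OF mU m0])
      fix es ys assume "homog (desusp L) es ys"
      then have ys: "homog L (map (\<lambda>d. d + 1) es) ys" by (simp add: homog_desusp')
      show "?U ys = 0"
      \<comment> \<open>The Jacobi identities start at n = 1, so the empty word is treated by the
        value 0 of both maps there.\<close>
      proof (cases "ys = []")
        case True
        then show ?thesis
          using multilinear_zero_Cons[OF graded_symmetricD[OF g]]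
            multilinear_zero_Cons[OF graded_symmetricD[OF g']]
          by (simp add: desuspend_Nil[OF l] desuspend_Nil[OF l'])
      next
        case False
        then have "1 \<le> length ys" by (simp add: Suc_le_eq)
        then show ?thesis using j ys U[OF ys] by simp
      qed
    qed
  next
    fix n ds xs
    assume u: "\<forall>w. ?U w = 0" and "length xs = n \<and> homog L ds xs"
    then have "s ((-1) powi decalage_exp ds) (jacobi l l' ds xs + jacobi l' l ds xs) = 0"
      using U[of ds xs] by simp
    then show "jacobi l l' ds xs + jacobi l' l ds xs = 0"
      by (simp add: powi_minus_one split: if_splits)
  qed
qed

text \<open>For \<open>l = l'\<close> the anticommutator yields the Jacobi sum twice; characteristic
  0 removes the factor 2.\<close>

lemma double_eq_zero_iff: "(x :: 'v) + x = 0 \<longleftrightarrow> x = 0"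
proof
  assume "x + x = 0"
  then have "s 2 x = 0" using scale_left_distrib[of 1 1 x] by simp
  then show "x = 0" by simp
qed simp

lemma L_infinity_iff:
  "L_infinity_algebra s L l \<longleftrightarrow> skew_maps s L l \<and>
     anticommutator (coder_of (desuspend l)) (coder_of (desuspend l)) = zero_map"
proof (cases "skew_maps s L l")
  case True
  then show ?thesis
    unfolding jacobi_iff_anticommutator[OF True True, symmetric] double_eq_zero_iff
    by (auto simp: L_infinity_algebra_def jacobi_def)
qed (simp add: L_infinity_algebra_def)

lemma compatible_iff:
  "compatible_L_infinity_algebra s L l l' \<longleftrightarrow> skew_maps s L l \<and> skew_maps s L l' \<and>
     anticommutator (coder_of (desuspend l)) (coder_of (desuspend l)) = zero_map \<and>
     anticommutator (coder_of (desuspend l')) (coder_of (desuspend l')) = zero_map \<and>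
     anticommutator (coder_of (desuspend l)) (coder_of (desuspend l')) = zero_map"
proof -
  have "jacobi l l' ds xs + jacobi l' l ds xs =
      (\<Sum>(i, j)\<in>{(i, j). 1 \<le> i \<and> 1 \<le> j \<and> i + j = length xs + 1}.
        \<Sum>\<sigma>\<in>shuffle_perms i (length xs - i).
          let ys = permute_list \<sigma> xs
          in s (skew_koszul_sign ds \<sigma> * (-1) ^ (i * (j - 1)))
               (l j (l' i (take i ys) # drop i ys) + l' j (l i (take i ys) # drop i ys)))" for ds xs
    by (simp add: jacobi_def Let_def scale_right_distrib sum.distrib[symmetric] case_prod_unfold)
  note j = this
  show ?thesis
  proof (cases "skew_maps s L l \<and> skew_maps s L l'")
    case True
    then show ?thesis
      unfolding compatible_L_infinity_algebra_def L_infinity_iff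
        jacobi_iff_anticommutator[OF conjunct1[OF True] conjunct2[OF True], symmetric] j
      by auto
  qed (auto simp: compatible_L_infinity_algebra_def L_infinity_iff)
qed

section \<open>Maurer-Cartan elements\<close>

text \<open>Scaling a representative by 1/2 removes the factor 2 from the middle component of the
  bracket.\<close>

lemma coset_double_eq_zero:
  assumes "A \<in> sym.Q" "A + A = sym.K"
  shows "A = sym.K"
proof -
  obtain f where f: "A = f +o sym.K" "keys f \<subseteq> {w. w \<noteq> []}" using sym.Q_cases[OF assms(1)] .
  have "(f + f) +o sym.K = 0 +o sym.K" using assms(2) by (simp add: f(1) sym.coset_add)
  then have "f + f \<in> sym.K" by (simp only: sym.coset_eq diff_zero)
  then have "pscale (1 / 2) (f + f) \<in> sym.K" by (rule free.span_scale)
  moreover have "pscale (1 / 2) (f + f) = f"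
    by (rule poly_mapping_eqI) (simp add: lookup_add)
  ultimately have "f +o sym.K = 0 +o sym.K" by (simp only: sym.coset_eq diff_zero)
  then show ?thesis by (simp add: f(1))
qed

text \<open>For the middle component both index pairs (1, 2) and (2, 1) occur, and they give the
  same map because the anticommutator is symmetric.\<close>

lemma Coder_c_bracket_pair:
  assumes "D \<in> hom" "E \<in> hom"
  shows "Coder_c_bracket s (desusp L) [D, E] [D, E] =
    [anticommutator D D, (\<lambda>A\<in>sym.Q. anticommutator D E A + anticommutator D E A), anticommutator E E]"
proof -
  have br: "coder_bracket s (desusp L) 1 1 F G A = anticommutator F G A"
    if "F \<in> hom" "G \<in> hom" "A \<in> sym.Q" for F G A
    using that end'.coset_hom_in_Q[OF that(1)] end'.coset_hom_in_Q[OF that(2)]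
    by (simp add: coder_bracket_def anticommutator_def coalgebra_eqs)
  have Q: "anticommutator F G A \<in> sym.Q" if "F \<in> hom" "G \<in> hom" "A \<in> sym.Q" for F G A
    by (rule end'.coset_hom_in_Q[OF anticommutator_hom[OF that(1,2)] that(3)])
  have comm: "anticommutator E D = anticommutator D E"
    by (auto simp: anticommutator_def fun_eq_iff add.commute)
  have res: "(\<lambda>A\<in>sym.Q. anticommutator F G A) = anticommutator F G" for F G
    by (auto simp: anticommutator_def fun_eq_iff)
  let ?S = "\<lambda>i. {(p, q). p + q = i + 1 \<and> 1 \<le> p \<and> p \<le> 1 + 1 \<and> 1 \<le> q \<and> q \<le> 1 + (1 :: nat)}"
  let ?f = "\<lambda>i A. (\<Sum>(p, q)\<in>?S i. coder_bracket s (desusp L) 1 1 ([D, E] ! (p - 1)) ([D, E] ! (q - 1)) A) + sym.K"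
  have S: "?S 1 = {(1, 1)}" "?S 2 = {(1, 2), (2, 1)}" "?S 3 = {(2, 2)}"
    by auto
  have f: "?f 1 A = anticommutator D D A" "?f 2 A = anticommutator D E A + anticommutator D E A"
    "?f 3 A = anticommutator E E A" if "A \<in> sym.Q" for A
    unfolding S using assms that by (simp_all add: br Q comm)
  have "Coder_c_bracket s (desusp L) [D, E] [D, E] = [\<lambda>A\<in>sym.Q. ?f 1 A, \<lambda>A\<in>sym.Q. ?f 2 A, \<lambda>A\<in>sym.Q. ?f 3 A]"
    unfolding Coder_c_bracket_def coalgebra_eqs by (simp add: Let_def upt_rec numeral_2_eq_2 numeral_3_eq_3)
  also have "\<dots> =
    [(\<lambda>A\<in>sym.Q. anticommutator D D A), (\<lambda>A\<in>sym.Q. anticommutator D E A + anticommutator D E A),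
     (\<lambda>A\<in>sym.Q. anticommutator E E A)]"
    using f by (intro arg_cong2[of _ _ _ _ "(#)"] restrict_ext refl)
  finally show ?thesis by (simp only: res)
qed

lemma maurer_cartan_iff:
  "\<theta> \<in> maurer_cartan (Coder_c s (desusp L)) (Coder_c_zero s (desusp L)) (Coder_c_bracket s (desusp L)) \<longleftrightarrow>
    (\<exists>D E. \<theta> = [D, E] \<and> D \<in> Coder s (desusp L) 1 \<and> E \<in> Coder s (desusp L) 1 \<and>
       anticommutator D D = zero_map \<and> anticommutator E E = zero_map \<and> anticommutator D E = zero_map)"
proof -
  have "\<theta> \<in> Coder_c s (desusp L) 1 \<longleftrightarrow>
      (\<exists>D E. \<theta> = [D, E] \<and> D \<in> Coder s (desusp L) 1 \<and> E \<in> Coder s (desusp L) 1)"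
    by (auto simp: Coder_c_def length_Suc_conv numeral_2_eq_2)
  moreover have "Coder_c_bracket s (desusp L) [D, E] [D, E] = Coder_c_zero s (desusp L) 2 \<longleftrightarrow>
      anticommutator D D = zero_map \<and> anticommutator E E = zero_map \<and> anticommutator D E = zero_map"
    if "D \<in> Coder s (desusp L) 1" "E \<in> Coder s (desusp L) 1" for D E
  proof -
    note h = Coder_hom[OF that(1)] Coder_hom[OF that(2)]
    have "(\<lambda>A\<in>sym.Q. anticommutator D E A + anticommutator D E A) = zero_map \<longleftrightarrow>
        anticommutator D E = zero_map"
    proof
      assume z: "(\<lambda>A\<in>sym.Q. anticommutator D E A + anticommutator D E A) = zero_map"
      show "anticommutator D E = zero_map"
      proof
        fix A
        show "anticommutator D E A = zero_map A"
        proof (cases "A \<in> sym.Q")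
          case True
          then have "anticommutator D E A \<in> sym.Q"
            by (rule end'.coset_hom_in_Q[OF anticommutator_hom[OF h]])
          moreover have "anticommutator D E A + anticommutator D E A = sym.K"
            using fun_cong[OF z, of A] True by simp
          ultimately have "anticommutator D E A = sym.K" by (rule coset_double_eq_zero)
          then show ?thesis using True by simp
        qed (simp add: anticommutator_def)
      qed
    next
      assume z: "anticommutator D E = zero_map"
      show "(\<lambda>A\<in>sym.Q. anticommutator D E A + anticommutator D E A) = zero_map"
        unfolding z by (auto simp: fun_eq_iff)
    qed
    then show ?thesis
      unfolding Coder_c_bracket_pair[OF h] Coder_c_zero_def coalgebra_eqs
      by (auto simp: numeral_3_eq_3)
  qed
  ultimately show ?thesis by (auto simp: maurer_cartan_def)
qed

text \<open>The two sums of words differ in the free space: the recursion contains words beginning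
  with the letter 0 and writes signs by means of parts of letters. They agree in SV, which is tested
  on functionals.\<close>

lemma induced_coder_coder_of:
  assumes l: "skew_maps s L l"
  shows "induced_coder s L l (coder_of (desuspend l))"
  unfolding induced_coder_def coalgebra_eqs
proof (intro allI impI)
  fix ds xs assume "xs \<noteq> [] \<and> homog L ds xs"
  then have ne: "xs \<noteq> []" and xs: "homog L ds xs" by simp_all
  note c = corestriction_desuspend[OF l]
  note g = graded_symmetric_corestriction[OF c] and vs = scalar_vs
  let ?n = "length xs" and ?es = "map (\<lambda>d. d - 1) ds" and ?d = "desuspend l"
  let ?R = "\<Sum>i\<in>{1..?n}. \<Sum>\<sigma>\<in>shuffle_perms i (?n - i).
    let ys = permute_list \<sigma> xs; es = permute_list \<sigma> ds
    in single (decalage s l (take i es) (take i ys) # drop i ys) (koszul_sign ?es \<sigma> :: 'k)"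
  have "coder_of ?d (cls xs) = unshuffle xs (\<lambda>a b. single (?d a # b) 1) +o sym.K"
    using ne by (simp add: coder_of_def end'.lift_coset[OF coder_of_annihilates[OF c]])
  also have "\<dots> = ?R +o sym.K"
  proof (rule sym.coset_eq_functionals)
    fix t :: "'v list \<Rightarrow> 'k" assume "annihilates (*) (sym_rels s (desusp L)) t"
    then have t: "graded_symmetric (*) t" by (simp add: annihilates_iff)
    let ?h = "\<lambda>i \<sigma>. koszul_sign ?es \<sigma> * t (?d (take i (permute_list \<sigma> xs)) # drop i (permute_list \<sigma> xs))"
    have "lext (*) t (unshuffle xs (\<lambda>a b. single (?d a # b) 1)) =
        (\<Sum>i\<le>?n. \<Sum>\<sigma>\<in>shuffle_perms i (?n - i). ?h i \<sigma>)"
      unfolding lext_unshuffle_insert[OF c vs]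
      using xs by (intro unshuffle_shuffles vs graded_symmetric2_multilinear2
          graded_symmetric2_insert g t) (simp add: homog_desusp)
    also have "\<dots> = (\<Sum>i\<in>{1..?n}. \<Sum>\<sigma>\<in>shuffle_perms i (?n - i). ?h i \<sigma>)"
      using multilinear_zero_Cons[OF graded_symmetricD[OF t]]
      by (intro sum.mono_neutral_right) (auto simp: not_le Suc_le_eq desuspend_Nil[OF l])
    also have "\<dots> = lext (*) t ?R"
      unfolding scalar.lext_sum Let_def
    proof (intro sum.cong refl)
      fix i \<sigma> assume "i \<in> {1..?n}" "\<sigma> \<in> shuffle_perms i (?n - i)"
      then have "\<sigma> permutes {..<?n}" using shuffle_perms_permutes by fastforce
      then have "homog L (take i (permute_list \<sigma> ds)) (take i (permute_list \<sigma> xs))"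
        by (intro homog_take homog_permute xs)
      then show "?h i \<sigma> = lext (*) t (single (decalage s l (take i (permute_list \<sigma> ds))
          (take i (permute_list \<sigma> xs)) # drop i (permute_list \<sigma> xs)) (koszul_sign ?es \<sigma>))"
        by (simp add: desuspend_decalage[OF l])
    qed
    finally show "lext (*) t (unshuffle xs (\<lambda>a b. single (?d a # b) 1)) = lext (*) t ?R" .
  qed
  finally show "coder_of ?d (cls xs) = ?R +o sym.K" .
qed

text \<open>A family is recovered from its coderivation by taking the corestriction and applying
  \<open>suspend\<close>. The same recipe yields a preimage of a given coderivation, because the
  extension of a corestriction is unique. The vanishing conditions on the two sides are matched by
  \<open>compatible_iff\<close> and \<open>maurer_cartan_iff\<close>.\<close>

lemma bij_betw_maurer_cartan:
  "bij_betw (\<lambda>(l, l'). [coder_of (desuspend l), coder_of (desuspend l')])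
    {(l, l'). compatible_L_infinity_algebra s L l l'}
    (maurer_cartan (Coder_c s (desusp L)) (Coder_c_zero s (desusp L)) (Coder_c_bracket s (desusp L)))"
  (is "bij_betw ?\<Phi> ?C ?M")
proof -
  have inj: "l = m" if "skew_maps s L l" "skew_maps s L m"
    "coder_of (desuspend l) = coder_of (desuspend m)" for l m
  proof -
    have "desuspend l = desuspend m"
      using dual_coder_of_letter[OF corestriction_desuspend[OF that(1)]]
      unfolding that(3) dual_coder_of_letter[OF corestriction_desuspend[OF that(2)]] by (rule sym)
    from arg_cong[OF this, of suspend] show ?thesis
      unfolding suspend_desuspend[OF that(1)] suspend_desuspend[OF that(2)] .
  qed
  have surj: "\<exists>l. skew_maps s L l \<and> coder_of (desuspend l) = D" if "D \<in> Coder s (desusp L) 1" for D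
  proof -
    note c = corestriction_Coder[OF that]
    show ?thesis
      using skew_maps_suspend[OF c] desuspend_suspend[OF c] coder_of_corestriction[OF that] by metis
  qed
  show ?thesis
    unfolding bij_betw_def
  proof
    show "inj_on ?\<Phi> ?C"
      by (rule inj_onI) (auto simp: compatible_iff dest: inj)
    show "?\<Phi> ` ?C = ?M"
    proof (intro subset_antisym subsetI)
      fix \<theta> assume "\<theta> \<in> ?\<Phi> ` ?C"
      then obtain l l' where "\<theta> = [coder_of (desuspend l), coder_of (desuspend l')]"
        "compatible_L_infinity_algebra s L l l'" by auto
      then show "\<theta> \<in> ?M"
        unfolding maurer_cartan_iff compatible_iff
        using coder_of_Coder[OF corestriction_desuspend] by blast
    next
      fix \<theta> assume "\<theta> \<in> ?M"
      then obtain D E where \<theta>: "\<theta> = [D, E]" and D: "D \<in> Coder s (desusp L) 1" and E: "E \<in> Coder s (desusp L) 1"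
        and z: "anticommutator D D = zero_map" "anticommutator E E = zero_map" "anticommutator D E = zero_map"
        unfolding maurer_cartan_iff by blast
      obtain l l' where l: "skew_maps s L l" "coder_of (desuspend l) = D"
        and l': "skew_maps s L l'" "coder_of (desuspend l') = E"
        using surj[OF D] surj[OF E] by blast
      then have "compatible_L_infinity_algebra s L l l'" using z by (simp add: compatible_iff)
      then show "\<theta> \<in> ?\<Phi> ` ?C" using l l' \<theta> by (intro image_eqI[of _ _ "(l, l')"]) auto
    qed
  qed
qed

end

theorem theorem3p4:
  fixes s :: "'k::field_char_0 \<Rightarrow> 'v::ab_group_add \<Rightarrow> 'v" and L :: "int \<Rightarrow> 'v set"
  assumes "graded_vector_space s L"
  defines "V \<equiv> desusp L"
  shows "\<exists>\<Phi>. bij_betw \<Phi> {(l, l'). compatible_L_infinity_algebra s L l l'}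
                (maurer_cartan (Coder_c s V) (Coder_c_zero s V) (Coder_c_bracket s V)) \<and>
             (\<forall>l l'. compatible_L_infinity_algebra s L l l' \<longrightarrow>
                (\<exists>D D'. \<Phi> (l, l') = [D, D'] \<and> induced_coder s L l D \<and> induced_coder s L l' D'))"
proof -
  interpret desuspended_space s L by unfold_locales (rule assms(1))
  show ?thesis
    unfolding V_def
    by (rule exI, rule conjI[OF bij_betw_maurer_cartan])
      (auto simp: compatible_iff induced_coder_coder_of)
qed

end
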